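(* Let $\mathbf{X}=(X,\omega_1,\omega_2,\mathbf{g})$ be an almost $2$-Kähler manifold and let $t\in\mathbb{R}$, $t>0$. Then: 1) $\alpha_t(\mathbf{X})$, $\beta_t(\mathbf{X})$ and $\lambda_t(\mathbf{X})$ are almost $2$-Kähler manifolds. 2) The deformations $\alpha_t$ and $\beta_t$ leave the dualizing form $\omega_D$ unchanged. In particular, if $\mathbf{X}$ is weakly self-dual (respectively self-dual), then $\alpha_t(\mathbf{X})$ and $\beta_t(\mathbf{X})$ are weakly self-dual (respectively self-dual). 3) For $i\in\{1,2\}$, if $\omega_i$ is covariant constant with respect to the Levi-Civita connection of $\mathbf{g}$, then it is also covariant constant with respect to the Levi-Civita connections of $\alpha_t(\mathbf{g})$ and of $\beta_t(\mathbf{g})$.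
   Context: For a $2$-form $\alpha$, $\alpha^\perp$ denotes the distribution of vectors $v$ with $\iota_v\alpha=0$. A polysymplectic structure on a vector space $V$ of dimension $n(s+1)$ is given by $\omega_1,\dots,\omega_s\in\Lambda^2V^*$ for which there is a basis $v_1,\dots,v_n,w^1_1,\dots,w^s_n$ of $V$ (a standard polysymplectic basis) with $\omega_j=\sum_{i=1}^n v_i^*\wedge (w_i^j)^*$ for all $j$. A polysymplectic manifold is a smooth manifold $X$ of dimension $n(s+1)$ with smooth closed $2$-forms $\omega_1,\dots,\omega_s$ inducing a polysymplectic structure on each $T_pX$ and such that $\sum_j\omega_j^\perp$ is an integrable distribution. A Riemannian metric $\mathbf{g}$ is compatible with it if every $T_pX$ has a $\mathbf{g}$-orthonormal standard polysymplectic basis; then $(X,\omega_1,\dots,\omega_s,\mathbf{g})$ is an almost $s$-Kähler manifold. On an almost $2$-Kähler manifold the dualizing form is the (well defined) $2$-form $\omega_D=\sum_{i=1}^n (w_i^1)^*\wedge(w_i^2)^*$ at $p$, for any orthonormal standard polysymplectic basis of $T_pX$. The manifold is weakly self-dual if $d\omega_D=0$; it is self-dual if moreover all leaves of the foliation $\omega_1^\perp+\omega_2^\perp$ have Riemannian volume one. Deformations, for $t>0$: $\alpha_t(\mathbf{X})=(X,t\omega_1,\omega_2,\alpha_t(\mathbf{g}))$, where $\alpha_t(\mathbf{g})$ is the metric for which any $\mathbf{g}$-orthonormal standard polysymplectic basis $v_1,\dots,v_n,w_1^1,\dots,w_n^2$ of $T_pX$ (with respect to $\omega_1,\omega_2$)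 is orthogonal, with $v_i$ and $w_i^1$ of squared length $t$ and $w_i^2$ of squared length $t^{-1}$; $\beta_t(\mathbf{X})=(X,\omega_1,t\omega_2,\beta_t(\mathbf{g}))$, where $\beta_t(\mathbf{g})$ is defined in the same way with the upper indices $1$ and $2$ exchanged (so $v_i,w^2_i$ have squared length $t$ and $w^1_i$ squared length $t^{-1}$); $\lambda_t(\mathbf{X})=(X,t\omega_1,t\omega_2,t\mathbf{g})$. *)

theory Defs
  imports "HOL-Analysis.Analysis"
begin

section \<open>Smooth functions on open subsets of Euclidean spaces\<close>

primrec Ck_on :: "nat \<Rightarrow> 'a::real_normed_vector set \<Rightarrow> ('a \<Rightarrow> 'b::real_normed_vector) \<Rightarrow> bool" where
  "Ck_on 0 S f \<longleftrightarrow> continuous_on S f"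
| "Ck_on (Suc k) S f \<longleftrightarrow>
     (\<forall>x\<in>S. f differentiable (at x)) \<and> (\<forall>v. Ck_on k S (\<lambda>x. frechet_derivative f (at x) v))"

definition smooth_on :: "'a::real_normed_vector set \<Rightarrow> ('a \<Rightarrow> 'b::real_normed_vector) \<Rightarrow> bool" where
  "smooth_on S f \<longleftrightarrow> open S \<and> (\<forall>k. Ck_on k S f)"


section \<open>Smooth manifolds\<close>

text \<open>A manifold is given by an atlas; its point set is the union of the chart domains and its
  topology is the one induced by the charts. A chart is a pair of a domain and a coordinate map,
  whose values outside the domain are irrelevant.\<close>

type_synonym ('a, 'e) chart = "'a set \<times> ('a \<Rightarrow> 'e)"
type_synonym ('a, 'e) atlas = "('a, 'e) chart set"

definition chart_inv :: "('a, 'e) chart \<Rightarrow> 'e \<Rightarrow> 'a" where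
  "chart_inv c = inv_into (fst c) (snd c)"

definition chart_range :: "('a, 'e) chart \<Rightarrow> 'e set" where
  "chart_range c = snd c ` fst c"

definition is_chart :: "('a, 'e::euclidean_space) chart \<Rightarrow> bool" where
  "is_chart c \<longleftrightarrow> inj_on (snd c) (fst c) \<and> open (chart_range c)"

definition compatible_charts ::
    "('a, 'e::euclidean_space) chart \<Rightarrow> ('a, 'e) chart \<Rightarrow> bool" where
  "compatible_charts c d \<longleftrightarrow>
     smooth_on (snd c ` (fst c \<inter> fst d)) (snd d \<circ> chart_inv c) \<and>
     smooth_on (snd d ` (fst c \<inter> fst d)) (snd c \<circ> chart_inv d)"

definition points :: "('a, 'e) atlas \<Rightarrow> 'a set" where
  "points M = (\<Union>c\<in>M. fst c)"

definition manifold_topology :: "('a, 'e::euclidean_space) atlas \<Rightarrow> 'a topology" where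
  "manifold_topology M =
     topology (\<lambda>U. U \<subseteq> points M \<and> (\<forall>c\<in>M. open (snd c ` (U \<inter> fst c))))"

definition smooth_manifold :: "('a, 'e::euclidean_space) atlas \<Rightarrow> bool" where
  "smooth_manifold M \<longleftrightarrow>
     (\<forall>c\<in>M. is_chart c) \<and> (\<forall>c\<in>M. \<forall>d\<in>M. compatible_charts c d) \<and>
     Hausdorff_space (manifold_topology M) \<and> second_countable (manifold_topology M)"

text \<open>The tangent space at a point \<open>p\<close> is the model space \<open>'e\<close>, a vector being identified with
  its coordinates in the reference chart \<open>chart_at M p\<close>. The reference chart varies
  discontinuously with \<open>p\<close>, so regularity of fields is only ever expressed after passing to the
  coordinates of one fixed chart, by \<open>from_coords\<close> and \<open>to_coords\<close>.\<close>

definition chart_at :: "('a, 'e) atlas \<Rightarrow> 'a \<Rightarrow> ('a, 'e) chart" where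
  "chart_at M p = (SOME c. c \<in> M \<and> p \<in> fst c)"

definition from_coords ::
    "('a, 'e::euclidean_space) atlas \<Rightarrow> ('a, 'e) chart \<Rightarrow> 'a \<Rightarrow> 'e \<Rightarrow> 'e" where
  "from_coords M c p = frechet_derivative (snd (chart_at M p) \<circ> chart_inv c) (at (snd c p))"

definition to_coords ::
    "('a, 'e::euclidean_space) atlas \<Rightarrow> ('a, 'e) chart \<Rightarrow> 'a \<Rightarrow> 'e \<Rightarrow> 'e" where
  "to_coords M c p =
     frechet_derivative (snd c \<circ> chart_inv (chart_at M p)) (at (snd (chart_at M p) p))"

definition smooth_map ::
    "('a, 'e::euclidean_space) atlas \<Rightarrow> ('b, 'f::euclidean_space) atlas \<Rightarrow> ('a \<Rightarrow> 'b) \<Rightarrow> bool" where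
  "smooth_map M N f \<longleftrightarrow>
     f ` points M \<subseteq> points N \<and>
     (\<forall>c\<in>M. \<forall>d\<in>N. smooth_on (snd c ` {p \<in> fst c. f p \<in> fst d}) (snd d \<circ> f \<circ> chart_inv c))"

definition tangent_map ::
    "('a, 'e::euclidean_space) atlas \<Rightarrow> ('b, 'f::euclidean_space) atlas \<Rightarrow> ('a \<Rightarrow> 'b) \<Rightarrow> 'a \<Rightarrow> 'e \<Rightarrow> 'f" where
  "tangent_map M N f p =
     frechet_derivative (snd (chart_at N (f p)) \<circ> f \<circ> chart_inv (chart_at M p))
       (at (snd (chart_at M p) p))"


section \<open>Bilinear tensor fields\<close>

type_synonym ('a, 'e) bifield = "'a \<Rightarrow> 'e \<Rightarrow> 'e \<Rightarrow> real"

definition local_form ::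
    "('a, 'e::euclidean_space) atlas \<Rightarrow> ('a, 'e) chart \<Rightarrow> ('a, 'e) bifield \<Rightarrow> 'e \<Rightarrow> 'e \<Rightarrow> 'e \<Rightarrow> real" where
  "local_form M c \<tau> x u v =
     (let p = chart_inv c x in \<tau> p (from_coords M c p u) (from_coords M c p v))"

definition smooth_bifield :: "('a, 'e::euclidean_space) atlas \<Rightarrow> ('a, 'e) bifield \<Rightarrow> bool" where
  "smooth_bifield M \<tau> \<longleftrightarrow>
     (\<forall>p\<in>points M. bilinear (\<tau> p)) \<and>
     (\<forall>c\<in>M. \<forall>u v. smooth_on (chart_range c) (\<lambda>x. local_form M c \<tau> x u v))"

definition two_form :: "('a, 'e::euclidean_space) atlas \<Rightarrow> ('a, 'e) bifield \<Rightarrow> bool" where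
  "two_form M \<omega> \<longleftrightarrow> smooth_bifield M \<omega> \<and> (\<forall>p\<in>points M. \<forall>u. \<omega> p u u = 0)"

definition inner_form :: "('v::real_vector \<Rightarrow> 'v \<Rightarrow> real) \<Rightarrow> bool" where
  "inner_form h \<longleftrightarrow>
     (\<forall>u. linear (h u)) \<and> (\<forall>u v. h u v = h v u) \<and> (\<forall>u. u \<noteq> 0 \<longrightarrow> h u u > 0)"

definition riemannian_metric :: "('a, 'e::euclidean_space) atlas \<Rightarrow> ('a, 'e) bifield \<Rightarrow> bool" where
  "riemannian_metric M g \<longleftrightarrow> smooth_bifield M g \<and> (\<forall>p\<in>points M. inner_form (g p))"

definition scale_form :: "real \<Rightarrow> ('a, 'e) bifield \<Rightarrow> ('a, 'e) bifield" where
  "scale_form t \<tau> = (\<lambda>p u v. t * \<tau> p u v)"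

definition partial_form ::
    "('a, 'e::euclidean_space) atlas \<Rightarrow> ('a, 'e) chart \<Rightarrow> ('a, 'e) bifield \<Rightarrow> 'e \<Rightarrow> 'e \<Rightarrow> 'e \<Rightarrow> 'e \<Rightarrow> real" where
  "partial_form M c \<tau> x u v w = frechet_derivative (\<lambda>y. local_form M c \<tau> y v w) (at x) u"

definition exterior_deriv ::
    "('a, 'e::euclidean_space) atlas \<Rightarrow> ('a, 'e) chart \<Rightarrow> ('a, 'e) bifield \<Rightarrow> 'e \<Rightarrow> 'e \<Rightarrow> 'e \<Rightarrow> 'e \<Rightarrow> real" where
  "exterior_deriv M c \<omega> x u v w =
     partial_form M c \<omega> x u v w - partial_form M c \<omega> x v u w + partial_form M c \<omega> x w u v"

definition closed_two_form :: "('a, 'e::euclidean_space) atlas \<Rightarrow> ('a, 'e) bifield \<Rightarrow> bool" where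
  "closed_two_form M \<omega> \<longleftrightarrow>
     two_form M \<omega> \<and> (\<forall>c\<in>M. \<forall>x\<in>chart_range c. \<forall>u v w. exterior_deriv M c \<omega> x u v w = 0)"


section \<open>The Levi-Civita connection\<close>

text \<open>In a chart, a connection has the form \<open>\<nabla>\<^sub>u Y = D\<^sub>u Y + \<Gamma> u Y\<close>, where \<open>\<Gamma>\<close> is the bilinear map of
  Christoffel symbols at the point under consideration, and it acts on bilinear forms by the
  Leibniz rule. The Levi-Civita connection is the unique one that is torsion-free
  (\<open>\<Gamma>\<close> is symmetric) and satisfies \<open>\<nabla>g = 0\<close>.\<close>

definition cov_deriv ::
    "('a, 'e::euclidean_space) atlas \<Rightarrow> ('a, 'e) chart \<Rightarrow> ('e \<Rightarrow> 'e \<Rightarrow> 'e) \<Rightarrow> ('a, 'e) bifield \<Rightarrow>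
     'e \<Rightarrow> 'e \<Rightarrow> 'e \<Rightarrow> 'e \<Rightarrow> real" where
  "cov_deriv M c \<Gamma> \<tau> x u v w =
     partial_form M c \<tau> x u v w - local_form M c \<tau> x (\<Gamma> u v) w - local_form M c \<tau> x v (\<Gamma> u w)"

definition levi_civita ::
    "('a, 'e::euclidean_space) atlas \<Rightarrow> ('a, 'e) chart \<Rightarrow> ('a, 'e) bifield \<Rightarrow> 'e \<Rightarrow> 'e \<Rightarrow> 'e \<Rightarrow> 'e" where
  "levi_civita M c g x =
     (THE \<Gamma>. bilinear \<Gamma> \<and> (\<forall>u v. \<Gamma> u v = \<Gamma> v u) \<and> (\<forall>u v w. cov_deriv M c \<Gamma> g x u v w = 0))"

definition covariantly_constant ::
    "('a, 'e::euclidean_space) atlas \<Rightarrow> ('a, 'e) bifield \<Rightarrow> ('a, 'e) bifield \<Rightarrow> bool" where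
  "covariantly_constant M g \<tau> \<longleftrightarrow>
     (\<forall>c\<in>M. \<forall>x\<in>chart_range c. \<forall>u v w. cov_deriv M c (levi_civita M c g x) \<tau> x u v w = 0)"


section \<open>Distributions and their leaves\<close>

text \<open>A distribution is integrable if it is tangent to a foliation: around every point there is a
  smoothly compatible chart in which it is a constant subspace of the model space.\<close>

definition integrable_distribution ::
    "('a, 'e::euclidean_space) atlas \<Rightarrow> ('a \<Rightarrow> 'e set) \<Rightarrow> bool" where
  "integrable_distribution M D \<longleftrightarrow>
     (\<exists>k. \<forall>p\<in>points M. \<exists>c F.
        is_chart c \<and> p \<in> fst c \<and> fst c \<subseteq> points M \<and> (\<forall>d\<in>M. compatible_charts c d) \<and>
        subspace F \<and> dim F = k \<and> (\<forall>q\<in>fst c. D q = {u. to_coords M c q u \<in> F}))"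

definition immersed_submanifold ::
    "('a, 'e::euclidean_space) atlas \<Rightarrow> ('a, 'f::euclidean_space) atlas \<Rightarrow> bool" where
  "immersed_submanifold M N \<longleftrightarrow>
     smooth_manifold N \<and> smooth_map N M id \<and> (\<forall>q\<in>points N. inj (tangent_map N M id q))"

definition connected_integral_manifold ::
    "('a, 'e::euclidean_space) atlas \<Rightarrow> ('a \<Rightarrow> 'e set) \<Rightarrow> ('a, 'f::euclidean_space) atlas \<Rightarrow> bool" where
  "connected_integral_manifold M D N \<longleftrightarrow>
     immersed_submanifold M N \<and> (\<forall>q\<in>points N. range (tangent_map N M id q) = D q) \<and>
     points N \<noteq> {} \<and> connected_space (manifold_topology N)"

definition leaf ::
    "('a, 'e::euclidean_space) atlas \<Rightarrow> ('a \<Rightarrow> 'e set) \<Rightarrow> ('a, 'f::euclidean_space) atlas \<Rightarrow> bool" where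
  "leaf M D N \<longleftrightarrow>
     connected_integral_manifold M D N \<and>
     (\<forall>N'::('a, 'f) atlas. connected_integral_manifold M D N' \<and> points N \<subseteq> points N' \<longrightarrow>
        points N' = points N)"

definition induced_metric ::
    "('a, 'e::euclidean_space) atlas \<Rightarrow> ('a, 'e) bifield \<Rightarrow> ('a, 'f::euclidean_space) atlas \<Rightarrow> ('a, 'f) bifield" where
  "induced_metric M g N = (\<lambda>q u v. g q (tangent_map N M id q u) (tangent_map N M id q v))"


section \<open>Riemannian volume\<close>

definition volume_density ::
    "('a, real^'k) atlas \<Rightarrow> ('a, real^'k) chart \<Rightarrow> ('a, real^'k) bifield \<Rightarrow> real^'k \<Rightarrow> real" where
  "volume_density N c h x = sqrt (det (\<chi> i j. local_form N c h x (axis i 1) (axis j 1)))"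

definition riemannian_measure :: "('a, real^'k) atlas \<Rightarrow> ('a, real^'k) bifield \<Rightarrow> 'a measure" where
  "riemannian_measure N h =
     (THE \<mu>. space \<mu> = points N \<and>
        sets \<mu> = sigma_sets (points N) {U. openin (manifold_topology N) U} \<and>
        (\<forall>c\<in>N. \<forall>B\<in>sets \<mu>. B \<subseteq> fst c \<longrightarrow>
           emeasure \<mu> B = set_nn_integral lborel (snd c ` B) (\<lambda>x. ennreal (volume_density N c h x))))"

definition riemannian_volume :: "('a, real^'k) atlas \<Rightarrow> ('a, real^'k) bifield \<Rightarrow> ennreal" where
  "riemannian_volume N h = emeasure (riemannian_measure N h) (points N)"


section \<open>Polysymplectic structures on vector spaces\<close>

text \<open>A family \<open>v\<^sub>1, \<dots>, v\<^sub>n, w\<^sup>1\<^sub>1, \<dots>, w\<^sup>s\<^sub>n\<close> is given by \<open>v :: nat \<Rightarrow> 'v\<close> and \<open>w :: nat \<Rightarrow> nat \<Rightarrow> 'v\<close>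
  with \<open>w j i\<close> standing for \<open>w\<^sup>j\<^sub>i\<close>; all indices start from 1.\<close>

definition basis_set :: "nat \<Rightarrow> nat \<Rightarrow> (nat \<Rightarrow> 'v) \<Rightarrow> (nat \<Rightarrow> nat \<Rightarrow> 'v) \<Rightarrow> 'v set" where
  "basis_set n s v w = v ` {1..n} \<union> {w j i | i j. i \<in> {1..n} \<and> j \<in> {1..s}}"

definition is_basis ::
    "nat \<Rightarrow> nat \<Rightarrow> (nat \<Rightarrow> 'v::real_vector) \<Rightarrow> (nat \<Rightarrow> nat \<Rightarrow> 'v) \<Rightarrow> bool" where
  "is_basis n s v w \<longleftrightarrow>
     card (basis_set n s v w) = n * (s + 1) \<and>
     independent (basis_set n s v w) \<and> span (basis_set n s v w) = UNIV"

definition wedge :: "('v \<Rightarrow> real) \<Rightarrow> ('v \<Rightarrow> real) \<Rightarrow> 'v \<Rightarrow> 'v \<Rightarrow> real" where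
  "wedge \<phi> \<psi> = (\<lambda>a b. \<phi> a * \<psi> b - \<phi> b * \<psi> a)"

definition dual_vector :: "'v::real_vector set \<Rightarrow> 'v \<Rightarrow> 'v \<Rightarrow> real" where
  "dual_vector B b = (\<lambda>a. representation B a b)"

definition standard_basis ::
    "nat \<Rightarrow> nat \<Rightarrow> (nat \<Rightarrow> 'v::real_vector \<Rightarrow> 'v \<Rightarrow> real) \<Rightarrow> (nat \<Rightarrow> 'v) \<Rightarrow> (nat \<Rightarrow> nat \<Rightarrow> 'v) \<Rightarrow> bool" where
  "standard_basis n s \<omega> v w \<longleftrightarrow>
     is_basis n s v w \<and>
     (\<forall>j\<in>{1..s}. \<forall>a b. \<omega> j a b =
        (\<Sum>i=1..n. wedge (dual_vector (basis_set n s v w) (v i))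
                         (dual_vector (basis_set n s v w) (w j i)) a b))"

definition orthonormal_standard_basis ::
    "nat \<Rightarrow> nat \<Rightarrow> (nat \<Rightarrow> 'v::real_vector \<Rightarrow> 'v \<Rightarrow> real) \<Rightarrow> ('v \<Rightarrow> 'v \<Rightarrow> real) \<Rightarrow>
     (nat \<Rightarrow> 'v) \<Rightarrow> (nat \<Rightarrow> nat \<Rightarrow> 'v) \<Rightarrow> bool" where
  "orthonormal_standard_basis n s \<omega> h v w \<longleftrightarrow>
     standard_basis n s \<omega> v w \<and>
     (\<forall>a\<in>basis_set n s v w. \<forall>b\<in>basis_set n s v w. h a b = (if a = b then 1 else 0))"

definition form_kernel :: "('v \<Rightarrow> 'v \<Rightarrow> real) \<Rightarrow> 'v set" where
  "form_kernel \<alpha> = {v. \<forall>u. \<alpha> v u = 0}"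


section \<open>Almost Kaehler manifolds\<close>

definition kernel_sum :: "nat \<Rightarrow> (nat \<Rightarrow> ('a, 'e::real_vector) bifield) \<Rightarrow> 'a \<Rightarrow> 'e set" where
  "kernel_sum s \<omega> p = {\<Sum>j=1..s. x j | x. \<forall>j\<in>{1..s}. x j \<in> form_kernel (\<omega> j p)}"

definition polysymplectic_manifold ::
    "nat \<Rightarrow> nat \<Rightarrow> ('a, 'e::euclidean_space) atlas \<Rightarrow> (nat \<Rightarrow> ('a, 'e) bifield) \<Rightarrow> bool" where
  "polysymplectic_manifold n s M \<omega> \<longleftrightarrow>
     smooth_manifold M \<and> DIM('e) = n * (s + 1) \<and>
     (\<forall>j\<in>{1..s}. closed_two_form M (\<omega> j)) \<and>
     (\<forall>p\<in>points M. \<exists>v w. standard_basis n s (\<lambda>j. \<omega> j p) v w) \<and>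
     integrable_distribution M (kernel_sum s \<omega>)"

text \<open>Only the forms \<open>\<omega> j\<close> with \<open>1 \<le> j \<le> s\<close> are meaningful.\<close>

type_synonym ('a, 'e) kaehler_data =
  "('a, 'e) atlas \<times> (nat \<Rightarrow> ('a, 'e) bifield) \<times> ('a, 'e) bifield"

definition almost_kaehler :: "nat \<Rightarrow> nat \<Rightarrow> ('a, 'e::euclidean_space) kaehler_data \<Rightarrow> bool" where
  "almost_kaehler n s X \<longleftrightarrow>
     (case X of (M, \<omega>, g) \<Rightarrow>
       polysymplectic_manifold n s M \<omega> \<and> riemannian_metric M g \<and>
       (\<forall>p\<in>points M. \<exists>v w. orthonormal_standard_basis n s (\<lambda>j. \<omega> j p) (g p) v w))"

definition dualizing_form :: "nat \<Rightarrow> ('a, 'e::euclidean_space) kaehler_data \<Rightarrow> ('a, 'e) bifield" where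
  "dualizing_form n X =
     (case X of (M, \<omega>, g) \<Rightarrow> \<lambda>p. THE \<delta>. \<forall>v w.
        orthonormal_standard_basis n 2 (\<lambda>j. \<omega> j p) (g p) v w \<longrightarrow>
        \<delta> = (\<lambda>a b. \<Sum>i=1..n. wedge (dual_vector (basis_set n 2 v w) (w 1 i))
                                    (dual_vector (basis_set n 2 v w) (w 2 i)) a b))"

definition weakly_self_dual :: "nat \<Rightarrow> ('a, 'e::euclidean_space) kaehler_data \<Rightarrow> bool" where
  "weakly_self_dual n X \<longleftrightarrow> closed_two_form (fst X) (dualizing_form n X)"

text \<open>The model space of the manifold has dimension \<open>3n\<close> and that of the leaves dimension \<open>2n\<close>,
  where \<open>n\<close> is the cardinality of the type \<open>'n\<close>.\<close>

definition self_dual :: "('a, real^('n::finite + 'n + 'n)) kaehler_data \<Rightarrow> bool" where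
  "self_dual X \<longleftrightarrow>
     weakly_self_dual CARD('n) X \<and>
     (case X of (M, \<omega>, g) \<Rightarrow> \<forall>N::('a, real^('n + 'n)) atlas.
        leaf M (kernel_sum 2 \<omega>) N \<longrightarrow> riemannian_volume N (induced_metric M g N) = 1)"


section \<open>Deformations\<close>

text \<open>The metric for which every orthonormal standard basis is orthogonal, with \<open>v\<^sub>i\<close> and
  \<open>w\<^sup>j\<^sub>i\<close> of squared length \<open>t\<close> and \<open>w\<^sup>k\<^sub>i\<close> of squared length \<open>1/t\<close>, where \<open>{j, k} = {1, 2}\<close>.\<close>

definition deformed_metric ::
    "nat \<Rightarrow> nat \<Rightarrow> nat \<Rightarrow> real \<Rightarrow> (nat \<Rightarrow> ('a, 'e::euclidean_space) bifield) \<Rightarrow> ('a, 'e) bifield \<Rightarrow>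
     ('a, 'e) bifield" where
  "deformed_metric n j k t \<omega> g = (\<lambda>p. THE h. inner_form h \<and>
     (\<forall>v w. orthonormal_standard_basis n 2 (\<lambda>l. \<omega> l p) (g p) v w \<longrightarrow>
        (\<forall>a\<in>basis_set n 2 v w. \<forall>b\<in>basis_set n 2 v w. a \<noteq> b \<longrightarrow> h a b = 0) \<and>
        (\<forall>i\<in>{1..n}. h (v i) (v i) = t \<and> h (w j i) (w j i) = t \<and> h (w k i) (w k i) = 1 / t)))"

definition alpha_deform :: "nat \<Rightarrow> real \<Rightarrow> ('a, 'e::euclidean_space) kaehler_data \<Rightarrow> ('a, 'e) kaehler_data" where
  "alpha_deform n t X =
     (case X of (M, \<omega>, g) \<Rightarrow> (M, fun_upd \<omega> 1 (scale_form t (\<omega> 1)), deformed_metric n 1 2 t \<omega> g))"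

definition beta_deform :: "nat \<Rightarrow> real \<Rightarrow> ('a, 'e::euclidean_space) kaehler_data \<Rightarrow> ('a, 'e) kaehler_data" where
  "beta_deform n t X =
     (case X of (M, \<omega>, g) \<Rightarrow> (M, fun_upd \<omega> 2 (scale_form t (\<omega> 2)), deformed_metric n 2 1 t \<omega> g))"

definition lambda_deform :: "real \<Rightarrow> ('a, 'e) kaehler_data \<Rightarrow> ('a, 'e) kaehler_data" where
  "lambda_deform t X =
     (case X of (M, \<omega>, g) \<Rightarrow> (M, \<lambda>j. scale_form t (\<omega> j), scale_form t g))"

end

(* Raising an index with the metric turns omega_1 and omega_2 into endomorphisms A and B; in an
   orthonormal standard basis they map v to w^1, respectively v to w^2, and kill the other w's.
   Everything is expressed by them: alpha_t(g) = (1/t) g + (t - 1/t) g(A., A.), and omega_D(a, b)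
   = g(A a, B b) - g(A b, B a), so smoothness and invariance are inherited. On the leaves the Gram
   matrix is multiplied by a matrix of determinant t^n t^(-n) = 1.

   Part 3 is a pointwise computation. If omega_1 is parallel, so is A, hence also alpha_t(g), and
   the connection does not change. For beta_t, write N = nabla B. Differentiating the identities
   between A and B, and using that omega_2 is closed and that the sum of the kernels is
   integrable, leaves N with a single totally symmetric component on the w^1's. It follows that B
   N is symmetric as a vector-valued form and that A B N_u is self-adjoint, so that nabla - ((t -
   1/t)/t) B N is torsion-free, preserves beta_t(g), and still annihilates omega_1. *)

theory Submission
  imports Defs
begin

section \<open>Calculus of smooth functions\<close>

text \<open>Tangent vectors are recorded in a reference chart that jumps from point to point, and
  orthonormal standard bases are given only pointwise, with no smooth choice. Nothing defined
  through a basis can be differentiated directly. This is why everything is rewritten in terms of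
  \<open>sharp\<close>: it is defined without a basis, commutes with linear isomorphisms (so it can
  be computed on \<open>local_form\<close> in any chart), and is smooth because Cramer's rule makes
  its components rational in those of the metric and the form. A frame is used only at a single
  point, to verify polynomial identities between A and B; these hold throughout a chart, and it is
  they that are differentiated. Integrability is given as a straightening chart. It enters through
  the endomorphism B A A, which vanishes on the sum of the kernels: by the symmetry of second
  derivatives of the transition map, the derivative of such a field is symmetric on the
  distribution. In the factor (t - 1/t)/t the numerator comes from differentiating g(B., B.) in the
  deformed metric, and the division by t from that metric being t g on the image of B.\<close>

lemma has_derivative_frechet:
  "f differentiable (at x) \<Longrightarrow> (f has_derivative frechet_derivative f (at x)) (at x)"
  by (simp add: frechet_derivative_works)

lemma frechet_derivative_eq:
  "(f has_derivative f') (at x) \<Longrightarrow> frechet_derivative f (at x) = f'"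
  by (rule frechet_derivative_at [symmetric])

lemma differentiable_cong_open:
  assumes "open S" "x \<in> S" "\<And>y. y \<in> S \<Longrightarrow> f y = g y"
  shows "f differentiable (at x) \<longleftrightarrow> g differentiable (at x)"
  unfolding differentiable_def
  using assms has_derivative_transform_within_open[of f _ x UNIV S g]
    has_derivative_transform_within_open[of g _ x UNIV S f] by metis

lemma frechet_derivative_cong_open:
  assumes "open S" "x \<in> S" "\<And>y. y \<in> S \<Longrightarrow> f y = g y"
  shows "frechet_derivative f (at x) = frechet_derivative g (at x)"
proof -
  have "(f has_derivative f') (at x) \<longleftrightarrow> (g has_derivative f') (at x)" for f'
    using assms has_derivative_transform_within_open[of f _ x UNIV S g]
      has_derivative_transform_within_open[of g _ x UNIV S f] by metis
  then show ?thesis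
    by (simp add: frechet_derivative_def)
qed

lemma Ck_on_cong:
  assumes "open S" "\<And>y. y \<in> S \<Longrightarrow> f y = g y" "Ck_on k S f"
  shows "Ck_on k S g"
  using assms(2,3)
proof (induction k arbitrary: f g)
  case 0
  then show ?case
    by (metis Ck_on.simps(1) continuous_on_cong)
next
  case (Suc k)
  show ?case
    unfolding Ck_on.simps
  proof (intro conjI ballI allI)
    fix x assume "x \<in> S"
    then show "g differentiable (at x)"
      using Suc.prems differentiable_cong_open[OF assms(1), of x f g] by auto
  next
    fix v
    show "Ck_on k S (\<lambda>x. frechet_derivative g (at x) v)"
    proof (rule Suc.IH)
      show "frechet_derivative f (at y) v = frechet_derivative g (at y) v" if "y \<in> S" for y
        using frechet_derivative_cong_open[OF assms(1) that Suc.prems(1)] by simp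
      show "Ck_on k S (\<lambda>x. frechet_derivative f (at x) v)"
        using Suc.prems by simp
    qed
  qed
qed

lemma Ck_on_SucD: "Ck_on (Suc k) S f \<Longrightarrow> Ck_on k S f"
proof (induction k arbitrary: f)
  case 0
  then show ?case
    by (auto simp: continuous_on_eq_continuous_within differentiable_imp_continuous_within
        intro: continuous_at_imp_continuous_within)
next
  case (Suc k)
  then show ?case
    using Ck_on.simps(2) by blast
qed

lemma Ck_on_const: "Ck_on k S (\<lambda>x. c)"
  by (induction k arbitrary: c) auto

text \<open>\<open>Ck_on\<close> speaks of \<open>frechet_derivative\<close>, whereas the usual
  rules deliver explicit derivatives. This rule bridges the two, so that each closure lemma below is
  a derivative rule plus an induction on the order.\<close>

lemma Ck_on_SucI:
  assumes "open S" and "\<And>x. x \<in> S \<Longrightarrow> (f has_derivative f' x) (at x)"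
    and "\<And>v. Ck_on k S (\<lambda>x. f' x v)"
  shows "Ck_on (Suc k) S f"
  unfolding Ck_on.simps
proof (intro conjI ballI allI)
  show "f differentiable (at x)" if "x \<in> S" for x
    using assms(2)[OF that] by (auto simp: differentiable_def)
  show "Ck_on k S (\<lambda>x. frechet_derivative f (at x) v)" for v
    by (rule Ck_on_cong[OF assms(1) _ assms(3)[of v]]) (simp add: frechet_derivative_eq[OF assms(2)])
qed

lemma Ck_on_Suc_has_derivative:
  "Ck_on (Suc k) S f \<Longrightarrow> x \<in> S \<Longrightarrow> (f has_derivative frechet_derivative f (at x)) (at x)"
  by (simp add: has_derivative_frechet)

lemma Ck_on_add:
  assumes "open S" "Ck_on k S f" "Ck_on k S g"
  shows "Ck_on k S (\<lambda>x. f x + g x)"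
  using assms(2,3)
proof (induction k arbitrary: f g)
  case 0
  then show ?case by (simp add: continuous_on_add)
next
  case (Suc k)
  show ?case
    by (rule Ck_on_SucI[OF assms(1) has_derivative_add[OF Suc.prems[THEN Ck_on_Suc_has_derivative]]])
      (use Suc in auto)
qed

lemma Ck_on_mult:
  fixes f g :: "'a::real_normed_vector \<Rightarrow> 'b::real_normed_algebra"
  assumes "open S" "Ck_on k S f" "Ck_on k S g"
  shows "Ck_on k S (\<lambda>x. f x * g x)"
  using assms(2,3)
proof (induction k arbitrary: f g)
  case 0
  then show ?case by (simp add: continuous_on_mult)
next
  case (Suc k)
  have "Ck_on k S f" "Ck_on k S g"
    using Suc.prems by (simp_all only: Ck_on_SucD)
  then show ?case
    by (intro Ck_on_SucI[OF assms(1) has_derivative_mult[OF Suc.prems[THEN Ck_on_Suc_has_derivative]]]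
        Ck_on_add[OF assms(1)] Suc.IH) (use Suc.prems in auto)
qed

lemma Ck_on_inverse:
  fixes f :: "'a::real_normed_vector \<Rightarrow> 'b::real_normed_div_algebra"
  assumes "open S" "Ck_on k S f" "\<And>x. x \<in> S \<Longrightarrow> f x \<noteq> 0"
  shows "Ck_on k S (\<lambda>x. inverse (f x))"
  using assms(2)
proof (induction k)
  case 0
  then show ?case using assms(3) by (simp add: continuous_on_inverse)
next
  case (Suc k)
  \<comment> \<open>The derivative of 1/f contains 1/f again. It is of class \<open>k\<close> by the
    induction hypothesis, which is why \<open>f\<close> stays fixed in this induction.\<close>
  have inv: "Ck_on k S (\<lambda>x. inverse (f x))"
    using Suc Ck_on_SucD by blast
  have "Ck_on k S (\<lambda>x. (- 1) * (inverse (f x) * frechet_derivative f (at x) v * inverse (f x)))" for v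
    by (intro Ck_on_mult[OF assms(1)] Ck_on_const inv) (use Suc in auto)
  then show ?case
    by (intro Ck_on_SucI[OF assms(1) Deriv.has_derivative_inverse[OF assms(3)
            Ck_on_Suc_has_derivative[OF Suc.prems]]]) auto
qed

lemma Ck_on_sum:
  assumes "open S" "\<And>i. i \<in> I \<Longrightarrow> Ck_on k S (f i)"
  shows "Ck_on k S (\<lambda>x. \<Sum>i\<in>I. f i x)"
  using assms(2)
  by (induction I rule: infinite_finite_induct)
    (auto intro: Ck_on_const Ck_on_add[OF assms(1)])

lemma Ck_on_prod:
  fixes f :: "'i \<Rightarrow> 'a::real_normed_vector \<Rightarrow> 'b::{real_normed_algebra, comm_ring_1}"
  assumes "open S" "\<And>i. i \<in> I \<Longrightarrow> Ck_on k S (f i)"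
  shows "Ck_on k S (\<lambda>x. \<Prod>i\<in>I. f i x)"
  using assms(2)
  by (induction I rule: infinite_finite_induct)
    (auto intro: Ck_on_const Ck_on_mult[OF assms(1)])

lemma Ck_on_det:
  fixes A :: "'a::real_normed_vector \<Rightarrow> 'm::finite \<Rightarrow> 'm \<Rightarrow> real"
  assumes "open S" "\<And>i j. Ck_on k S (\<lambda>x. A x i j)"
  shows "Ck_on k S (\<lambda>x. det ((\<chi> i j. A x i j) :: real^'m^'m))"
  unfolding det_def vec_lambda_beta
  by (intro Ck_on_sum Ck_on_mult Ck_on_prod Ck_on_const assms)

lemma smooth_onD:
  assumes "smooth_on S f"
  shows "open S" "Ck_on k S f" "\<And>x. x \<in> S \<Longrightarrow> f differentiable (at x)"
    "\<And>x. x \<in> S \<Longrightarrow> (f has_derivative frechet_derivative f (at x)) (at x)"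
proof -
  show "open S" "Ck_on k S f"
    using assms by (simp_all add: smooth_on_def)
  have "Ck_on (Suc 0) S f"
    using assms unfolding smooth_on_def by blast
  then show "f differentiable (at x)" if "x \<in> S" for x
    using that by simp
  then show "(f has_derivative frechet_derivative f (at x)) (at x)" if "x \<in> S" for x
    using that by (simp add: has_derivative_frechet)
qed

text \<open>Young's theorem: the double difference of \<open>f\<close> over a parallelogram equals each of the two
  mixed second derivatives at some point of it.\<close>

lemma mixed_second_derivative_mvt:
  fixes f :: "'a::real_normed_vector \<Rightarrow> real"
  assumes C: "Ck_on (Suc (Suc k)) (ball x r) f"
    and h: "h > 0" "h * (norm u + norm v) < r"
  shows "\<exists>y. norm (y - x) \<le> h * (norm u + norm v) \<and>
    f (x + h *\<^sub>R u + h *\<^sub>R v) - f (x + h *\<^sub>R u) - f (x + h *\<^sub>R v) + f x =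
    h * h * frechet_derivative (\<lambda>z. frechet_derivative f (at z) u) (at y) v"
proof -
  define f1 where "f1 z = frechet_derivative f (at z) u" for z
  have near: "norm (s *\<^sub>R u + q *\<^sub>R v) \<le> h * (norm u + norm v)"
    if "0 \<le> s" "s \<le> h" "0 \<le> q" "q \<le> h" for s q
  proof -
    have "norm (s *\<^sub>R u + q *\<^sub>R v) \<le> s * norm u + q * norm v"
      using norm_triangle_ineq[of "s *\<^sub>R u" "q *\<^sub>R v"] that by simp
    also have "\<dots> \<le> h * norm u + h * norm v"
      using that by (intro add_mono mult_right_mono) auto
    finally show ?thesis by (simp add: algebra_simps)
  qed
  have inb: "x + s *\<^sub>R u + q *\<^sub>R v \<in> ball x r"
    if "0 \<le> s" "s \<le> h" "0 \<le> q" "q \<le> h" for s q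
  proof -
    have "dist (x + s *\<^sub>R u + q *\<^sub>R v) x = norm (s *\<^sub>R u + q *\<^sub>R v)"
      by (simp add: dist_norm add.assoc)
    then show ?thesis
      using near[OF that] h(2) by (simp add: dist_commute)
  qed
  have df: "(f has_derivative frechet_derivative f (at z)) (at z)" if "z \<in> ball x r" for z
    using Ck_on_Suc_has_derivative[OF C that] .
  have df1: "(f1 has_derivative frechet_derivative f1 (at z)) (at z)" if "z \<in> ball x r" for z
    using C Ck_on_Suc_has_derivative[of k "ball x r" f1] that unfolding f1_def by simp
  \<comment> \<open>The increment of \<open>\<phi>\<close> is the double difference, and its
    derivative is the increment of \<open>f1\<close> along \<open>v\<close>. A second use of the
    mean value theorem, on \<open>\<psi>\<close>, resolves that increment.\<close>
  define \<phi> where "\<phi> s = f (x + s *\<^sub>R u + h *\<^sub>R v) - f (x + s *\<^sub>R u)" for s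
  have "(\<phi> has_derivative (\<lambda>d. d * (f1 (x + s *\<^sub>R u + h *\<^sub>R v) - f1 (x + s *\<^sub>R u)))) (at s)"
    if "0 \<le> s" "s \<le> h" for s
  proof -
    have *: "((\<lambda>s. f (x + s *\<^sub>R u + q *\<^sub>R v)) has_derivative (\<lambda>d. d * f1 (x + s *\<^sub>R u + q *\<^sub>R v))) (at s)"
      if "0 \<le> q" "q \<le> h" for q
    proof -
      have z: "x + s *\<^sub>R u + q *\<^sub>R v \<in> ball x r"
        using inb \<open>0 \<le> s\<close> \<open>s \<le> h\<close> that by blast
      have "((\<lambda>s. x + s *\<^sub>R u + q *\<^sub>R v) has_derivative (\<lambda>d. d *\<^sub>R u)) (at s)"
        by (auto intro!: derivative_eq_intros)
      from has_derivative_compose[OF this df[OF z]] show ?thesis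
        using linear_scale[OF has_derivative_linear[OF df[OF z]]] by (simp add: f1_def o_def)
    qed
    show ?thesis
      using has_derivative_diff[OF *[of h] *[of 0]] h(1) unfolding \<phi>_def by (simp add: algebra_simps)
  qed
  then have "\<exists>s\<in>{0<..<h}. \<phi> h - \<phi> 0 = (h - 0) * (f1 (x + s *\<^sub>R u + h *\<^sub>R v) - f1 (x + s *\<^sub>R u))"
    using h(1) by (intro mvt_simple) (auto intro: has_derivative_at_withinI)
  then obtain s where s: "0 < s" "s < h"
    "\<phi> h - \<phi> 0 = h * (f1 (x + s *\<^sub>R u + h *\<^sub>R v) - f1 (x + s *\<^sub>R u))"
    by auto
  define \<psi> where "\<psi> q = f1 (x + s *\<^sub>R u + q *\<^sub>R v)" for q
  have "(\<psi> has_derivative (\<lambda>d. d * frechet_derivative f1 (at (x + s *\<^sub>R u + q *\<^sub>R v)) v)) (at q)"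
    if "0 \<le> q" "q \<le> h" for q
  proof -
    have z: "x + s *\<^sub>R u + q *\<^sub>R v \<in> ball x r"
      using inb s that by auto
    have "((\<lambda>q. x + s *\<^sub>R u + q *\<^sub>R v) has_derivative (\<lambda>d. d *\<^sub>R v)) (at q)"
      by (auto intro!: derivative_eq_intros)
    from has_derivative_compose[OF this df1[OF z]] show ?thesis
      using linear_scale[OF has_derivative_linear[OF df1[OF z]]] by (simp add: \<psi>_def[abs_def] o_def)
  qed
  then have "\<exists>q\<in>{0<..<h}. \<psi> h - \<psi> 0 = (h - 0) * frechet_derivative f1 (at (x + s *\<^sub>R u + q *\<^sub>R v)) v"
    using h(1) by (intro mvt_simple) (auto intro: has_derivative_at_withinI)
  then obtain q where q: "0 < q" "q < h"
    "\<psi> h - \<psi> 0 = h * frechet_derivative f1 (at (x + s *\<^sub>R u + q *\<^sub>R v)) v"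
    by auto
  have "norm (x + s *\<^sub>R u + q *\<^sub>R v - x) \<le> h * (norm u + norm v)"
    using near[of s q] s q by (simp add: add.assoc)
  moreover have "f (x + h *\<^sub>R u + h *\<^sub>R v) - f (x + h *\<^sub>R u) - f (x + h *\<^sub>R v) + f x =
      h * (h * frechet_derivative f1 (at (x + s *\<^sub>R u + q *\<^sub>R v)) v)"
    using s(3) q(3) unfolding \<phi>_def \<psi>_def by (simp add: algebra_simps)
  ultimately show ?thesis
    unfolding f1_def by (intro exI[of _ "x + s *\<^sub>R u + q *\<^sub>R v"]) (simp add: mult.assoc)
qed

text \<open>The intermediate point of the preceding lemma tends to \<open>x\<close> with
  \<open>h\<close>, and the mixed derivative is continuous.\<close>

lemma mixed_second_derivative_tendsto:
  fixes f :: "'a::real_normed_vector \<Rightarrow> real"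
  assumes C: "Ck_on (Suc (Suc k)) S f" and S: "open S" "x \<in> S"
  shows "((\<lambda>h. (f (x + h *\<^sub>R u + h *\<^sub>R v) - f (x + h *\<^sub>R u) - f (x + h *\<^sub>R v) + f x) / (h * h))
    \<longlongrightarrow> frechet_derivative (\<lambda>z. frechet_derivative f (at z) u) (at x) v) (at_right 0)"
proof (rule tendstoI)
  define D where "D y = frechet_derivative (\<lambda>z. frechet_derivative f (at z) u) (at y) v" for y
  fix e :: real assume "e > 0"
  have mono: "Ck_on j T g \<Longrightarrow> T' \<subseteq> T \<Longrightarrow> Ck_on j T' g" for j T T' and g :: "'a \<Rightarrow> real"
    by (induction j arbitrary: g) (auto intro: continuous_on_subset)
  have zero: "Ck_on j T g \<Longrightarrow> Ck_on 0 T g" for j T and g :: "'a \<Rightarrow> real"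
    by (induction j) (blast dest: Ck_on_SucD)+
  have "continuous_on S D"
    using C zero[of k S] unfolding D_def by simp
  then obtain d where d: "d > 0" "\<And>y. dist y x < d \<Longrightarrow> y \<in> S \<Longrightarrow> dist (D y) (D x) < e"
    using S \<open>e > 0\<close> unfolding continuous_on_iff by meson
  obtain r where r: "r > 0" "ball x r \<subseteq> S"
    using S openE by blast
  define m where "m = min r d"
  have m: "m > 0" "m \<le> r" "m \<le> d"
    using r d by (auto simp: m_def)
  \<comment> \<open>The summand 1 keeps the denominator positive when \<open>u\<close> and
    \<open>v\<close> are both zero.\<close>
  define a where "a = m / (norm u + norm v + 1)"
  have den: "norm u + norm v + 1 > 0"
    by (smt (verit) norm_ge_zero)
  have a: "a > 0"
    unfolding a_def using m den by simp
  have "dist ((f (x + h *\<^sub>R u + h *\<^sub>R v) - f (x + h *\<^sub>R u) - f (x + h *\<^sub>R v) + f x) / (h * h)) (D x) < e"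
    if h: "0 < h" "h < a" for h
  proof -
    have hn: "h * (norm u + norm v) < m"
    proof -
      have "h * (norm u + norm v) \<le> h * (norm u + norm v + 1)"
        using h by simp
      also have "\<dots> < a * (norm u + norm v + 1)"
        using h den by (intro mult_strict_right_mono) auto
      also have "\<dots> = m"
        unfolding a_def using den by (simp add: field_simps)
      finally show ?thesis .
    qed
    have "Ck_on (Suc (Suc k)) (ball x r) f"
      using mono C r by blast
    from mixed_second_derivative_mvt[OF this h(1), of u v] obtain y
      where y: "norm (y - x) \<le> h * (norm u + norm v)" and
        eq: "f (x + h *\<^sub>R u + h *\<^sub>R v) - f (x + h *\<^sub>R u) - f (x + h *\<^sub>R v) + f x = h * h * D y"
      using hn m unfolding D_def by auto
    have "dist y x < m"
      using y hn by (simp add: dist_norm)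
    then have "dist (D y) (D x) < e"
      using m r(2) d(2)[of y] by (metis dist_commute less_le_trans mem_ball subsetD)
    then show ?thesis
      using eq h by simp
  qed
  then have "eventually (\<lambda>h. dist ((f (x + h *\<^sub>R u + h *\<^sub>R v) - f (x + h *\<^sub>R u) - f (x + h *\<^sub>R v) + f x) / (h * h)) (D x) < e)
      (at_right 0)"
    unfolding eventually_at_right_field using a by blast
  then show "eventually (\<lambda>h. dist ((f (x + h *\<^sub>R u + h *\<^sub>R v) - f (x + h *\<^sub>R u) - f (x + h *\<^sub>R v) + f x) / (h * h))
      (frechet_derivative (\<lambda>z. frechet_derivative f (at z) u) (at x) v) < e) (at_right 0)"
    by (simp add: D_def)
qed

text \<open>The double difference is symmetric in \<open>u\<close> and \<open>v\<close>, so the two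
  mixed derivatives are limits of the same quotient.\<close>

lemma second_derivative_symmetric_real:
  fixes f :: "'a::real_normed_vector \<Rightarrow> real"
  assumes "Ck_on (Suc (Suc k)) S f" "open S" "x \<in> S"
  shows "frechet_derivative (\<lambda>z. frechet_derivative f (at z) u) (at x) v =
    frechet_derivative (\<lambda>z. frechet_derivative f (at z) v) (at x) u"
proof (rule tendsto_unique[OF trivial_limit_at_right_real mixed_second_derivative_tendsto[OF assms]])
  have eq: "f (x + h *\<^sub>R u + h *\<^sub>R v) - f (x + h *\<^sub>R u) - f (x + h *\<^sub>R v) + f x =
      f (x + h *\<^sub>R v + h *\<^sub>R u) - f (x + h *\<^sub>R v) - f (x + h *\<^sub>R u) + f x" for h
    by (simp add: add.assoc add.commute[of "h *\<^sub>R u"])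
  show "((\<lambda>h. (f (x + h *\<^sub>R u + h *\<^sub>R v) - f (x + h *\<^sub>R u) - f (x + h *\<^sub>R v) + f x) / (h * h))
      \<longlongrightarrow> frechet_derivative (\<lambda>z. frechet_derivative f (at z) v) (at x) u) (at_right 0)"
    unfolding eq by (rule mixed_second_derivative_tendsto[OF assms])
qed

lemma Ck_on_inner:
  assumes "open S" "Ck_on k S f"
  shows "Ck_on k S (\<lambda>x. f x \<bullet> b)"
  using assms(2)
proof (induction k arbitrary: f)
  case 0
  then show ?case by (auto intro: continuous_intros)
next
  case (Suc k)
  show ?case
    by (rule Ck_on_SucI[OF assms(1) has_derivative_inner_left[OF Ck_on_Suc_has_derivative[OF Suc.prems]]])
      (use Suc in auto)
qed

lemma second_derivative_symmetric:
  fixes f :: "'a::real_normed_vector \<Rightarrow> 'b::euclidean_space"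
  assumes C: "Ck_on (Suc (Suc k)) S f" and S: "open S" "x \<in> S"
  shows "frechet_derivative (\<lambda>z. frechet_derivative f (at z) u) (at x) v =
    frechet_derivative (\<lambda>z. frechet_derivative f (at z) v) (at x) u"
proof (rule euclidean_eqI)
  fix b :: 'b assume "b \<in> Basis"
  have inner: "frechet_derivative (\<lambda>z. frechet_derivative (\<lambda>z. f z \<bullet> b) (at z) p) (at x) q =
      frechet_derivative (\<lambda>z. frechet_derivative f (at z) p) (at x) q \<bullet> b" for p q
  proof -
    have "frechet_derivative (\<lambda>z. frechet_derivative (\<lambda>z. f z \<bullet> b) (at z) p) (at x) =
        frechet_derivative (\<lambda>z. frechet_derivative f (at z) p \<bullet> b) (at x)"
      by (rule frechet_derivative_cong_open[OF S])
        (simp add: frechet_derivative_eq[OF has_derivative_inner_left[OF Ck_on_Suc_has_derivative[OF C]]])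
    also have "\<dots> = (\<lambda>q. frechet_derivative (\<lambda>z. frechet_derivative f (at z) p) (at x) q \<bullet> b)"
      using C S Ck_on_Suc_has_derivative[of k S "\<lambda>z. frechet_derivative f (at z) p"]
      by (intro frechet_derivative_eq has_derivative_inner_left) simp
    finally show ?thesis by simp
  qed
  show "frechet_derivative (\<lambda>z. frechet_derivative f (at z) u) (at x) v \<bullet> b =
      frechet_derivative (\<lambda>z. frechet_derivative f (at z) v) (at x) u \<bullet> b"
    using second_derivative_symmetric_real[OF Ck_on_inner[OF S(1) C, of b] S, of u v] by (simp add: inner)
qed

section \<open>Inner products and adapted frames\<close>

lemma inner_formD:
  assumes "inner_form h"
  shows "linear (h u)" "linear (\<lambda>u. h u v)" "h u v = h v u" "u \<noteq> 0 \<Longrightarrow> h u u > 0"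
    "h (a + b) v = h a v + h b v" "h (a - b) v = h a v - h b v" "h (r *\<^sub>R a) v = r * h a v"
    "h (- a) v = - h a v" "h 0 v = 0" "h (sum f I) v = (\<Sum>i\<in>I. h (f i) v)"
    "h v (a + b) = h v a + h v b" "h v (a - b) = h v a - h v b" "h v (r *\<^sub>R a) = r * h v a"
    "h v (- a) = - h v a" "h v 0 = 0" "h v (sum f I) = (\<Sum>i\<in>I. h v (f i))"
proof -
  have lin: "linear (h u)" for u
    using assms by (simp add: inner_form_def)
  have sym: "h u v = h v u" for u v
    using assms by (simp add: inner_form_def)
  have lin': "linear (\<lambda>u. h u v)" for v
  proof -
    have "(\<lambda>u. h u v) = h v"
      using sym by blast
    then show ?thesis
      using lin by simp
  qed
  show "linear (h u)" "linear (\<lambda>u. h u v)" "h u v = h v u"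
    using lin lin' sym by blast+
  show "u \<noteq> 0 \<Longrightarrow> h u u > 0"
    using assms by (simp add: inner_form_def)
  show "h (a + b) v = h a v + h b v" "h (a - b) v = h a v - h b v" "h (r *\<^sub>R a) v = r * h a v"
    "h (- a) v = - h a v" "h 0 v = 0" "h (sum f I) v = (\<Sum>i\<in>I. h (f i) v)"
    using linear_add[OF lin'] linear_diff[OF lin'] linear_scale[OF lin'] linear_neg[OF lin']
      linear_0[OF lin'] linear_sum[OF lin'] by simp_all
  show "h v (a + b) = h v a + h v b" "h v (a - b) = h v a - h v b" "h v (r *\<^sub>R a) = r * h v a"
    "h v (- a) = - h v a" "h v 0 = 0" "h v (sum f I) = (\<Sum>i\<in>I. h v (f i))"
    using linear_add[OF lin] linear_diff[OF lin] linear_scale[OF lin] linear_neg[OF lin]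
      linear_0[OF lin] linear_sum[OF lin] by simp_all
qed

lemma inner_form_eqI:
  assumes "inner_form h" "\<And>w. h y w = h z w"
  shows "y = z"
proof (rule ccontr)
  assume "y \<noteq> z"
  then have "h (y - z) (y - z) > 0"
    using inner_formD(4)[OF assms(1)] by simp
  then show False
    using assms(2)[of "y - z"] by (simp add: inner_formD(6)[OF assms(1)])
qed

text \<open>Positivity makes the linear map from \<open>y\<close> to the values of
  \<open>h y\<close> on the basis injective, hence surjective in finite dimension. Unique existence
  is the form in which the definite descriptions of \<open>sharp\<close> and of the Christoffel
  symbols consume it.\<close>

lemma inner_form_riesz:
  fixes h :: "'e::euclidean_space \<Rightarrow> 'e \<Rightarrow> real"
  assumes h: "inner_form h" and f: "linear f"
  shows "\<exists>!y. \<forall>w. h y w = f w"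
proof -
  define L where "L y = (\<Sum>b\<in>Basis. h y b *\<^sub>R b)" for y
  have L: "linear L"
    by (rule linearI) (simp_all add: L_def inner_formD[OF h] sum.distrib scaleR_add_left
        scaleR_sum_right)
  have Lb: "L y \<bullet> b = h y b" if "b \<in> Basis" for y b
    using that by (simp add: L_def)
  have eq: "(\<forall>w. h y w = f w) \<longleftrightarrow> (\<forall>b\<in>Basis. h y b = f b)" for y
    using linear_eq_stdbasis[OF inner_formD(1)[OF h, of y] f] by metis
  have "inj L"
  proof (rule injI)
    fix y z assume "L y = L z"
    then have "h y b = h z b" if "b \<in> Basis" for b
      using Lb that by metis
    then have "h y w = h z w" for w
      using linear_eq_stdbasis[OF inner_formD(1)[OF h, of y] inner_formD(1)[OF h, of z]] by metis
    then show "y = z"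
      by (rule inner_form_eqI[OF h])
  qed
  then have "surj L"
    using L linear_injective_imp_surjective by blast
  then obtain y where "L y = (\<Sum>b\<in>Basis. f b *\<^sub>R b)"
    by (metis surjD)
  then have "\<forall>b\<in>Basis. h y b = f b"
    using Lb by (metis inner_sum_left_Basis)
  then show ?thesis
    using eq inner_form_eqI[OF h] by metis
qed

text \<open>Characterised by its pairings with all vectors instead of a formula in a frame: it makes
  sense for a whole field at once and is compatible with changes of coordinates.\<close>

definition sharp :: "('v \<Rightarrow> 'v \<Rightarrow> real) \<Rightarrow> ('v \<Rightarrow> 'v \<Rightarrow> real) \<Rightarrow> 'v \<Rightarrow> 'v" where
  "sharp h \<alpha> v = (THE y. \<forall>w. h y w = \<alpha> v w)"

definition sharp_form ::
    "('v \<Rightarrow> 'v \<Rightarrow> real) \<Rightarrow> ('v \<Rightarrow> 'v \<Rightarrow> real) \<Rightarrow> 'v \<Rightarrow> 'v \<Rightarrow> real" where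
  "sharp_form h \<alpha> u v = h (sharp h \<alpha> u) (sharp h \<alpha> v)"

text \<open>In an adapted frame \<open>sharp_form\<close> agrees with \<open>h\<close> on the
  \<open>v i\<close> and \<open>p i\<close> and vanishes on the \<open>q i\<close>. The coefficients
  are chosen so that their sum is t, while the first alone is 1/t.\<close>

definition deform_inner ::
    "real \<Rightarrow> ('v \<Rightarrow> 'v \<Rightarrow> real) \<Rightarrow> ('v \<Rightarrow> 'v \<Rightarrow> real) \<Rightarrow> 'v \<Rightarrow> 'v \<Rightarrow> real" where
  "deform_inner t h \<alpha> u v = (1 / t) * h u v + (t - 1 / t) * sharp_form h \<alpha> u v"

text \<open>An orthonormal standard basis for s = 2, with \<open>p\<close> and \<open>q\<close> in
  place of \<open>w 1\<close> and \<open>w 2\<close>, and with the coordinate functionals replaced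
  by pairings with \<open>h\<close>. In this form the two 2-forms play visibly exchangeable
  roles.\<close>

definition adapted_frame ::
    "nat \<Rightarrow> ('v::real_vector \<Rightarrow> 'v \<Rightarrow> real) \<Rightarrow> ('v \<Rightarrow> 'v \<Rightarrow> real) \<Rightarrow> ('v \<Rightarrow> 'v \<Rightarrow> real) \<Rightarrow>
     (nat \<Rightarrow> 'v) \<Rightarrow> (nat \<Rightarrow> 'v) \<Rightarrow> (nat \<Rightarrow> 'v) \<Rightarrow> bool" where
  "adapted_frame n h \<alpha> \<beta> v p q \<longleftrightarrow>
     (\<forall>i\<in>{1..n}. \<forall>k\<in>{1..n}. h (v i) (v k) = (if i = k then 1 else 0) \<and>
        h (p i) (p k) = (if i = k then 1 else 0) \<and> h (q i) (q k) = (if i = k then 1 else 0) \<and>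
        h (v i) (p k) = 0 \<and> h (v i) (q k) = 0 \<and> h (p i) (q k) = 0) \<and>
     (\<forall>a. a = (\<Sum>i=1..n. h a (v i) *\<^sub>R v i + h a (p i) *\<^sub>R p i + h a (q i) *\<^sub>R q i)) \<and>
     (\<forall>a b. \<alpha> a b = (\<Sum>i=1..n. h a (v i) * h b (p i) - h b (v i) * h a (p i))) \<and>
     (\<forall>a b. \<beta> a b = (\<Sum>i=1..n. h a (v i) * h b (q i) - h b (v i) * h a (q i)))"

section \<open>Linear algebra of a single tangent space\<close>

locale kaehler_space =
  fixes n :: nat and h \<alpha> \<beta> :: "'v::real_vector \<Rightarrow> 'v \<Rightarrow> real" and v p q :: "nat \<Rightarrow> 'v"
  assumes inner: "inner_form h" and frame: "adapted_frame n h \<alpha> \<beta> v p q"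
begin

lemmas h_simps = inner_formD(5-)[OF inner]

lemma h_commute: "h a b = h b a"
  using inner by (simp add: inner_form_def)

lemma ortho:
  assumes "i \<in> {1..n}" "k \<in> {1..n}"
  shows "h (v i) (v k) = (if i = k then 1 else 0)" "h (p i) (p k) = (if i = k then 1 else 0)"
    "h (q i) (q k) = (if i = k then 1 else 0)"
    "h (v i) (p k) = 0" "h (v i) (q k) = 0" "h (p i) (q k) = 0"
    "h (p i) (v k) = 0" "h (q i) (v k) = 0" "h (q i) (p k) = 0"
proof -
  note o = bspec[OF bspec[OF conjunct1[OF frame[unfolded adapted_frame_def]] assms(1)] assms(2)]
  note o' = bspec[OF bspec[OF conjunct1[OF frame[unfolded adapted_frame_def]] assms(2)] assms(1)]
  show "h (v i) (v k) = (if i = k then 1 else 0)" "h (p i) (p k) = (if i = k then 1 else 0)"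
    "h (q i) (q k) = (if i = k then 1 else 0)" "h (v i) (p k) = 0" "h (v i) (q k) = 0" "h (p i) (q k) = 0"
    using o by simp_all
  show "h (p i) (v k) = 0" "h (q i) (v k) = 0" "h (q i) (p k) = 0"
    using o' h_commute by metis+
qed

lemma expansion: "a = (\<Sum>i=1..n. h a (v i) *\<^sub>R v i + h a (p i) *\<^sub>R p i + h a (q i) *\<^sub>R q i)"
  using frame unfolding adapted_frame_def by blast

lemma form_eq:
  "\<alpha> a b = (\<Sum>i=1..n. h a (v i) * h b (p i) - h b (v i) * h a (p i))"
  "\<beta> a b = (\<Sum>i=1..n. h a (v i) * h b (q i) - h b (v i) * h a (q i))"
  using frame unfolding adapted_frame_def by blast+

text \<open>Transfers every result on \<open>\<alpha>\<close> and \<open>A\<close> to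
  \<open>\<beta>\<close> and \<open>B\<close>, so that the second deformation is handled as the
  first with the roles of the forms exchanged.\<close>

lemma swap: "kaehler_space n h \<beta> \<alpha> v q p"
proof
  show "inner_form h" by (rule inner)
  show "adapted_frame n h \<beta> \<alpha> v q p"
    unfolding adapted_frame_def
  proof (intro conjI allI ballI)
    fix a
    show "a = (\<Sum>i=1..n. h a (v i) *\<^sub>R v i + h a (q i) *\<^sub>R q i + h a (p i) *\<^sub>R p i)"
      by (rule trans[OF expansion[of a] sum.cong]) (simp_all add: algebra_simps)
  qed (simp_all add: ortho form_eq)
qed

lemma linear_ext:
  fixes f g :: "'v \<Rightarrow> 'b::real_vector"
  assumes "linear f" "linear g"
    and "\<And>i. i \<in> {1..n} \<Longrightarrow> f (v i) = g (v i)" "\<And>i. i \<in> {1..n} \<Longrightarrow> f (p i) = g (p i)"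
    "\<And>i. i \<in> {1..n} \<Longrightarrow> f (q i) = g (q i)"
  shows "f a = g a"
proof -
  have "F a = (\<Sum>i=1..n. h a (v i) *\<^sub>R F (v i) + h a (p i) *\<^sub>R F (p i) + h a (q i) *\<^sub>R F (q i))"
    if "linear F" for F :: "'v \<Rightarrow> 'b"
    by (subst expansion[of a])
      (simp add: linear_sum[OF that] linear_add[OF that] linear_scale[OF that])
  from this[OF assms(1)] this[OF assms(2)] show ?thesis
    using assms(3-5) by simp
qed

lemma bilinear_ext:
  fixes f g :: "'v \<Rightarrow> 'v \<Rightarrow> 'b::real_vector"
  assumes "\<And>a. linear (f a)" "\<And>b. linear (\<lambda>a. f a b)" "\<And>a. linear (g a)" "\<And>b. linear (\<lambda>a. g a b)"
    and "\<And>x y. x \<in> v ` {1..n} \<union> p ` {1..n} \<union> q ` {1..n} \<Longrightarrow>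
      y \<in> v ` {1..n} \<union> p ` {1..n} \<union> q ` {1..n} \<Longrightarrow> f x y = g x y"
  shows "f a b = g a b"
proof -
  have "f a y = g a y" if "y \<in> v ` {1..n} \<union> p ` {1..n} \<union> q ` {1..n}" for y
    by (rule linear_ext[OF assms(2,4)]; rule assms(5)[OF _ that]; blast)
  then show ?thesis
    by (rule linear_ext[OF assms(1,3)]; blast)
qed

abbreviation "A \<equiv> sharp h \<alpha>"
abbreviation "B \<equiv> sharp h \<beta>"

lemma A_eq: "A a = (\<Sum>i=1..n. h a (v i) *\<^sub>R p i - h a (p i) *\<^sub>R v i)"
  unfolding sharp_def
proof (rule the_equality)
  have *: "h (\<Sum>i=1..n. h a (v i) *\<^sub>R p i - h a (p i) *\<^sub>R v i) w = \<alpha> a w" for w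
    by (simp only: h_simps form_eq h_commute[of _ w] mult.commute[of "h a _"])
  then show "\<forall>w. h (\<Sum>i=1..n. h a (v i) *\<^sub>R p i - h a (p i) *\<^sub>R v i) w = \<alpha> a w" by blast
  show "y = (\<Sum>i=1..n. h a (v i) *\<^sub>R p i - h a (p i) *\<^sub>R v i)" if "\<forall>w. h y w = \<alpha> a w" for y
    using that * by (intro inner_form_eqI[OF inner]) simp
qed

lemma linear_A: "linear A"
proof (rule linearI)
  show "A (a + b) = A a + A b" for a b
    by (simp add: A_eq h_simps scaleR_add_left sum.distrib[symmetric] algebra_simps)
  show "A (r *\<^sub>R a) = r *\<^sub>R A a" for r a
    by (simp add: A_eq h_simps scaleR_sum_right scaleR_diff_right)
qed

lemma h_A: "h (A a) b = \<alpha> a b"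
  by (simp only: A_eq h_simps form_eq h_commute[of _ b] mult.commute[of "h a _"])

lemma form_skew: "\<alpha> b a = - \<alpha> a b"
  by (simp add: form_eq sum_subtractf)

lemma h_A_skew: "h (A a) b = - h a (A b)"
  by (simp only: h_commute[of a] h_A form_skew[of a b])

lemma A_frame:
  assumes "i \<in> {1..n}"
  shows "A (v i) = p i" "A (p i) = - v i" "A (q i) = 0"
  using assms by (simp_all add: A_eq ortho if_distrib[of "\<lambda>r. r *\<^sub>R _"] cong: if_cong)
    (simp_all add: sum_subtractf sum_negf)

lemma linear_A_simps:
  "A (a + b) = A a + A b" "A (a - b) = A a - A b" "A (- a) = - A a" "A (r *\<^sub>R a) = r *\<^sub>R A a" "A 0 = 0"
  using linear_A by (simp_all add: linear_add linear_diff linear_neg linear_scale linear_0)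

lemmas linear_B = kaehler_space.linear_A[OF swap]
lemmas h_B = kaehler_space.h_A[OF swap]
lemmas h_B_skew = kaehler_space.h_A_skew[OF swap]
lemmas linear_B_simps = kaehler_space.linear_A_simps[OF swap]

lemma B_frame:
  assumes "i \<in> {1..n}"
  shows "B (v i) = q i" "B (q i) = - v i" "B (p i) = 0"
  using kaehler_space.A_frame[OF swap assms] by auto

lemmas frame_simps = A_frame B_frame linear_A_simps linear_B_simps

lemma linear_compose_AB:
  "linear f \<Longrightarrow> linear (\<lambda>x. A (f x))" "linear f \<Longrightarrow> linear (\<lambda>x. B (f x))"
  using linear_compose[OF _ linear_A, of f] linear_compose[OF _ linear_B, of f]
  by (simp_all add: o_def)

lemma linear_h:
  "linear f \<Longrightarrow> linear (\<lambda>x. h (f x) b)" "linear f \<Longrightarrow> linear (\<lambda>x. h b (f x))"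
  using linear_compose[OF _ inner_formD(2)[OF inner, of b], of f]
    linear_compose[OF _ inner_formD(1)[OF inner, of b], of f]
  by (simp_all add: o_def)

text \<open>\<open>- A (A a)\<close> is the projection onto the span of the \<open>v i\<close> and
  \<open>p i\<close>, with kernel spanned by the \<open>q i\<close>; the first identity says that
  \<open>B\<close> maps its image into its kernel and its kernel into its image. All four are frame
  free, so they hold at every point of a manifold and may be differentiated.\<close>

lemma AB_identities:
  "A (A (B a)) + B (A (A a)) = - B a" "A (B (A a)) = 0" "B (A (B a)) = 0" "B (B (B a)) = - B a"
proof -
  note lin = linear_compose_add linear_compose_neg linear_compose_AB linear_ident linear_zero linear_B
  show "A (A (B a)) + B (A (A a)) = - B a"
    by (rule linear_ext[of "\<lambda>a. A (A (B a)) + B (A (A a))" "\<lambda>a. - B a"]; (intro lin)?)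
      (simp_all add: frame_simps)
  show "A (B (A a)) = 0"
    by (rule linear_ext[of "\<lambda>a. A (B (A a))" "\<lambda>a. 0"]; (intro lin)?) (simp_all add: frame_simps)
  show "B (A (B a)) = 0"
    by (rule linear_ext[of "\<lambda>a. B (A (B a))" "\<lambda>a. 0"]; (intro lin)?) (simp_all add: frame_simps)
  show "B (B (B a)) = - B a"
    by (rule linear_ext[of "\<lambda>a. B (B (B a))" "\<lambda>a. - B a"]; (intro lin)?) (simp_all add: frame_simps)
qed

lemma sharp_form_frame:
  assumes "i \<in> {1..n}"
  shows "sharp_form h \<alpha> a (v i) = h a (v i)" "sharp_form h \<alpha> a (p i) = h a (p i)" "sharp_form h \<alpha> a (q i) = 0"
  using assms by (simp_all add: sharp_form_def h_A_skew frame_simps h_simps)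

text \<open>\<open>A a\<close> lies in the span of the \<open>v i\<close> and \<open>p i\<close>,
  and \<open>B b\<close> in that of the \<open>v i\<close> and \<open>q i\<close>. Only the
  components along \<open>v i\<close> meet, and they are \<open>- h a (p i)\<close> and
  \<open>- h b (q i)\<close>.\<close>

lemma h_inner_A:
  "h (A a) (B b) = (\<Sum>i=1..n. h a (p i) * h b (q i))"
proof -
  have "h (A a) (B b) = (\<Sum>i=1..n. h a (v i) * h (p i) (B b) - h a (p i) * h (v i) (B b))"
    by (simp add: A_eq h_simps)
  also have "\<dots> = (\<Sum>i=1..n. h a (p i) * h b (q i))"
  proof (rule sum.cong)
    fix i assume "i \<in> {1..n}"
    then have "h (p i) (B b) = 0" "h (v i) (B b) = - h b (q i)"
      using h_B_skew[of "p i" b] h_B_skew[of "v i" b] h_commute[of b] by (simp_all add: frame_simps h_simps)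
    then show "h a (v i) * h (p i) (B b) - h a (p i) * h (v i) (B b) = h a (p i) * h b (q i)"
      by simp
  qed simp
  finally show ?thesis .
qed

lemma dual_form_eq:
  "(\<Sum>i=1..n. wedge (\<lambda>a. h a (p i)) (\<lambda>a. h a (q i)) a b) = h (A a) (B b) - h (A b) (B a)"
  by (simp add: h_inner_A wedge_def sum_subtractf)

lemma deform_inner_frame:
  assumes "i \<in> {1..n}" "t > 0"
  shows "deform_inner t h \<alpha> a (v i) = t * h a (v i)" "deform_inner t h \<alpha> a (p i) = t * h a (p i)"
    "deform_inner t h \<alpha> a (q i) = h a (q i) / t"
  using assms by (simp_all add: deform_inner_def sharp_form_frame algebra_simps)

lemma linear_deform_inner: "linear (deform_inner t h \<alpha> a)"
  by (rule linearI) (simp_all add: deform_inner_def sharp_form_def linear_A_simps h_simps algebra_simps)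

lemma deform_inner_commute: "deform_inner t h \<alpha> a b = deform_inner t h \<alpha> b a"
  by (simp add: deform_inner_def sharp_form_def h_commute[of a] h_commute[of "A a"])

text \<open>Positivity is hidden in the formula, since t - 1/t is negative for t < 1. The frame
  diagonalises the form with values t and 1/t, so it dominates \<open>h\<close> times the smaller of
  the two.\<close>

lemma inner_form_deform:
  assumes "t > 0"
  shows "inner_form (deform_inner t h \<alpha>)"
  unfolding inner_form_def
proof (intro conjI allI impI)
  fix a :: 'v assume "a \<noteq> 0"
  then have "h a a > 0"
    using inner_formD(4)[OF inner] by blast
  have exp: "F a = (\<Sum>i=1..n. h a (v i) * F (v i) + h a (p i) * F (p i) + h a (q i) * F (q i))"
    if "linear F" for F :: "'v \<Rightarrow> real"
    by (subst expansion[of a])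
      (simp add: linear_sum[OF that] linear_add[OF that] linear_scale[OF that])
  define m where "m = min t (1 / t)"
  have m: "m > 0" "m \<le> t" "m \<le> 1 / t"
    using assms by (auto simp: m_def)
  have "m * h a a = (\<Sum>i=1..n. m * (h a (v i))\<^sup>2 + m * (h a (p i))\<^sup>2 + m * (h a (q i))\<^sup>2)"
    using exp[OF inner_formD(1)[OF inner, of a]]
    by (simp add: power2_eq_square sum_distrib_left algebra_simps)
  also have "\<dots> \<le> (\<Sum>i=1..n. t * (h a (v i))\<^sup>2 + t * (h a (p i))\<^sup>2 + 1 / t * (h a (q i))\<^sup>2)"
    by (intro sum_mono add_mono mult_right_mono m) auto
  also have "\<dots> = deform_inner t h \<alpha> a a"
    using assms by (subst exp[OF linear_deform_inner])
      (auto intro!: sum.cong simp: deform_inner_frame power2_eq_square)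
  finally show "deform_inner t h \<alpha> a a > 0"
    using \<open>h a a > 0\<close> m by (smt (verit) mult_pos_pos)
qed (use linear_deform_inner deform_inner_commute in blast)+

text \<open>The frame is rescaled to unit length in the new metric. Pairings with the new
  \<open>v i\<close> and \<open>p i\<close> carry a factor sqrt t, those with the new
  \<open>q i\<close> a factor 1/sqrt t: the products give t for \<open>\<alpha>\<close> and 1 for
  \<open>\<beta>\<close>.\<close>

lemma deform_kaehler_space:
  assumes t: "t > 0"
  shows "kaehler_space n (deform_inner t h \<alpha>) (\<lambda>a b. t * \<alpha> a b) \<beta>
    (\<lambda>i. (1 / sqrt t) *\<^sub>R v i) (\<lambda>i. (1 / sqrt t) *\<^sub>R p i) (\<lambda>i. sqrt t *\<^sub>R q i)"
proof
  let ?g = "deform_inner t h \<alpha>"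
  show inner': "inner_form ?g"
    by (rule inner_form_deform[OF t])
  have s: "sqrt t * sqrt t = t" "sqrt t \<noteq> 0"
    using t by auto
  have g: "?g a ((1 / sqrt t) *\<^sub>R v i) = sqrt t * h a (v i)" "?g a ((1 / sqrt t) *\<^sub>R p i) = sqrt t * h a (p i)"
    "?g a (sqrt t *\<^sub>R q i) = h a (q i) / sqrt t"
    if "i \<in> {1..n}" for a i
    using that t s by (simp_all add: inner_formD[OF inner'] deform_inner_frame field_simps)
  show "adapted_frame n ?g (\<lambda>a b. t * \<alpha> a b) \<beta>
    (\<lambda>i. (1 / sqrt t) *\<^sub>R v i) (\<lambda>i. (1 / sqrt t) *\<^sub>R p i) (\<lambda>i. sqrt t *\<^sub>R q i)"
    unfolding adapted_frame_def
  proof (intro conjI allI ballI)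
    fix a
    show "a = (\<Sum>i=1..n. ?g a ((1 / sqrt t) *\<^sub>R v i) *\<^sub>R (1 / sqrt t) *\<^sub>R v i +
        ?g a ((1 / sqrt t) *\<^sub>R p i) *\<^sub>R (1 / sqrt t) *\<^sub>R p i + ?g a (sqrt t *\<^sub>R q i) *\<^sub>R sqrt t *\<^sub>R q i)"
      using s by (subst expansion[of a]) (auto intro!: sum.cong simp: g simp del: real_sqrt_mult_self)
  next
    fix a b
    show "t * \<alpha> a b = (\<Sum>i=1..n. ?g a ((1 / sqrt t) *\<^sub>R v i) * ?g b ((1 / sqrt t) *\<^sub>R p i) -
        ?g b ((1 / sqrt t) *\<^sub>R v i) * ?g a ((1 / sqrt t) *\<^sub>R p i))"
      unfolding form_eq(1)[of a b] sum_distrib_left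
      by (rule sum.cong) (simp_all add: g algebra_simps, simp add: mult.assoc[symmetric] abs_of_pos t)
    show "\<beta> a b = (\<Sum>i=1..n. ?g a ((1 / sqrt t) *\<^sub>R v i) * ?g b (sqrt t *\<^sub>R q i) -
        ?g b ((1 / sqrt t) *\<^sub>R v i) * ?g a (sqrt t *\<^sub>R q i))"
      unfolding form_eq(2)[of a b] using s
      by (intro sum.cong) (simp_all add: g)
  qed (use s in \<open>simp_all add: g h_simps ortho\<close>)
qed

lemma scale_kaehler_space:
  assumes t: "t > 0"
  shows "kaehler_space n (\<lambda>a b. t * h a b) (\<lambda>a b. t * \<alpha> a b) (\<lambda>a b. t * \<beta> a b)
    (\<lambda>i. (1 / sqrt t) *\<^sub>R v i) (\<lambda>i. (1 / sqrt t) *\<^sub>R p i) (\<lambda>i. (1 / sqrt t) *\<^sub>R q i)"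
proof
  let ?g = "\<lambda>a b. t * h a b"
  show "inner_form ?g"
    using inner t by (auto simp: inner_form_def linear_iff algebra_simps)
  have s: "sqrt t * sqrt t = t" "sqrt t \<noteq> 0"
    using t by auto
  have g: "t * h a ((1 / sqrt t) *\<^sub>R b) = sqrt t * h a b" for a b
    using s by (simp add: h_simps field_simps)
  show "adapted_frame n ?g (\<lambda>a b. t * \<alpha> a b) (\<lambda>a b. t * \<beta> a b)
    (\<lambda>i. (1 / sqrt t) *\<^sub>R v i) (\<lambda>i. (1 / sqrt t) *\<^sub>R p i) (\<lambda>i. (1 / sqrt t) *\<^sub>R q i)"
    unfolding adapted_frame_def g
  proof (intro conjI allI ballI)
    fix a
    show "a = (\<Sum>i=1..n. (sqrt t * h a (v i)) *\<^sub>R (1 / sqrt t) *\<^sub>R v i +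
        (sqrt t * h a (p i)) *\<^sub>R (1 / sqrt t) *\<^sub>R p i + (sqrt t * h a (q i)) *\<^sub>R (1 / sqrt t) *\<^sub>R q i)"
      using s by (subst expansion[of a]) (auto intro!: sum.cong simp del: real_sqrt_mult_self)
  next
    fix a b
    show "t * \<alpha> a b = (\<Sum>i=1..n. sqrt t * h a (v i) * (sqrt t * h b (p i)) -
        sqrt t * h b (v i) * (sqrt t * h a (p i)))"
      unfolding form_eq(1)[of a b] sum_distrib_left
      by (rule sum.cong) (simp_all add: algebra_simps, simp add: mult.assoc[symmetric] abs_of_pos t)
    show "t * \<beta> a b = (\<Sum>i=1..n. sqrt t * h a (v i) * (sqrt t * h b (q i)) -
        sqrt t * h b (v i) * (sqrt t * h a (q i)))"
      unfolding form_eq(2)[of a b] sum_distrib_left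
      by (rule sum.cong) (simp_all add: algebra_simps, simp add: mult.assoc[symmetric] abs_of_pos t)
  qed (use s in \<open>simp_all add: h_simps ortho\<close>)
qed

end

section \<open>Algebra of the derivative of \<open>B\<close> when \<open>A\<close> is
  parallel\<close>

context kaehler_space
begin

text \<open>Here \<open>N u\<close> stands for the covariant derivative of \<open>B\<close> along \<open>u\<close> when \<open>A\<close> is parallel. The
  conditions \<open>AAB\<close>, \<open>BAB\<close>, \<open>BBB\<close> are the derivatives of the identities between \<open>A\<close> and \<open>B\<close>,
  \<open>cyclic\<close> expresses that \<open>\<beta>\<close> is closed, and \<open>involutive\<close> that the sum of the kernels is integrable.\<close>

lemma parallel_transfer:
  assumes lin: "\<And>u. linear (N u)" "\<And>a. linear (\<lambda>u. N u a)"
    and AAB: "\<And>u a. N u (A (A a)) + A (A (N u a)) = - N u a"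
    and BAB: "\<And>u a. N u (A (B a)) + B (A (N u a)) = 0"
    and BBB: "\<And>u a. N u (B (B a)) + B (N u (B a)) + B (B (N u a)) = - N u a"
    and skew: "\<And>u a b. h (N u a) b = - h (N u b) a"
    and cyclic: "\<And>u a b. h (N u a) b + h (N a b) u + h (N b u) a = 0"
    and involutive: "\<And>i k. i \<in> {1..n} \<Longrightarrow> k \<in> {1..n} \<Longrightarrow> N (q i) (p k) = 0"
  shows "B (N u a) = B (N a u)" and "h (A (B (N u a))) b = h (A (B (N u b))) a"
proof -
  define T where "T u a b = h (N u a) b" for u a b
  have linT: "linear (\<lambda>u. T u a b)" "linear (\<lambda>a. T u a b)" "linear (\<lambda>b. T u a b)" for u a b
    unfolding T_def by (rule linear_h lin inner_formD(1)[OF inner])+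
  have T_skew: "T u a b = - T u b a" for u a b
    unfolding T_def by (rule skew)
  have T_cyclic: "T u a b + T a b u + T b u a = 0" for u a b
    unfolding T_def by (rule cyclic)
  have N_neg: "N u (- a) = - N u a" "N u 0 = 0" for u a
    using linear_neg[OF lin(1)] linear_0[OF lin(1)] by auto
  have AA_sym: "h (A (A a)) b = h a (A (A b))" for a b
    by (simp add: h_A_skew)
  \<comment> \<open>By \<open>AAB\<close>, \<open>N u\<close> exchanges the eigenspaces of
    \<open>A A\<close> for the eigenvalues -1 and 0. Hence its blocks within each of them vanish,
    which is \<open>YY\<close> and \<open>ZZ\<close>.\<close>
  have YY: "T u a b = 0" if "A (A a) = - a" "A (A b) = - b" for u a b
  proof -
    have "A (A (N u a)) = 0"
      using AAB[of u a] that by (simp add: N_neg)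
    then have "h (N u a) (A (A b)) = 0"
      using AA_sym[of "N u a" b] by (simp add: h_simps)
    then show ?thesis
      using that by (simp add: T_def h_simps)
  qed
  have ZZ: "T u a b = 0" if "A a = 0" "A b = 0" for u a b
  proof -
    have "A (A (N u a)) = - N u a"
      using AAB[of u a] that by (simp add: N_neg frame_simps)
    then have "- T u a b = h (N u a) (A (A b))"
      using AA_sym[of "N u a" b] by (simp add: T_def h_simps)
    then show ?thesis
      using that by (simp add: frame_simps h_simps)
  qed
  \<comment> \<open>What remains of \<open>N u\<close> is one block pairing the \<open>v i\<close>
    with the \<open>q k\<close> and one pairing the \<open>p i\<close> with the \<open>q k\<close>.
    \<open>BBB\<close> makes the former skew in the two indices, \<open>BAB\<close> makes the latter
    symmetric.\<close>
  have x_skew: "T u (v i) (q k) = - T u (v k) (q i)" if "i \<in> {1..n}" "k \<in> {1..n}" for u i k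
  proof -
    have "h (N u (B (B (v i))) + B (N u (B (v i))) + B (B (N u (v i)))) (q k) = h (- N u (v i)) (q k)"
      using BBB by simp
    then have "- T u (v i) (q k) + T u (q i) (v k) - T u (v i) (q k) = - T u (v i) (q k)"
      using that by (simp add: T_def h_simps h_B_skew frame_simps N_neg)
    then show ?thesis
      using T_skew[of u "q i" "v k"] by simp
  qed
  have y_sym: "T u (p i) (q k) = T u (p k) (q i)" if "i \<in> {1..n}" "k \<in> {1..n}" for u i k
  proof -
    have "h (N u (A (B (q i))) + B (A (N u (q i)))) (q k) = 0"
      using BAB by (simp add: h_simps)
    then have "- T u (p i) (q k) - T u (q i) (p k) = 0"
      using that by (simp add: T_def h_simps h_A_skew h_B_skew frame_simps N_neg)
    then show ?thesis
      using T_skew[of u "q i" "p k"] by simp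
  qed
  have frame_YZ: "A (A (v i)) = - v i" "A (A (p i)) = - p i" "A (q i) = 0" if "i \<in> {1..n}" for i
    using that by (simp_all add: frame_simps)
  \<comment> \<open>In each of the next three facts one term of the cyclic identity is killed by
    \<open>YY\<close> or \<open>ZZ\<close>, so that the identity becomes an exchange of two
    arguments.\<close>
  have xq: "T (q j) (v i) (q k) = T (q k) (v i) (q j)"
    if "i \<in> {1..n}" "k \<in> {1..n}" "j \<in> {1..n}" for i j k
    using T_cyclic[of "q j" "v i" "q k"] ZZ[OF frame_YZ(3)[OF that(2)] frame_YZ(3)[OF that(3)], of "v i"]
      T_skew[of "q k" "q j" "v i"] by linarith
  have xv: "T (v j) (v i) (q k) = T (v i) (v j) (q k)"
    if "i \<in> {1..n}" "k \<in> {1..n}" "j \<in> {1..n}" for i j k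
    using T_cyclic[of "v j" "v i" "q k"] YY[OF frame_YZ(1)[OF that(3)] frame_YZ(1)[OF that(1)], of "q k"]
      T_skew[of "v i" "q k" "v j"] by linarith
  have xp: "T (p j) (v i) (q k) = T (v i) (p j) (q k)"
    if "i \<in> {1..n}" "k \<in> {1..n}" "j \<in> {1..n}" for i j k
    using T_cyclic[of "p j" "v i" "q k"] YY[OF frame_YZ(2)[OF that(3)] frame_YZ(1)[OF that(1)], of "q k"]
      T_skew[of "v i" "q k" "p j"] by linarith
  \<comment> \<open>An array with three indices that is skew in one pair and symmetric in another
    pair vanishes. For \<open>u = v j\<close> and \<open>u = q j\<close> the symmetry is
    \<open>xv\<close> or \<open>xq\<close>; for \<open>u = p j\<close> it comes from
    \<open>y_sym\<close> through \<open>xp\<close>.\<close>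
  have x_zero: "T u (v i) (q k) = 0" if i: "i \<in> {1..n}" and k: "k \<in> {1..n}" for u i k
  proof (rule linear_ext[OF linT(1) linear_zero])
    fix j assume j: "j \<in> {1..n}"
    show "T (v j) (v i) (q k) = 0"
      using xv[OF i k j] xv[OF k i j] xv[OF k j i] x_skew[OF i k, of "v j"] x_skew[OF j k, of "v i"]
        x_skew[OF i j, of "v k"] by linarith
    show "T (p j) (v i) (q k) = 0"
      using xp[OF i k j] xp[OF k i j] xp[OF i j k] xp[OF j i k] xp[OF j k i] xp[OF k j i]
        x_skew[OF i k, of "p j"] x_skew[OF j k, of "p i"] x_skew[OF i j, of "p k"]
        y_sym[OF j k, of "v i"] y_sym[OF j i, of "v k"] y_sym[OF i k, of "v j"] by linarith
    show "T (q j) (v i) (q k) = 0"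
      using xq[OF i k j] xq[OF k i j] xq[OF j k i] x_skew[OF i k, of "q j"] x_skew[OF i j, of "q k"]
        x_skew[OF j k, of "q i"] by linarith
  qed
  note vanish = YY ZZ x_zero frame_YZ
  have vanish': "T u (q k) (v i) = 0" if "i \<in> {1..n}" "k \<in> {1..n}" for u i k
    using x_zero[OF that] T_skew[of u "q k" "v i"] by simp
  \<comment> \<open>The previous relations make this block totally symmetric but do not kill it; its
    vanishing is the contribution of integrability.\<close>
  have qp: "T (q j) (p i) (q k) = 0" "T (q j) (q k) (p i) = 0"
    if "i \<in> {1..n}" "k \<in> {1..n}" "j \<in> {1..n}" for i j k
    using involutive[of j i] that T_skew[of "q j" "q k" "p i"] by (simp_all add: T_def h_simps)
  have Tq: "T (q j) a b = 0" if "j \<in> {1..n}" for j a b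
    by (rule bilinear_ext[of "T (q j)" "\<lambda>a b. 0", OF linT(3) linT(2) linear_zero linear_zero])
      (use that in \<open>auto simp: vanish vanish' qp\<close>)
  have Tv: "T u a (v k) = 0" if "k \<in> {1..n}" for u a k
    by (rule linear_ext[OF linT(2) linear_zero]) (use that in \<open>auto simp: vanish vanish'\<close>)
  show "B (N u a) = B (N a u)"
  proof (rule inner_form_eqI[OF inner])
    fix w
    \<comment> \<open>Pairing with \<open>w\<close> and moving \<open>B\<close> across leaves only
      the values of \<open>T u a\<close> on the \<open>q k\<close> and \<open>v k\<close>. On
      \<open>q k\<close> the term with \<open>q k\<close> in first place is zero, so the cyclic
      identity gives the symmetry; on \<open>v k\<close> both sides vanish.\<close>
    have *: "T u a (B w) = T a u (B w)"
    proof (rule linear_ext[of "\<lambda>w. T u a (B w)" "\<lambda>w. T a u (B w)"])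
      show "linear (\<lambda>w. T u a (B w))" "linear (\<lambda>w. T a u (B w))"
        unfolding T_def by (intro linear_h linear_B)+
      fix k assume k: "k \<in> {1..n}"
      show "T u a (B (v k)) = T a u (B (v k))"
        using T_cyclic[of u a "q k"] Tq[OF k] T_skew[of a "q k" u] k by (simp add: frame_simps)
      show "T u a (B (p k)) = T a u (B (p k))"
        using k by (simp add: frame_simps T_def h_simps)
      show "T u a (B (q k)) = T a u (B (q k))"
        using Tv[OF k] k by (simp add: frame_simps T_def h_simps)
    qed
    then show "h (B (N u a)) w = h (B (N a u)) w"
      by (simp add: h_B_skew T_def)
  qed
  \<comment> \<open>On the frame \<open>B (A b)\<close> is nonzero only for \<open>b = p k\<close>,
    where it equals \<open>- q k\<close>. The values of \<open>T u\<close> against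
    \<open>q k\<close> vanish on the \<open>v i\<close> and the \<open>q i\<close> and are symmetric
    on the \<open>p i\<close>.\<close>
  have "T u a (B (A b)) = T u b (B (A a))"
  proof (rule bilinear_ext[of "\<lambda>a b. T u a (B (A b))" "\<lambda>a b. T u b (B (A a))"])
    have l: "linear (\<lambda>b. T u a (B (A b)))" for a
      unfolding T_def by (intro linear_h linear_compose_AB linear_ident)
    show "linear (\<lambda>b. T u a (B (A b)))" "linear (\<lambda>a. T u b (B (A a)))" for a b
      by (rule l)+
    show "linear (\<lambda>a. T u a (B (A b)))" "linear (\<lambda>b. T u b (B (A a)))" for a b
      by (rule linT(2))+
    have T0: "T u a 0 = 0" "T u a (- b) = - T u a b" for a b
      by (simp_all add: T_def h_simps)
    fix x y
    assume "x \<in> v ` {1..n} \<union> p ` {1..n} \<union> q ` {1..n}" "y \<in> v ` {1..n} \<union> p ` {1..n} \<union> q ` {1..n}"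
    then show "T u x (B (A y)) = T u y (B (A x))"
      by (auto simp: frame_simps T0 vanish y_sym)
  qed
  then show "h (A (B (N u a))) b = h (A (B (N u b))) a"
    by (simp add: h_A_skew h_B_skew T_def)
qed

end

section \<open>Orthonormal standard bases as adapted frames\<close>

lemma basis_set_eq_image:
  "basis_set n s v w =
    (\<lambda>x. case x of (j, i) \<Rightarrow> if j = 0 then v i else w j i) ` ({0..s} \<times> {1..n})" (is "?B = ?e ` ?I")
proof
  show "?B \<subseteq> ?e ` ?I"
  proof
    fix x assume "x \<in> ?B"
    then consider i where "i \<in> {1..n}" "x = v i" | i j where "i \<in> {1..n}" "j \<in> {1..s}" "x = w j i"
      unfolding basis_set_def by blast
    then show "x \<in> ?e ` ?I"
    proof cases
      case (1 i)
      then show ?thesis by (intro image_eqI[of _ _ "(0, i)"]) auto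
    next
      case (2 i j)
      then show ?thesis by (intro image_eqI[of _ _ "(j, i)"]) auto
    qed
  qed
  show "?e ` ?I \<subseteq> ?B"
  proof
    fix x assume "x \<in> ?e ` ?I"
    then obtain j i where *: "j \<le> s" "i \<in> {1..n}" "x = (if j = 0 then v i else w j i)"
      by auto
    then show "x \<in> ?B"
      unfolding basis_set_def by (cases "j = 0") (simp, force)
  qed
qed

text \<open>Coefficients with respect to an orthonormal basis are inner products, so the dual basis
  consists of pairings with \<open>h\<close>.\<close>

lemma orthonormal_standard_basisD:
  assumes h: "inner_form h" and b: "orthonormal_standard_basis n 2 \<omega> h v w"
  shows "adapted_frame n h (\<omega> 1) (\<omega> 2) v (w 1) (w 2)"
    and "\<And>b. b \<in> basis_set n 2 v w \<Longrightarrow> dual_vector (basis_set n 2 v w) b = (\<lambda>a. h a b)"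
proof -
  define S where "S = basis_set n 2 v w"
  define e where "e x = (case x of (j, i) \<Rightarrow> if j = 0 then v i else w j i)" for x :: "nat \<times> nat"
  have basis: "card S = n * 3" "independent S" "span S = UNIV"
    and on: "\<And>a b. a \<in> S \<Longrightarrow> b \<in> S \<Longrightarrow> h a b = (if a = b then 1 else 0)"
    and \<omega>: "\<And>j a b. j \<in> {1..2} \<Longrightarrow> \<omega> j a b =
        (\<Sum>i=1..n. wedge (dual_vector S (v i)) (dual_vector S (w j i)) a b)"
    using b unfolding orthonormal_standard_basis_def standard_basis_def is_basis_def S_def by auto
  have S_eq: "S = e ` ({0..2} \<times> {1..n})"
    unfolding S_def basis_set_eq_image e_def ..
  \<comment> \<open>The cardinality demanded by \<open>is_basis\<close> equals the number of
    indices, so no two indices share a vector; index 0 stands for the \<open>v i\<close>.\<close>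
  have inj: "inj_on e ({0..2} \<times> {1..n})"
    using basis(1) S_eq by (intro eq_card_imp_inj_on) auto
  have fin: "finite S"
    using S_eq by simp
  have rep: "representation S a b = h a b" if "b \<in> S" for a b
  proof -
    have "(\<Sum>b'\<in>S. representation S a b' *\<^sub>R b') = a"
      using basis fin by (intro sum_representation_eq) auto
    then have "h a b = (\<Sum>b'\<in>S. representation S a b' * h b' b)"
      using inner_formD(10)[OF h, of "\<lambda>b'. representation S a b' *\<^sub>R b'" S b]
      by (simp add: inner_formD(7)[OF h])
    also have "\<dots> = (\<Sum>b'\<in>S. if b' = b then representation S a b' else 0)"
      using on that by (intro sum.cong) auto
    finally show ?thesis
      using fin that by simp
  qed
  then show dual: "dual_vector (basis_set n 2 v w) b = (\<lambda>a. h a b)" if "b \<in> basis_set n 2 v w" for b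
    using that by (auto simp: dual_vector_def S_def)
  have mem: "v i \<in> S" "w j i \<in> S" if "i \<in> {1..n}" "j \<in> {1..2}" for i j
    using that unfolding S_def basis_set_def by blast+
  have exp: "a = (\<Sum>i=1..n. h a (v i) *\<^sub>R v i + h a (w 1 i) *\<^sub>R w 1 i + h a (w 2 i) *\<^sub>R w 2 i)" for a
  proof -
    have "a = (\<Sum>b\<in>S. h a b *\<^sub>R b)"
      using basis fin rep sum_representation_eq[of S a S] by simp
    also have "\<dots> = (\<Sum>j=0..2. \<Sum>i=1..n. h a (e (j, i)) *\<^sub>R e (j, i))"
      unfolding S_eq using inj by (simp add: sum.reindex sum.cartesian_product case_prod_beta)
    also have "\<dots> = (\<Sum>i=1..n. h a (v i) *\<^sub>R v i + h a (w 1 i) *\<^sub>R w 1 i + h a (w 2 i) *\<^sub>R w 2 i)"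
      by (simp add: e_def numeral_2_eq_2 sum.distrib)
    finally show ?thesis .
  qed
  have ortho: "h (e x) (e y) = (if x = y then 1 else 0)"
    if "x \<in> {0..2} \<times> {1..n}" "y \<in> {0..2} \<times> {1..n}" for x y
    using on[of "e x" "e y"] S_eq inj that by (auto simp: inj_on_eq_iff)
  have \<omega>': "\<omega> j a b = (\<Sum>i=1..n. h a (v i) * h b (w j i) - h b (v i) * h a (w j i))"
    if "j \<in> {1..2}" for j a b
    unfolding \<omega>[OF that]
    by (rule sum.cong) (use that mem in \<open>auto simp: wedge_def dual_vector_def rep\<close>)
  show "adapted_frame n h (\<omega> 1) (\<omega> 2) v (w 1) (w 2)"
    unfolding adapted_frame_def
  proof (intro conjI allI ballI)
    fix i k assume "i \<in> {1..n}" "k \<in> {1..n}"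
    then show "h (v i) (v k) = (if i = k then 1 else 0)" "h (w 1 i) (w 1 k) = (if i = k then 1 else 0)"
      "h (w 2 i) (w 2 k) = (if i = k then 1 else 0)"
      "h (v i) (w 1 k) = 0" "h (v i) (w 2 k) = 0" "h (w 1 i) (w 2 k) = 0"
      using ortho[of "(0, i)" "(0, k)"] ortho[of "(1, i)" "(1, k)"] ortho[of "(2, i)" "(2, k)"]
        ortho[of "(0, i)" "(1, k)"] ortho[of "(0, i)" "(2, k)"] ortho[of "(1, i)" "(2, k)"]
      by (auto simp: e_def)
  qed (rule exp, (rule \<omega>', simp)+)
qed

lemma kaehler_space_orthonormal_standard_basis:
  assumes "kaehler_space n h (\<omega> 1) (\<omega> 2) v (w 1) (w 2)"
  shows "orthonormal_standard_basis n 2 \<omega> h v w"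
proof -
  interpret kaehler_space n h "\<omega> 1" "\<omega> 2" v "w 1" "w 2"
    by (rule assms)
  define S where "S = basis_set n 2 v w"
  define e where "e x = (case x of (j, i) \<Rightarrow> if j = 0 then v i else w j i)" for x :: "nat \<times> nat"
  have S_eq: "S = e ` ({0..2} \<times> {1..n})"
    unfolding S_def basis_set_eq_image e_def ..
  have ortho_e: "h (e x) (e y) = (if x = y then 1 else 0)"
    if "x \<in> {0..2} \<times> {1..n}" "y \<in> {0..2} \<times> {1..n}" for x y
  proof -
    have three: "j = 0 \<or> j = 1 \<or> j = 2" if "j \<in> {0..2}" for j :: nat
      using that by auto
    show ?thesis
      using that three[of "fst x"] three[of "fst y"]
      by (cases x; cases y) (auto simp: e_def ortho ortho[unfolded One_nat_def])
  qed
  have inj: "inj_on e ({0..2} \<times> {1..n})"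
    using ortho_e by (intro inj_onI) (metis zero_neq_one)
  have on: "h a b = (if a = b then 1 else 0)" if "a \<in> S" "b \<in> S" for a b
    using that ortho_e inj unfolding S_eq by (auto simp: inj_on_eq_iff)
  have card: "card S = n * (2 + 1)"
    unfolding S_eq using inj by (simp add: card_image)
  have fin: "finite S"
    using S_eq by simp
  have indep: "independent S"
  proof (rule independent_if_scalars_zero[OF fin])
    fix f x assume f: "(\<Sum>x\<in>S. f x *\<^sub>R x) = 0" and x: "x \<in> S"
    have "0 = (\<Sum>y\<in>S. f y * h y x)"
      using arg_cong[OF f, of "\<lambda>a. h a x"] by (simp add: h_simps)
    also have "\<dots> = (\<Sum>y\<in>S. if y = x then f y else 0)"
      using on x by (intro sum.cong) auto
    finally show "f x = 0"
      using fin x by simp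
  qed
  have mem: "v i \<in> S" "w j i \<in> S" if "i \<in> {1..n}" "j \<in> {1..2}" for i j
    using that unfolding S_def basis_set_def by blast+
  have "a \<in> span S" for a
    by (subst expansion[of a]) (intro span_sum span_add span_scale span_base mem(1)[of _ 1] mem(2)[of _ 1] mem(2)[of _ 2]; simp)
  then have span: "span S = UNIV"
    by blast
  have rep: "representation S a b = h a b" if "b \<in> S" for a b
  proof -
    have "(\<Sum>b'\<in>S. representation S a b' *\<^sub>R b') = a"
      using indep span fin by (intro sum_representation_eq) auto
    then have "h a b = (\<Sum>b'\<in>S. representation S a b' * h b' b)"
      using inner_formD(10)[OF inner, of "\<lambda>b'. representation S a b' *\<^sub>R b'" S b]
      by (simp add: inner_formD(7)[OF inner])
    also have "\<dots> = (\<Sum>b'\<in>S. if b' = b then representation S a b' else 0)"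
      using on that by (intro sum.cong) auto
    finally show ?thesis
      using fin that by simp
  qed
  have "\<omega> j a b = (\<Sum>i=1..n. wedge (dual_vector S (v i)) (dual_vector S (w j i)) a b)"
    if "j \<in> {1..2}" for j a b
  proof -
    have "j = 1 \<or> j = 2"
      using that by auto
    then have "\<omega> j a b = (\<Sum>i=1..n. h a (v i) * h b (w j i) - h b (v i) * h a (w j i))"
      using form_eq[of a b] by (elim disjE) simp_all
    also have "\<dots> = (\<Sum>i=1..n. wedge (dual_vector S (v i)) (dual_vector S (w j i)) a b)"
      by (rule sum.cong) (use that mem in \<open>auto simp: wedge_def dual_vector_def rep\<close>)
    finally show ?thesis .
  qed
  then show ?thesis
    unfolding orthonormal_standard_basis_def standard_basis_def is_basis_def S_def[symmetric]
    using card indep span on by blast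
qed

lemma orthonormal_standard_basis_iff:
  assumes "inner_form h"
  shows "orthonormal_standard_basis n 2 \<omega> h v w \<longleftrightarrow> kaehler_space n h (\<omega> 1) (\<omega> 2) v (w 1) (w 2)"
  using assms orthonormal_standard_basisD(1) kaehler_space_orthonormal_standard_basis
  unfolding kaehler_space_def by blast

definition dual_inner ::
    "('v \<Rightarrow> 'v \<Rightarrow> real) \<Rightarrow> ('v \<Rightarrow> 'v \<Rightarrow> real) \<Rightarrow> ('v \<Rightarrow> 'v \<Rightarrow> real) \<Rightarrow> 'v \<Rightarrow> 'v \<Rightarrow> real" where
  "dual_inner h \<alpha> \<beta> a b =
     h (sharp h \<alpha> a) (sharp h \<beta> b) - h (sharp h \<alpha> b) (sharp h \<beta> a)"

section \<open>The dualizing form on one tangent space, and behaviour under linear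
  isomorphisms\<close>

context kaehler_space
begin

lemma dual_inner_eq:
  "dual_inner h \<alpha> \<beta> = (\<lambda>a b. \<Sum>i=1..n. wedge (\<lambda>a. h a (p i)) (\<lambda>a. h a (q i)) a b)"
  by (intro ext) (simp only: dual_inner_def dual_form_eq)

text \<open>In the rescaled frame the pairings with \<open>p i\<close> are multiplied by sqrt t and
  those with \<open>q i\<close> by 1/sqrt t, so each product of the two is unchanged.\<close>

lemma dual_inner_deform:
  assumes t: "t > 0"
  shows "dual_inner (deform_inner t h \<alpha>) (\<lambda>a b. t * \<alpha> a b) \<beta> = dual_inner h \<alpha> \<beta>"
proof -
  interpret d: kaehler_space n "deform_inner t h \<alpha>" "\<lambda>a b. t * \<alpha> a b" \<beta>
    "\<lambda>i. (1 / sqrt t) *\<^sub>R v i" "\<lambda>i. (1 / sqrt t) *\<^sub>R p i" "\<lambda>i. sqrt t *\<^sub>R q i"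
    by (rule deform_kaehler_space[OF t])
  have s: "sqrt t * sqrt t = t" "sqrt t \<noteq> 0"
    using t by auto
  show ?thesis
    unfolding d.dual_inner_eq dual_inner_eq
  proof (intro ext sum.cong refl)
    fix a b i assume "i \<in> {1..n}"
    then show "wedge (\<lambda>a. deform_inner t h \<alpha> a ((1 / sqrt t) *\<^sub>R p i)) (\<lambda>a. deform_inner t h \<alpha> a (sqrt t *\<^sub>R q i)) a b =
        wedge (\<lambda>a. h a (p i)) (\<lambda>a. h a (q i)) a b"
      using t s by (simp add: wedge_def d.h_simps deform_inner_frame)
  qed
qed

text \<open>Exchanging the forms changes the sign both before and after deformation; thus invariance
  under the second deformation follows from that under the first.\<close>

lemma dual_inner_swap: "dual_inner h \<beta> \<alpha> a b = - dual_inner h \<alpha> \<beta> a b"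
  by (simp add: dual_inner_def h_commute[of "A _"])

text \<open>Naturality of raising an index. It allows \<open>sharp\<close> to be computed from local
  expressions, although the fields live on tangent spaces read in the reference charts.\<close>

lemma h_sharp:
  assumes "linear F" "linear G" "\<And>a. F (G a) = a" "\<And>a. G (F a) = a"
  shows "sharp (\<lambda>a b. h (F a) (F b)) (\<lambda>a b. \<alpha> (F a) (F b)) a = G (A (F a))"
  unfolding sharp_def[of "\<lambda>a b. h (F a) (F b)"]
proof (rule the_equality)
  show "\<forall>w. h (F (G (A (F a)))) (F w) = \<alpha> (F a) (F w)"
    by (simp add: assms h_A)
  show "y = G (A (F a))" if y: "\<forall>w. h (F y) (F w) = \<alpha> (F a) (F w)" for y
  proof -
    have "h (F y) w = h (A (F a)) w" for w
      using y[rule_format, of "G w"] by (simp add: assms h_A)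
    then have "F y = A (F a)"
      by (rule inner_form_eqI[OF inner])
    then show ?thesis
      using assms(4) by metis
  qed
qed

lemma pullback:
  fixes F :: "'u::real_vector \<Rightarrow> 'v"
  assumes FG: "linear F" "linear G" "\<And>a. F (G a) = a" "\<And>a. G (F a) = a"
  shows "kaehler_space n (\<lambda>a b. h (F a) (F b)) (\<lambda>a b. \<alpha> (F a) (F b)) (\<lambda>a b. \<beta> (F a) (F b))
    (\<lambda>i. G (v i)) (\<lambda>i. G (p i)) (\<lambda>i. G (q i))"
proof
  show "inner_form (\<lambda>a b. h (F a) (F b))"
    unfolding inner_form_def
  proof (intro conjI allI impI)
    show "linear (\<lambda>b. h (F a) (F b))" for a
      by (rule linear_h(2)[OF FG(1)])
    show "h (F a) (F b) = h (F b) (F a)" for a b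
      by (rule h_commute)
    fix a :: 'u assume "a \<noteq> 0"
    then have "F a \<noteq> 0"
      using FG(4)[of a] linear_0[OF FG(2)] by metis
    then show "h (F a) (F a) > 0"
      by (rule inner_formD(4)[OF inner])
  qed
  show "adapted_frame n (\<lambda>a b. h (F a) (F b)) (\<lambda>a b. \<alpha> (F a) (F b)) (\<lambda>a b. \<beta> (F a) (F b))
    (\<lambda>i. G (v i)) (\<lambda>i. G (p i)) (\<lambda>i. G (q i))"
    unfolding adapted_frame_def
  proof (intro conjI allI ballI)
    fix a
    have "G (F a) = (\<Sum>i=1..n. h (F a) (v i) *\<^sub>R G (v i) + h (F a) (p i) *\<^sub>R G (p i) + h (F a) (q i) *\<^sub>R G (q i))"
      by (subst expansion[of "F a"])
        (simp add: linear_sum[OF FG(2)] linear_add[OF FG(2)] linear_scale[OF FG(2)])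
    then show "a = (\<Sum>i=1..n. h (F a) (F (G (v i))) *\<^sub>R G (v i) + h (F a) (F (G (p i))) *\<^sub>R G (p i) +
        h (F a) (F (G (q i))) *\<^sub>R G (q i))"
      by (simp only: FG(3,4))
  next
    fix a b
    show "\<alpha> (F a) (F b) = (\<Sum>i=1..n. h (F a) (F (G (v i))) * h (F b) (F (G (p i))) -
        h (F b) (F (G (v i))) * h (F a) (F (G (p i))))"
      "\<beta> (F a) (F b) = (\<Sum>i=1..n. h (F a) (F (G (v i))) * h (F b) (F (G (q i))) -
        h (F b) (F (G (v i))) * h (F a) (F (G (q i))))"
      by (simp_all only: FG(3) form_eq)
  qed (simp_all add: FG(3) ortho)
qed

lemma deform_inner_pullback:
  assumes "linear F" "linear G" "\<And>a. F (G a) = a" "\<And>a. G (F a) = a"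
  shows "deform_inner t (\<lambda>a b. h (F a) (F b)) (\<lambda>a b. \<alpha> (F a) (F b)) a b = deform_inner t h \<alpha> (F a) (F b)"
  by (simp add: deform_inner_def sharp_form_def h_sharp[OF assms] assms(3))

end

section \<open>Coordinates of tangent vectors\<close>

lemma chart_inv_snd: "is_chart c \<Longrightarrow> p \<in> fst c \<Longrightarrow> chart_inv c (snd c p) = p"
  by (simp add: chart_inv_def is_chart_def)

lemma chart_inv_mem:
  "x \<in> chart_range c \<Longrightarrow> chart_inv c x \<in> fst c" "x \<in> chart_range c \<Longrightarrow> snd c (chart_inv c x) = x"
  by (simp_all add: chart_inv_def chart_range_def inv_into_into f_inv_into_f)

text \<open>Common generalisation of \<open>from_coords\<close> and \<open>to_coords\<close>, where
  one chart is the reference chart. It also covers charts outside the atlas, such as those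
  straightening a distribution.\<close>

definition transition_deriv ::
    "('a, 'e::euclidean_space) chart \<Rightarrow> ('a, 'f::euclidean_space) chart \<Rightarrow> 'a \<Rightarrow> 'e \<Rightarrow> 'f" where
  "transition_deriv c d p = frechet_derivative (snd d \<circ> chart_inv c) (at (snd c p))"

lemma from_coords_eq: "from_coords M c p = transition_deriv c (chart_at M p) p"
  and to_coords_eq: "to_coords M c p = transition_deriv (chart_at M p) c p"
  by (simp_all add: from_coords_def to_coords_def transition_deriv_def)

lemma transition_has_derivative:
  assumes "compatible_charts c d" "p \<in> fst c" "p \<in> fst d"
  shows "(snd d \<circ> chart_inv c has_derivative transition_deriv c d p) (at (snd c p))"
  unfolding transition_deriv_def
  using assms by (intro smooth_onD(4)[of "snd c ` (fst c \<inter> fst d)"]) (auto simp: compatible_charts_def)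

lemma linear_transition_deriv:
  assumes "compatible_charts c d" "p \<in> fst c" "p \<in> fst d"
  shows "linear (transition_deriv c d p)"
  using transition_has_derivative[OF assms] has_derivative_linear by blast

lemma transition_deriv_self:
  assumes "is_chart c" "p \<in> fst c"
  shows "transition_deriv c c p = (\<lambda>u. u)"
proof -
  have "open (chart_range c)" "snd c p \<in> chart_range c"
    using assms by (auto simp: is_chart_def chart_range_def)
  then show ?thesis
    unfolding transition_deriv_def
    by (subst frechet_derivative_cong_open[of "chart_range c" _ _ "\<lambda>x. x"])
      (auto simp: chart_inv_mem)
qed

lemma transition_deriv_compose:
  assumes "is_chart c" "is_chart d" "compatible_charts c d" "compatible_charts d e"
    and p: "p \<in> fst c" "p \<in> fst d" "p \<in> fst e"
  shows "transition_deriv c e p u = transition_deriv d e p (transition_deriv c d p u)"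
proof -
  define S where "S = snd c ` (fst c \<inter> fst d)"
  have S: "open S" "snd c p \<in> S"
    using assms smooth_onD(1)[of S] by (auto simp: S_def compatible_charts_def)
  have "((snd e \<circ> chart_inv d) \<circ> (snd d \<circ> chart_inv c) has_derivative
      transition_deriv d e p \<circ> transition_deriv c d p) (at (snd c p))"
    using transition_has_derivative[OF assms(4) p(2,3)] assms
    by (intro diff_chain_at transition_has_derivative) (simp_all add: chart_inv_snd)
  then have "(snd e \<circ> chart_inv c has_derivative
      transition_deriv d e p \<circ> transition_deriv c d p) (at (snd c p))"
    by (rule has_derivative_transform_within_open[OF _ S])
      (use assms in \<open>auto simp: S_def chart_inv_snd\<close>)
  then show ?thesis
    unfolding transition_deriv_def[of c e] by (simp add: frechet_derivative_eq)
qed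

lemma compatible_charts_commute: "compatible_charts c d \<longleftrightarrow> compatible_charts d c"
  by (auto simp: compatible_charts_def Int_commute)

lemma transition_deriv_inverse:
  assumes "is_chart c" "is_chart d" "compatible_charts c d" "p \<in> fst c" "p \<in> fst d"
  shows "transition_deriv d c p (transition_deriv c d p u) = u"
  using transition_deriv_compose[OF assms(1,2,3) _ assms(4,5,4), of u] assms
  by (simp add: transition_deriv_self compatible_charts_commute)

lemma chart_at:
  assumes "p \<in> points M"
  shows "chart_at M p \<in> M" "p \<in> fst (chart_at M p)"
proof -
  have "\<exists>c. c \<in> M \<and> p \<in> fst c"
    using assms by (auto simp: points_def simp del: split_paired_Ex)
  from someI_ex[OF this] show "chart_at M p \<in> M" "p \<in> fst (chart_at M p)"
    by (simp_all add: chart_at_def)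
qed

lemma points_of_chart: "c \<in> M \<Longrightarrow> p \<in> fst c \<Longrightarrow> p \<in> points M"
  by (auto simp: points_def)

lemma smooth_manifoldD:
  assumes "smooth_manifold M"
  shows "c \<in> M \<Longrightarrow> is_chart c" "c \<in> M \<Longrightarrow> d \<in> M \<Longrightarrow> compatible_charts c d"
    "c \<in> M \<Longrightarrow> open (chart_range c)"
  using assms by (auto simp: smooth_manifold_def is_chart_def)

lemma from_coords:
  assumes "smooth_manifold M" "c \<in> M" "p \<in> fst c"
  shows "linear (from_coords M c p)" "linear (to_coords M c p)"
    "from_coords M c p (to_coords M c p u) = u" "to_coords M c p (from_coords M c p u) = u"
proof -
  note c0 = chart_at[OF points_of_chart[OF assms(2,3)]]
  note facts = smooth_manifoldD[OF assms(1)] assms c0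
  show "linear (from_coords M c p)" "linear (to_coords M c p)"
    unfolding from_coords_eq to_coords_eq by (intro linear_transition_deriv facts)+
  show "from_coords M c p (to_coords M c p u) = u" "to_coords M c p (from_coords M c p u) = u"
    unfolding from_coords_eq to_coords_eq by (intro transition_deriv_inverse facts)+
qed

lemma local_form_eq:
  "local_form M c \<tau> x = (\<lambda>u v. \<tau> (chart_inv c x) (from_coords M c (chart_inv c x) u)
     (from_coords M c (chart_inv c x) v))"
  by (simp add: local_form_def Let_def fun_eq_iff)

text \<open>Deformed metrics and dualizing forms are definite descriptions whose value is known only
  at points of the manifold. This and the following congruence lemmas replace them by explicit
  formulas there.\<close>

lemma local_form_cong:
  assumes "c \<in> M" "x \<in> chart_range c" "\<And>p. p \<in> points M \<Longrightarrow> \<tau> p = \<sigma> p"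
  shows "local_form M c \<tau> x = local_form M c \<sigma> x"
  using assms(3)[OF points_of_chart[OF assms(1) chart_inv_mem(1)[OF assms(2)]]]
  by (simp add: local_form_eq)

lemma partial_form_cong:
  assumes "smooth_manifold M" "c \<in> M" "x \<in> chart_range c" "\<And>p. p \<in> points M \<Longrightarrow> \<tau> p = \<sigma> p"
  shows "partial_form M c \<tau> x = partial_form M c \<sigma> x"
proof -
  have "frechet_derivative (\<lambda>y. local_form M c \<tau> y v w) (at x) =
      frechet_derivative (\<lambda>y. local_form M c \<sigma> y v w) (at x)" for v w
    by (rule frechet_derivative_cong_open[of "chart_range c"])
      (use assms smooth_manifoldD(3)[OF assms(1,2)] local_form_cong[of c M _ \<tau> \<sigma>] in auto)
  then show ?thesis
    by (simp add: partial_form_def fun_eq_iff)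
qed

lemma smooth_on_cong:
  assumes "smooth_on S f" "\<And>x. x \<in> S \<Longrightarrow> f x = g x"
  shows "smooth_on S g"
  unfolding smooth_on_def
proof (intro conjI allI)
  show "open S"
    using assms(1) by (rule smooth_onD)
  show "Ck_on k S g" for k
    by (rule Ck_on_cong[OF smooth_onD(1)[OF assms(1)] assms(2) smooth_onD(2)[OF assms(1)]])
qed

lemma smooth_bifield_cong:
  assumes M: "smooth_manifold M" and eq: "\<And>p. p \<in> points M \<Longrightarrow> \<tau> p = \<sigma> p"
    and sm: "smooth_bifield M \<tau>"
  shows "smooth_bifield M \<sigma>"
  unfolding smooth_bifield_def
proof (intro conjI ballI allI)
  show "bilinear (\<sigma> p)" if "p \<in> points M" for p
    using that sm eq[OF that] by (auto simp: smooth_bifield_def)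
  show "smooth_on (chart_range c) (\<lambda>x. local_form M c \<sigma> x u v)" if "c \<in> M" for c u v
  proof -
    have "smooth_on (chart_range c) (\<lambda>x. local_form M c \<tau> x u v)"
      using sm that by (simp add: smooth_bifield_def)
    then show ?thesis
      by (rule smooth_on_cong) (simp add: local_form_cong[OF that _ eq])
  qed
qed

lemma closed_two_form_cong:
  assumes M: "smooth_manifold M" and eq: "\<And>p. p \<in> points M \<Longrightarrow> \<tau> p = \<sigma> p"
    and cl: "closed_two_form M \<tau>"
  shows "closed_two_form M \<sigma>"
  unfolding closed_two_form_def two_form_def exterior_deriv_def
proof (intro conjI ballI allI)
  show "smooth_bifield M \<sigma>"
    using cl by (intro smooth_bifield_cong[OF M eq]) (auto simp: closed_two_form_def two_form_def)
  show "\<sigma> p u u = 0" if "p \<in> points M" for p u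
    using cl that eq[OF that, symmetric] by (simp add: closed_two_form_def two_form_def)
  show "partial_form M c \<sigma> x u v w - partial_form M c \<sigma> x v u w + partial_form M c \<sigma> x w u v = 0"
    if "c \<in> M" "x \<in> chart_range c" for c x u v w
  proof -
    have "partial_form M c \<sigma> x = partial_form M c \<tau> x"
      by (rule partial_form_cong[OF M that]) (rule eq[symmetric])
    then show ?thesis
      using cl that by (simp add: closed_two_form_def exterior_deriv_def)
  qed
qed

section \<open>Deformed metrics and the dualizing form\<close>

lemma sharp_works:
  fixes h :: "'e::euclidean_space \<Rightarrow> 'e \<Rightarrow> real"
  assumes "inner_form h" "linear (\<alpha> v)"
  shows "h (sharp h \<alpha> v) w = \<alpha> v w"
  unfolding sharp_def using theI'[OF inner_form_riesz[OF assms]] by blast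

lemma linear_vec_expansion:
  fixes f :: "real^'m::finite \<Rightarrow> real"
  assumes "linear f"
  shows "f y = (\<Sum>i\<in>UNIV. y $ i * f (axis i 1))"
proof -
  have "f y = f (\<Sum>i\<in>UNIV. y $ i *s axis i 1)"
    by (simp add: basis_expansion)
  also have "\<dots> = (\<Sum>i\<in>UNIV. y $ i * f (axis i 1))"
    by (simp add: linear_sum[OF assms] scalar_mult_eq_scaleR linear_scale[OF assms])
  finally show ?thesis .
qed

text \<open>The defining property of \<open>sharp\<close> is a linear system with the Gram matrix as
  coefficients. Its solution by determinants shows the components to be as regular as the metric and
  the form.\<close>

lemma sharp_cramer:
  fixes h :: "real^'m::finite \<Rightarrow> real^'m \<Rightarrow> real"
  assumes h: "inner_form h" and \<alpha>: "linear (\<alpha> v)"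
  defines "G \<equiv> (\<chi> i j. h (axis j 1) (axis i 1)) :: real^'m^'m"
  shows "det G \<noteq> 0"
    and "sharp h \<alpha> v $ k = det ((\<chi> i j. if j = k then \<alpha> v (axis i 1) else h (axis j 1) (axis i 1)) :: real^'m^'m) / det G"
proof -
  have mult: "(G *v z) $ i = h z (axis i 1)" for z i
    using linear_vec_expansion[OF inner_formD(2)[OF h], of z "axis i 1"]
    by (simp add: G_def matrix_vector_mult_def mult.commute)
  have "z = 0" if "G *v z = 0" for z
  proof (rule ccontr)
    assume "z \<noteq> 0"
    have "h z w = 0" for w
      using linear_vec_expansion[OF inner_formD(1)[OF h], of z w] mult[of z] that by simp
    then show False
      using inner_formD(4)[OF h \<open>z \<noteq> 0\<close>] by simp
  qed
  then have "invertible G"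
    using matrix_left_invertible_ker[of G] invertible_left_inverse by blast
  then show det: "det G \<noteq> 0"
    by (simp add: invertible_det_nz)
  have "G *v sharp h \<alpha> v = (\<chi> i. \<alpha> v (axis i 1))"
    by (simp add: vec_eq_iff mult sharp_works[of h \<alpha> v, OF h \<alpha>])
  then have "sharp h \<alpha> v = (\<chi> k. det (\<chi> i j. if j = k then (\<chi> i. \<alpha> v (axis i 1)) $ i else G $ i $ j) / det G)"
    using cramer[OF det] by blast
  then show "sharp h \<alpha> v $ k = det ((\<chi> i j. if j = k then \<alpha> v (axis i 1) else h (axis j 1) (axis i 1)) :: real^'m^'m) / det G"
    by (simp add: G_def cong: if_cong)
qed

lemma Ck_on_sharp:
  fixes G \<Omega> :: "'a::real_normed_vector \<Rightarrow> real^'m::finite \<Rightarrow> real^'m \<Rightarrow> real"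
  assumes S: "open S"
    and G: "\<And>x. x \<in> S \<Longrightarrow> inner_form (G x)" "\<And>u v. Ck_on k S (\<lambda>x. G x u v)"
    and \<Omega>: "\<And>x u. x \<in> S \<Longrightarrow> linear (\<Omega> x u)" "\<And>u v. Ck_on k S (\<lambda>x. \<Omega> x u v)"
  shows "Ck_on k S (\<lambda>x. sharp (G x) (\<Omega> x) v $ i)"
proof -
  have "Ck_on k S (\<lambda>x. det ((\<chi> a b. if b = i then \<Omega> x v (axis a 1) else G x (axis b 1) (axis a 1)) :: real^'m^'m) *
      inverse (det ((\<chi> a b. G x (axis b 1) (axis a 1)) :: real^'m^'m)))"
  proof (intro Ck_on_mult Ck_on_inverse Ck_on_det S)
    show "Ck_on k S (\<lambda>x. if b = i then \<Omega> x v (axis a 1) else G x (axis b 1) (axis a 1))" for a b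
      using G(2) \<Omega>(2) by (cases "b = i") simp_all
    show "Ck_on k S (\<lambda>x. G x (axis b 1) (axis a 1))" for a b
      by (rule G(2))
    show "det ((\<chi> a b. G x (axis b 1) (axis a 1)) :: real^'m^'m) \<noteq> 0" if "x \<in> S" for x
      by (rule sharp_cramer(1)[of "G x" "\<Omega> x" v, OF G(1)[OF that] \<Omega>(1)[OF that]])
  qed
  then show ?thesis
    by (rule Ck_on_cong[OF S, rotated])
      (simp add: sharp_cramer(2)[of "G _" "\<Omega> _" v, OF G(1) \<Omega>(1)] divide_inverse)
qed

lemma Ck_on_deform_inner:
  fixes G \<Omega> :: "'a::real_normed_vector \<Rightarrow> real^'m::finite \<Rightarrow> real^'m \<Rightarrow> real"
  assumes S: "open S"
    and G: "\<And>x. x \<in> S \<Longrightarrow> inner_form (G x)" "\<And>u v. Ck_on k S (\<lambda>x. G x u v)"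
    and \<Omega>: "\<And>x u. x \<in> S \<Longrightarrow> linear (\<Omega> x u)" "\<And>u v. Ck_on k S (\<lambda>x. \<Omega> x u v)"
  shows "Ck_on k S (\<lambda>x. deform_inner t (G x) (\<Omega> x) u v)"
proof -
  \<comment> \<open>One of the two occurrences of \<open>sharp\<close> is absorbed by its defining
    property, and the form is then expanded linearly in the components of the other.\<close>
  have "Ck_on k S (\<lambda>x. (1 / t) * G x u v +
      (t - 1 / t) * (\<Sum>i\<in>UNIV. sharp (G x) (\<Omega> x) v $ i * \<Omega> x u (axis i 1)))"
    by (intro Ck_on_add Ck_on_mult Ck_on_sum Ck_on_const Ck_on_sharp assms)
  then show ?thesis
  proof (rule Ck_on_cong[OF S, rotated])
    fix x assume x: "x \<in> S"
    have "sharp_form (G x) (\<Omega> x) u v = \<Omega> x u (sharp (G x) (\<Omega> x) v)"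
      unfolding sharp_form_def by (rule sharp_works[of "G x" "\<Omega> x" u, OF G(1)[OF x] \<Omega>(1)[OF x]])
    also have "\<dots> = (\<Sum>i\<in>UNIV. sharp (G x) (\<Omega> x) v $ i * \<Omega> x u (axis i 1))"
      by (rule linear_vec_expansion[OF \<Omega>(1)[OF x]])
    finally show "(1 / t) * G x u v +
        (t - 1 / t) * (\<Sum>i\<in>UNIV. sharp (G x) (\<Omega> x) v $ i * \<Omega> x u (axis i 1)) = deform_inner t (G x) (\<Omega> x) u v"
      by (simp add: deform_inner_def)
  qed
qed

section \<open>Tensor fields in charts and their rescaling\<close>

lemma smooth_bifieldD:
  assumes "smooth_bifield M \<tau>"
  shows "p \<in> points M \<Longrightarrow> bilinear (\<tau> p)"
    "c \<in> M \<Longrightarrow> smooth_on (chart_range c) (\<lambda>x. local_form M c \<tau> x u v)"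
  using assms by (auto simp: smooth_bifield_def)

lemma bilinear_local_form:
  assumes "smooth_manifold M" "smooth_bifield M \<tau>" "c \<in> M" "x \<in> chart_range c"
  shows "bilinear (local_form M c \<tau> x)"
proof -
  note q = chart_inv_mem(1)[OF assms(4)]
  have F: "linear (from_coords M c (chart_inv c x))"
    by (rule from_coords(1)[OF assms(1,3) q])
  have b: "bilinear (\<tau> (chart_inv c x))"
    by (rule smooth_bifieldD(1)[OF assms(2) points_of_chart[OF assms(3) q]])
  have "linear (\<lambda>v. \<tau> (chart_inv c x) a (from_coords M c (chart_inv c x) v))"
    "linear (\<lambda>v. \<tau> (chart_inv c x) (from_coords M c (chart_inv c x) v) a)" for a
    using linear_compose[OF F, of "\<tau> (chart_inv c x) a"] linear_compose[OF F, of "\<lambda>v. \<tau> (chart_inv c x) v a"] b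
    by (simp_all add: bilinear_def o_def)
  then show ?thesis
    by (simp add: local_form_eq bilinear_def)
qed

lemma local_form_scale: "local_form M c (scale_form t \<tau>) x u v = t * local_form M c \<tau> x u v"
  by (simp add: local_form_eq scale_form_def)

lemma partial_form_has_derivative:
  assumes "smooth_bifield M \<tau>" "c \<in> M" "x \<in> chart_range c"
  shows "((\<lambda>y. local_form M c \<tau> y v w) has_derivative (\<lambda>u. partial_form M c \<tau> x u v w)) (at x)"
  unfolding partial_form_def
  using smooth_onD(4)[OF smooth_bifieldD(2)[OF assms(1,2)] assms(3)] by simp

lemma partial_form_scale:
  assumes "smooth_bifield M \<tau>" "c \<in> M" "x \<in> chart_range c"
  shows "partial_form M c (scale_form t \<tau>) x u v w = t * partial_form M c \<tau> x u v w"
  using frechet_derivative_eq[OF has_derivative_mult_right[OF partial_form_has_derivative[OF assms]], of t v w]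
  unfolding partial_form_def[of M c "scale_form t \<tau>"] local_form_scale by simp

lemma smooth_on_cmult:
  fixes f :: "'a::real_normed_vector \<Rightarrow> 'b::real_normed_algebra"
  assumes "smooth_on S f"
  shows "smooth_on S (\<lambda>x. r * f x)"
  using assms by (auto simp: smooth_on_def intro: Ck_on_mult Ck_on_const)

lemma smooth_bifield_scale:
  assumes "smooth_bifield M \<tau>"
  shows "smooth_bifield M (scale_form t \<tau>)"
  unfolding smooth_bifield_def
proof (intro conjI ballI allI)
  show "bilinear (scale_form t \<tau> p)" if "p \<in> points M" for p
    using smooth_bifieldD(1)[OF assms that]
    by (simp add: scale_form_def bilinear_def linear_iff algebra_simps)
  show "smooth_on (chart_range c) (\<lambda>x. local_form M c (scale_form t \<tau>) x u v)" if "c \<in> M" for c u v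
    unfolding local_form_scale by (intro smooth_on_cmult smooth_bifieldD(2)[OF assms that])
qed

lemma closed_two_form_scale:
  assumes "closed_two_form M \<omega>"
  shows "closed_two_form M (scale_form t \<omega>)"
proof -
  have s: "smooth_bifield M \<omega>"
    using assms by (simp add: closed_two_form_def two_form_def)
  have "exterior_deriv M c (scale_form t \<omega>) x u v w = t * exterior_deriv M c \<omega> x u v w"
    if "c \<in> M" "x \<in> chart_range c" for c x u v w
    unfolding exterior_deriv_def partial_form_scale[OF s that] by (simp add: algebra_simps)
  moreover have "scale_form t \<omega> p u u = 0" if "p \<in> points M" for p u
    using assms that by (simp add: scale_form_def closed_two_form_def two_form_def)
  ultimately show ?thesis
    using assms smooth_bifield_scale[OF s] by (simp add: closed_two_form_def two_form_def)
qed

lemma form_kernel_scale: "t \<noteq> 0 \<Longrightarrow> form_kernel (scale_form t \<tau> p) = form_kernel (\<tau> p)"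
  by (simp add: form_kernel_def scale_form_def)

lemma kernel_sum_cong:
  assumes "\<And>j p. form_kernel (\<omega> j p) = form_kernel (\<omega>' j p)"
  shows "kernel_sum s \<omega> = kernel_sum s \<omega>'"
  by (simp add: kernel_sum_def fun_eq_iff assms)

lemma almost_kaehlerI:
  fixes M :: "('a, 'e::euclidean_space) atlas"
  assumes "smooth_manifold M" "DIM('e) = n * 3" "closed_two_form M (\<omega> 1)" "closed_two_form M (\<omega> 2)"
    "integrable_distribution M (kernel_sum 2 \<omega>)" "riemannian_metric M g"
    and ks: "\<And>x. x \<in> points M \<Longrightarrow> \<exists>v p q. kaehler_space n (g x) (\<omega> 1 x) (\<omega> 2 x) v p q"
  shows "almost_kaehler n 2 (M, \<omega>, g)"
proof -
  have "\<exists>v w. orthonormal_standard_basis n 2 (\<lambda>j. \<omega> j x) (g x) v w" if x: "x \<in> points M" for x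
  proof -
    obtain v p q where "kaehler_space n (g x) (\<omega> 1 x) (\<omega> 2 x) v p q"
      using ks[OF x] by blast
    then have "orthonormal_standard_basis n 2 (\<lambda>j. \<omega> j x) (g x) v (\<lambda>j. if j = 1 then p else q)"
      by (intro kaehler_space_orthonormal_standard_basis) simp
    then show ?thesis by blast
  qed
  moreover have "j \<in> {1..2} \<Longrightarrow> j = 1 \<or> j = 2" for j :: nat
    by auto
  ultimately show ?thesis
    using assms unfolding almost_kaehler_def polysymplectic_manifold_def orthonormal_standard_basis_def
    by (auto simp del: atLeastAtMost_iff) metis+
qed

section \<open>The deformations and the dualizing form on the manifold\<close>

locale almost_2_kaehler =
  fixes n :: nat and M :: "('a, real^'m::finite) atlas"
    and \<omega> :: "nat \<Rightarrow> ('a, real^'m) bifield" and g :: "('a, real^'m) bifield"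
  assumes almost_kaehler: "almost_kaehler n 2 (M, \<omega>, g)"
begin

lemma manifold: "smooth_manifold M"
  and dim: "DIM(real^'m) = n * 3"
  and integrable: "integrable_distribution M (kernel_sum 2 \<omega>)"
  and metric: "riemannian_metric M g"
  using almost_kaehler by (auto simp: almost_kaehler_def polysymplectic_manifold_def)

lemma smooth_metric: "smooth_bifield M g"
  and inner_metric: "p \<in> points M \<Longrightarrow> inner_form (g p)"
  using metric by (auto simp: riemannian_metric_def)

lemma closed: "j \<in> {1, 2} \<Longrightarrow> closed_two_form M (\<omega> j)"
  using almost_kaehler by (auto simp: almost_kaehler_def polysymplectic_manifold_def)

lemma smooth_form: "j \<in> {1, 2} \<Longrightarrow> smooth_bifield M (\<omega> j)"
  using closed by (auto simp: closed_two_form_def two_form_def)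

text \<open>The ordered pair tells which form is deformed: (1, 2) corresponds to
  \<open>alpha_deform\<close>, (2, 1) to \<open>beta_deform\<close>, so that both are treated by one
  argument.\<close>

lemma kaehler_space_at:
  assumes "x \<in> points M" "(j, k) \<in> {(1, 2), (2, 1)}"
  shows "\<exists>v p q. kaehler_space n (g x) (\<omega> j x) (\<omega> k x) v p q"
proof -
  obtain v w where "orthonormal_standard_basis n 2 (\<lambda>j. \<omega> j x) (g x) v w"
    using almost_kaehler assms(1) by (auto simp: almost_kaehler_def)
  then have "kaehler_space n (g x) (\<omega> 1 x) (\<omega> 2 x) v (w 1) (w 2)"
    using orthonormal_standard_basis_iff[OF inner_metric[OF assms(1)], of n "\<lambda>j. \<omega> j x"] by simp
  then show ?thesis
    using assms(2) kaehler_space.swap by blast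
qed

lemma kaehler_space_local:
  assumes "c \<in> M" "x \<in> chart_range c" "(j, k) \<in> {(1, 2), (2, 1)}"
  shows "\<exists>v p q. kaehler_space n (local_form M c g x) (local_form M c (\<omega> j) x) (local_form M c (\<omega> k) x) v p q"
proof -
  note q = chart_inv_mem(1)[OF assms(2)]
  obtain v p q where "kaehler_space n (g (chart_inv c x)) (\<omega> j (chart_inv c x)) (\<omega> k (chart_inv c x)) v p q"
    using kaehler_space_at[OF points_of_chart[OF assms(1) q] assms(3)] by blast
  from kaehler_space.pullback[OF this from_coords[OF manifold assms(1) q]] show ?thesis
    unfolding local_form_eq by blast
qed

lemma inner_local: "c \<in> M \<Longrightarrow> x \<in> chart_range c \<Longrightarrow> inner_form (local_form M c g x)"
  using kaehler_space_local[of c x 1 2] by (auto simp: kaehler_space_def)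

lemma local_form_deform:
  assumes "c \<in> M" "x \<in> chart_range c" "j \<in> {1, 2}"
  shows "local_form M c (\<lambda>p. deform_inner t (g p) (\<omega> j p)) x =
    deform_inner t (local_form M c g x) (local_form M c (\<omega> j) x)"
proof -
  note q = chart_inv_mem(1)[OF assms(2)]
  \<comment> \<open>\<open>3 - j\<close> is the index of the other form.\<close>
  obtain v p q where "kaehler_space n (g (chart_inv c x)) (\<omega> j (chart_inv c x)) (\<omega> (3 - j) (chart_inv c x)) v p q"
    using kaehler_space_at[OF points_of_chart[OF assms(1) q], of j "3 - j"] assms(3) by auto
  from kaehler_space.deform_inner_pullback[OF this from_coords[OF manifold assms(1) q]] show ?thesis
    unfolding local_form_eq by (simp add: fun_eq_iff)
qed

text \<open>The description imposes its conditions on all orthonormal standard bases. The frame-free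
  candidate meets them for each basis, and a single basis already determines a bilinear form with
  the prescribed values, whence uniqueness.\<close>

lemma deformed_metric_eq:
  assumes "x \<in> points M" and jk: "(j, k) \<in> {(1, 2), (2, 1)}" and t: "t > 0"
  shows "deformed_metric n j k t \<omega> g x = deform_inner t (g x) (\<omega> j x)"
  unfolding deformed_metric_def
proof (rule the_equality)
  let ?h = "deform_inner t (g x) (\<omega> j x)"
  note basis_iff = orthonormal_standard_basis_iff[OF inner_metric[OF assms(1)], of n "\<lambda>j. \<omega> j x"]
  have ks: "kaehler_space n (g x) (\<omega> j x) (\<omega> k x) v (w j) (w k)"
    if "orthonormal_standard_basis n 2 (\<lambda>l. \<omega> l x) (g x) v w" for v w
  proof -
    have K: "kaehler_space n (g x) (\<omega> 1 x) (\<omega> 2 x) v (w 1) (w 2)"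
      using that basis_iff by simp
    from K kaehler_space.swap[OF K] show ?thesis
      using jk by auto
  qed
  have basis_set: "basis_set n 2 v w = v ` {1..n} \<union> w j ` {1..n} \<union> w k ` {1..n}"
    for v and w :: "nat \<Rightarrow> nat \<Rightarrow> real^'m"
  proof -
    have *: "{1..2} = {j, k}"
      using jk by auto
    show ?thesis
      unfolding basis_set_def * by blast
  qed
  have inner_h: "inner_form ?h"
    using kaehler_space_at[OF assms(1) jk] kaehler_space.inner_form_deform[OF _ t] by blast
  have ortho_h: "?h a b = 0"
    if on: "orthonormal_standard_basis n 2 (\<lambda>l. \<omega> l x) (g x) v w"
      and ab: "a \<in> basis_set n 2 v w" "b \<in> basis_set n 2 v w" "a \<noteq> b" for v w a b
  proof -
    interpret kaehler_space n "g x" "\<omega> j x" "\<omega> k x" v "w j" "w k"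
      by (rule ks[OF on])
    have "g x a b = 0"
      using on ab unfolding orthonormal_standard_basis_def by simp
    then show ?thesis
      using ab(2) t unfolding basis_set by (auto simp: deform_inner_frame)
  qed
  have diag: "?h (v i) (v i) = t \<and> ?h (w j i) (w j i) = t \<and> ?h (w k i) (w k i) = 1 / t"
    if on: "orthonormal_standard_basis n 2 (\<lambda>l. \<omega> l x) (g x) v w" and i: "i \<in> {1..n}" for v w i
  proof -
    interpret kaehler_space n "g x" "\<omega> j x" "\<omega> k x" v "w j" "w k"
      by (rule ks[OF on])
    show ?thesis
      using i t by (simp add: deform_inner_frame ortho)
  qed
  show "inner_form ?h \<and> (\<forall>v w. orthonormal_standard_basis n 2 (\<lambda>l. \<omega> l x) (g x) v w \<longrightarrow>
      (\<forall>a\<in>basis_set n 2 v w. \<forall>b\<in>basis_set n 2 v w. a \<noteq> b \<longrightarrow> ?h a b = 0) \<and>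
      (\<forall>i\<in>{1..n}. ?h (v i) (v i) = t \<and> ?h (w j i) (w j i) = t \<and> ?h (w k i) (w k i) = 1 / t))"
    using inner_h ortho_h diag by blast
  fix h assume h: "inner_form h \<and> (\<forall>v w. orthonormal_standard_basis n 2 (\<lambda>l. \<omega> l x) (g x) v w \<longrightarrow>
      (\<forall>a\<in>basis_set n 2 v w. \<forall>b\<in>basis_set n 2 v w. a \<noteq> b \<longrightarrow> h a b = 0) \<and>
      (\<forall>i\<in>{1..n}. h (v i) (v i) = t \<and> h (w j i) (w j i) = t \<and> h (w k i) (w k i) = 1 / t))"
  obtain v w where on: "orthonormal_standard_basis n 2 (\<lambda>j. \<omega> j x) (g x) v w"
    using almost_kaehler assms(1) by (auto simp: almost_kaehler_def)
  interpret kaehler_space n "g x" "\<omega> j x" "\<omega> k x" v "w j" "w k"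
    by (rule ks[OF on])
  have "h a b = ?h a b" for a b
  proof (rule bilinear_ext[of h ?h])
    fix a b
    show "linear (h a)" "linear (\<lambda>a. h a b)" "linear (?h a)" "linear (\<lambda>a. ?h a b)"
      using h inner_h by (simp_all add: inner_formD(1,2))
  next
    fix a b assume ab: "a \<in> v ` {1..n} \<union> w j ` {1..n} \<union> w k ` {1..n}"
      "b \<in> v ` {1..n} \<union> w j ` {1..n} \<union> w k ` {1..n}"
    show "h a b = ?h a b"
    proof (cases "a = b")
      case True
      then show ?thesis
        using diag[OF on] h[THEN conjunct2, rule_format, OF on, THEN conjunct2] ab(1) by auto
    next
      case False
      then show ?thesis
        using ortho_h[OF on] h[THEN conjunct2, rule_format, OF on, THEN conjunct1] ab
        unfolding basis_set by auto
    qed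
  qed
  then show "h = ?h"
    by blast
qed

text \<open>The expression on the right involves no basis, so every orthonormal standard basis
  yields the same form; existence of one such basis makes it unique.\<close>

lemma dualizing_form_eq:
  assumes "x \<in> points M"
  shows "dualizing_form n (M, \<omega>, g) x = dual_inner (g x) (\<omega> 1 x) (\<omega> 2 x)"
  unfolding dualizing_form_def prod.case
proof (rule the_equality)
  note h = inner_metric[OF assms]
  have eq: "(\<lambda>a b. \<Sum>i=1..n. wedge (dual_vector (basis_set n 2 v w) (w 1 i))
      (dual_vector (basis_set n 2 v w) (w 2 i)) a b) = dual_inner (g x) (\<omega> 1 x) (\<omega> 2 x)"
    if on: "orthonormal_standard_basis n 2 (\<lambda>j. \<omega> j x) (g x) v w" for v w
  proof -
    interpret kaehler_space n "g x" "\<omega> 1 x" "\<omega> 2 x" v "w 1" "w 2"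
      using on orthonormal_standard_basis_iff[OF h, of n "\<lambda>j. \<omega> j x"] by simp
    have "w j i \<in> basis_set n 2 v w" if "i \<in> {1..n}" "j \<in> {1..2}" for i j
      using that unfolding basis_set_def by blast
    then have "dual_vector (basis_set n 2 v w) (w j i) = (\<lambda>a. g x a (w j i))"
      if "i \<in> {1..n}" "j \<in> {1..2}" for i j
      using that orthonormal_standard_basisD(2)[OF h on] by blast
    then show ?thesis
      unfolding dual_inner_eq by (intro ext sum.cong) auto
  qed
  then show "\<forall>v w. orthonormal_standard_basis n 2 (\<lambda>j. \<omega> j x) (g x) v w \<longrightarrow>
      dual_inner (g x) (\<omega> 1 x) (\<omega> 2 x) =
        (\<lambda>a b. \<Sum>i=1..n. wedge (dual_vector (basis_set n 2 v w) (w 1 i))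
          (dual_vector (basis_set n 2 v w) (w 2 i)) a b)"
    by (intro allI impI) (rule eq[symmetric])
  fix \<delta> assume \<delta>: "\<forall>v w. orthonormal_standard_basis n 2 (\<lambda>j. \<omega> j x) (g x) v w \<longrightarrow>
      \<delta> = (\<lambda>a b. \<Sum>i=1..n. wedge (dual_vector (basis_set n 2 v w) (w 1 i))
          (dual_vector (basis_set n 2 v w) (w 2 i)) a b)"
  obtain v w where on: "orthonormal_standard_basis n 2 (\<lambda>j. \<omega> j x) (g x) v w"
    using almost_kaehler assms by (auto simp: almost_kaehler_def)
  show "\<delta> = dual_inner (g x) (\<omega> 1 x) (\<omega> 2 x)"
    using \<delta>[rule_format, OF on] unfolding eq[OF on] .
qed

lemma riemannian_deformed_metric:
  assumes jk: "(j, k) \<in> {(1, 2), (2, 1)}" and t: "t > 0"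
  shows "riemannian_metric M (deformed_metric n j k t \<omega> g)"
proof -
  let ?h = "\<lambda>p. deform_inner t (g p) (\<omega> j p)"
  have j: "j \<in> {1, 2}"
    using jk by auto
  have inner: "inner_form (?h p)" if "p \<in> points M" for p
    using kaehler_space_at[OF that jk] kaehler_space.inner_form_deform[OF _ t] by blast
  have "smooth_bifield M ?h"
    unfolding smooth_bifield_def
  proof (intro conjI ballI allI)
    show "bilinear (?h p)" if "p \<in> points M" for p
      using inner_formD(1,2)[OF inner[OF that]] by (simp add: bilinear_def)
    show "smooth_on (chart_range c) (\<lambda>x. local_form M c ?h x u v)" if c: "c \<in> M" for c u v
    proof (rule smooth_on_cong)
      note S = smooth_manifoldD(3)[OF manifold c]
      show "smooth_on (chart_range c)
          (\<lambda>x. deform_inner t (local_form M c g x) (local_form M c (\<omega> j) x) u v)"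
        unfolding smooth_on_def
      proof (intro conjI allI S Ck_on_deform_inner)
        show "inner_form (local_form M c g x)" if "x \<in> chart_range c" for x
          by (rule inner_local[OF c that])
        show "linear (local_form M c (\<omega> j) x a)" if "x \<in> chart_range c" for x a
          using bilinear_local_form[OF manifold smooth_form[OF j] c that] by (simp add: bilinear_def)
      qed (use smooth_onD(2)[OF smooth_bifieldD(2)[OF smooth_metric c]]
          smooth_onD(2)[OF smooth_bifieldD(2)[OF smooth_form[OF j] c]] in blast)+
    qed (simp add: local_form_deform[OF c _ j])
  qed
  then have "riemannian_metric M ?h"
    using inner by (simp add: riemannian_metric_def)
  then show ?thesis
    using smooth_bifield_cong[OF manifold, of ?h "deformed_metric n j k t \<omega> g"]
      deformed_metric_eq[OF _ jk t] by (simp add: riemannian_metric_def)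
qed

lemma kernel_sum_scale_one:
  "t \<noteq> 0 \<Longrightarrow> kernel_sum s (fun_upd \<omega> j (scale_form t (\<omega> j))) = kernel_sum s \<omega>"
  by (rule kernel_sum_cong) (simp add: form_kernel_scale)

lemma almost_kaehler_alpha:
  assumes t: "t > 0"
  shows "almost_kaehler n 2 (alpha_deform n t (M, \<omega>, g))"
  unfolding alpha_deform_def prod.case
proof (rule almost_kaehlerI[OF manifold dim])
  show "integrable_distribution M (kernel_sum 2 (fun_upd \<omega> 1 (scale_form t (\<omega> 1))))"
    using t integrable by (simp add: kernel_sum_scale_one)
  show "riemannian_metric M (deformed_metric n 1 2 t \<omega> g)"
    by (rule riemannian_deformed_metric) (simp_all add: t)
  show "\<exists>v p q. kaehler_space n (deformed_metric n 1 2 t \<omega> g x) ((fun_upd \<omega> 1 (scale_form t (\<omega> 1))) 1 x)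
      ((fun_upd \<omega> 1 (scale_form t (\<omega> 1))) 2 x) v p q" if x: "x \<in> points M" for x
    using kaehler_space_at[OF x, of 1 2] kaehler_space.deform_kaehler_space[OF _ t]
    by (auto simp: deformed_metric_eq[OF x _ t] scale_form_def) blast
qed (simp_all add: closed closed_two_form_scale)

lemma almost_kaehler_beta:
  assumes t: "t > 0"
  shows "almost_kaehler n 2 (beta_deform n t (M, \<omega>, g))"
  unfolding beta_deform_def prod.case
proof (rule almost_kaehlerI[OF manifold dim])
  show "integrable_distribution M (kernel_sum 2 (fun_upd \<omega> 2 (scale_form t (\<omega> 2))))"
    using t integrable by (simp add: kernel_sum_scale_one)
  show "riemannian_metric M (deformed_metric n 2 1 t \<omega> g)"
    by (rule riemannian_deformed_metric) (simp_all add: t)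
  show "\<exists>v p q. kaehler_space n (deformed_metric n 2 1 t \<omega> g x) ((fun_upd \<omega> 2 (scale_form t (\<omega> 2))) 1 x)
      ((fun_upd \<omega> 2 (scale_form t (\<omega> 2))) 2 x) v p q" if x: "x \<in> points M" for x
    using kaehler_space_at[OF x, of 2 1] kaehler_space.swap[OF kaehler_space.deform_kaehler_space[OF _ t]]
    by (auto simp: deformed_metric_eq[OF x _ t] scale_form_def) blast
qed (simp_all add: closed closed_two_form_scale)

lemma almost_kaehler_lambda:
  assumes t: "t > 0"
  shows "almost_kaehler n 2 (lambda_deform t (M, \<omega>, g))"
  unfolding lambda_deform_def prod.case
proof (rule almost_kaehlerI[OF manifold dim])
  have "kernel_sum 2 (\<lambda>j. scale_form t (\<omega> j)) = kernel_sum 2 \<omega>"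
    using t by (intro kernel_sum_cong) (simp add: form_kernel_scale)
  then show "integrable_distribution M (kernel_sum 2 (\<lambda>j. scale_form t (\<omega> j)))"
    using integrable by simp
  have ks: "\<exists>v p q. kaehler_space n (scale_form t g x) (scale_form t (\<omega> 1) x)
      (scale_form t (\<omega> 2) x) v p q" if x: "x \<in> points M" for x
    using kaehler_space_at[OF x, of 1 2] kaehler_space.scale_kaehler_space[OF _ t]
    by (auto simp: scale_form_def) blast
  then show "\<exists>v p q. kaehler_space n (scale_form t g x) (scale_form t (\<omega> 1) x)
      (scale_form t (\<omega> 2) x) v p q" if x: "x \<in> points M" for x
    using x .
  show "riemannian_metric M (scale_form t g)"
    unfolding riemannian_metric_def
    using smooth_bifield_scale[OF smooth_metric] ks kaehler_space.inner by blast
qed (simp_all add: closed closed_two_form_scale)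

lemma dualizing_form_alpha:
  assumes "x \<in> points M" and t: "t > 0"
  shows "dualizing_form n (alpha_deform n t (M, \<omega>, g)) x = dualizing_form n (M, \<omega>, g) x"
proof -
  obtain v p q where ks: "kaehler_space n (g x) (\<omega> 1 x) (\<omega> 2 x) v p q"
    using kaehler_space_at[OF assms(1), of 1 2] by auto
  have "almost_2_kaehler n M (fun_upd \<omega> 1 (scale_form t (\<omega> 1))) (deformed_metric n 1 2 t \<omega> g)"
    using almost_kaehler_alpha[OF t] by (simp add: almost_2_kaehler_def alpha_deform_def)
  from almost_2_kaehler.dualizing_form_eq[OF this assms(1)] show ?thesis
    using kaehler_space.dual_inner_deform[OF ks t]
    by (simp add: alpha_deform_def deformed_metric_eq[OF assms(1) _ t] scale_form_def dualizing_form_eq[OF assms(1)])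
qed

lemma dualizing_form_beta:
  assumes "x \<in> points M" and t: "t > 0"
  shows "dualizing_form n (beta_deform n t (M, \<omega>, g)) x = dualizing_form n (M, \<omega>, g) x"
proof -
  obtain v p q where ks: "kaehler_space n (g x) (\<omega> 2 x) (\<omega> 1 x) v p q"
    using kaehler_space_at[OF assms(1), of 2 1] by auto
  have "almost_2_kaehler n M (fun_upd \<omega> 2 (scale_form t (\<omega> 2))) (deformed_metric n 2 1 t \<omega> g)"
    using almost_kaehler_beta[OF t] by (simp add: almost_2_kaehler_def beta_deform_def)
  from almost_2_kaehler.dualizing_form_eq[OF this assms(1)] show ?thesis
    using kaehler_space.dual_inner_deform[OF ks t]
      kaehler_space.dual_inner_swap[OF kaehler_space.deform_kaehler_space[OF ks t]]
      kaehler_space.dual_inner_swap[OF ks]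
    by (simp add: beta_deform_def deformed_metric_eq[OF assms(1) _ t] scale_form_def fun_eq_iff
        dualizing_form_eq[OF assms(1)])
qed

lemma weakly_self_dual_deform:
  assumes "t > 0" "weakly_self_dual n (M, \<omega>, g)"
  shows "weakly_self_dual n (alpha_deform n t (M, \<omega>, g))" "weakly_self_dual n (beta_deform n t (M, \<omega>, g))"
proof -
  have "fst (alpha_deform n t (M, \<omega>, g)) = M" "fst (beta_deform n t (M, \<omega>, g)) = M"
    by (simp_all add: alpha_deform_def beta_deform_def)
  moreover have "closed_two_form M (dualizing_form n (M, \<omega>, g))"
    using assms(2) by (simp add: weakly_self_dual_def)
  from closed_two_form_cong[OF manifold _ this]
  have "closed_two_form M (dualizing_form n (alpha_deform n t (M, \<omega>, g)))"
    "closed_two_form M (dualizing_form n (beta_deform n t (M, \<omega>, g)))"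
    using dualizing_form_alpha[OF _ assms(1)] dualizing_form_beta[OF _ assms(1)] by metis+
  ultimately show "weakly_self_dual n (alpha_deform n t (M, \<omega>, g))" "weakly_self_dual n (beta_deform n t (M, \<omega>, g))"
    by (simp_all add: weakly_self_dual_def)
qed

end

section \<open>Volume of the leaves\<close>

lemma sum_UNIV_Plus:
  fixes f :: "'n::finite + 'n \<Rightarrow> 'b::comm_monoid_add"
  shows "sum f UNIV = (\<Sum>i\<in>UNIV. f (Inl i)) + (\<Sum>i\<in>UNIV. f (Inr i))"
  using sum.Plus[of "UNIV :: 'n set" "UNIV :: 'n set" f] by (simp add: UNIV_Plus_UNIV o_def)

lemma prod_UNIV_Plus:
  fixes f :: "'n::finite + 'n \<Rightarrow> 'b::comm_monoid_mult"
  shows "prod f UNIV = (\<Prod>i\<in>UNIV. f (Inl i)) * (\<Prod>i\<in>UNIV. f (Inr i))"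
  using prod.Plus[of "UNIV :: 'n set" "UNIV :: 'n set" f] by (simp add: UNIV_Plus_UNIV o_def)

context kaehler_space
begin

text \<open>\<open>v i\<close> is \<open>- A (p i)\<close> and also \<open>- B (q i)\<close>, and
  the image of a skew endomorphism is orthogonal to its kernel. Hence vectors tangent to a leaf lie
  in the span of the \<open>p i\<close> and \<open>q i\<close>.\<close>

lemma form_kernel_orthogonal:
  assumes "i \<in> {1..n}"
  shows "a \<in> form_kernel \<alpha> \<Longrightarrow> h a (v i) = 0" "a \<in> form_kernel \<beta> \<Longrightarrow> h a (v i) = 0"
proof -
  show "h a (v i) = 0" if "a \<in> form_kernel \<alpha>"
    using that h_A_skew[of a "p i"] assms by (simp add: form_kernel_def h_A frame_simps h_simps)
  show "h a (v i) = 0" if "a \<in> form_kernel \<beta>"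
    using that h_B_skew[of a "q i"] assms by (simp add: form_kernel_def h_B frame_simps h_simps)
qed

lemma deform_inner_one: "deform_inner 1 h \<alpha> = h"
  by (simp add: deform_inner_def fun_eq_iff)

text \<open>By \<open>orth\<close> the vectors lie in a space of dimension 2n, so their matrix
  \<open>K\<close> of coefficients in the \<open>p i\<close> and \<open>q i\<close> is square and
  the Gram matrix factors as the transpose of \<open>K\<close> times a diagonal \<open>D\<close>
  times \<open>K\<close>. Parameter 1 gives the undeformed metric.\<close>

lemma det_gram_deform:
  fixes L :: "real^('n::finite + 'n) \<Rightarrow> 'v"
  assumes n: "n = CARD('n)" and t: "t > 0"
    and orth: "\<And>u i. i \<in> {1..n} \<Longrightarrow> h (L u) (v i) = 0"
  shows "det (\<chi> i j. deform_inner t h \<alpha> (L (axis i 1)) (L (axis j 1))) =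
    det (\<chi> i j. h (L (axis i 1)) (L (axis j 1)))"
proof -
  obtain b :: "'n \<Rightarrow> nat" where b: "bij_betw b UNIV {1..n}"
    using bij_betw_iff_card[of "UNIV :: 'n set" "{1..n}"] n by auto
  have bI: "b i \<in> {1..n}" for i
    using b by (auto simp: bij_betw_def)
  define w where "w k = (case k of Inl i \<Rightarrow> p (b i) | Inr i \<Rightarrow> q (b i))" for k :: "'n + 'n"
  define K :: "real^('n + 'n)^('n + 'n)" where "K = (\<chi> k i. h (L (axis i 1)) (w k))"
  have L: "L (axis i 1) = (\<Sum>k\<in>UNIV. (K $ k $ i) *\<^sub>R w k)" for i
  proof -
    have "L (axis i 1) = (\<Sum>k=1..n. h (L (axis i 1)) (p k) *\<^sub>R p k + h (L (axis i 1)) (q k) *\<^sub>R q k)"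
      by (rule trans[OF expansion sum.cong]) (simp_all add: orth)
    also have "\<dots> = (\<Sum>k\<in>UNIV. h (L (axis i 1)) (p (b k)) *\<^sub>R p (b k) + h (L (axis i 1)) (q (b k)) *\<^sub>R q (b k))"
      by (rule sum.reindex_bij_betw[OF b, symmetric])
    finally show ?thesis
      by (simp add: sum_UNIV_Plus w_def K_def sum.distrib)
  qed
  have det: "det (\<chi> i j. deform_inner s h \<alpha> (L (axis i 1)) (L (axis j 1))) = det K * det K" if s: "s > 0" for s
  proof -
    define d where "d k = (case k of Inl i \<Rightarrow> s | Inr i \<Rightarrow> 1 / s)" for k :: "'n + 'n"
    define D :: "real^('n + 'n)^('n + 'n)" where "D = (\<chi> i j. if i = j then d i else 0)"
    have dw: "deform_inner s h \<alpha> a (w k) = d k * h a (w k)" for a k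
      using s bI by (auto simp: w_def d_def deform_inner_frame split: sum.splits)
    have "deform_inner s h \<alpha> (L (axis i 1)) (L (axis j 1)) = (transpose K ** (D ** K)) $ i $ j" for i j
    proof -
      have "deform_inner s h \<alpha> (L (axis i 1)) (L (axis j 1)) =
          (\<Sum>k\<in>UNIV. K $ k $ j * deform_inner s h \<alpha> (L (axis i 1)) (w k))"
        by (simp add: L[of j] linear_sum[OF linear_deform_inner] linear_scale[OF linear_deform_inner])
      also have "\<dots> = (\<Sum>k\<in>UNIV. K $ k $ i * (d k * K $ k $ j))"
        by (rule sum.cong) (simp_all add: dw K_def)
      also have "\<dots> = (transpose K ** (D ** K)) $ i $ j"
        by (simp add: matrix_matrix_mult_def transpose_def D_def if_distrib[of "\<lambda>r. r * _"] cong: if_cong)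
      finally show ?thesis .
    qed
    then have "(\<chi> i j. deform_inner s h \<alpha> (L (axis i 1)) (L (axis j 1))) = transpose K ** (D ** K)"
      by (simp add: vec_eq_iff)
    moreover have "det D = 1"
    proof -
      have "det D = (\<Prod>i\<in>UNIV. d i)"
        using det_diagonal[of D] by (simp add: D_def)
      also have "\<dots> = s ^ CARD('n) * (1 / s) ^ CARD('n)"
        by (simp add: prod_UNIV_Plus d_def)
      also have "\<dots> = 1"
        using s by (simp add: power_mult_distrib[symmetric])
      finally show ?thesis .
    qed
    ultimately show ?thesis
      by (simp add: det_mul det_transpose)
  qed
  from det[OF t] det[of 1] show ?thesis
    by (simp add: deform_inner_one)
qed

end

text \<open>The metric enters the description of the measure only through the densities on chart
  ranges, so equal densities turn the two descriptions into the same predicate.\<close>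

lemma riemannian_volume_cong:
  assumes "\<And>c x. c \<in> N \<Longrightarrow> x \<in> chart_range c \<Longrightarrow> volume_density N c h x = volume_density N c h' x"
  shows "riemannian_volume N h = riemannian_volume N h'"
proof -
  have eq: "set_nn_integral lborel (snd c ` B) (\<lambda>x. ennreal (volume_density N c h x)) =
      set_nn_integral lborel (snd c ` B) (\<lambda>x. ennreal (volume_density N c h' x))"
    if c: "c \<in> N" and B: "B \<subseteq> fst c" for c B
  proof (rule nn_integral_cong)
    fix x
    show "ennreal (volume_density N c h x) * indicator (snd c ` B) x =
        ennreal (volume_density N c h' x) * indicator (snd c ` B) x"
    proof (cases "x \<in> snd c ` B")
      case True
      then have "x \<in> chart_range c"
        using B by (auto simp: chart_range_def)
      then show ?thesis
        using assms[OF c] by simp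
    qed simp
  qed
  have "riemannian_measure N h = riemannian_measure N h'"
    unfolding riemannian_measure_def
    by (intro arg_cong[of _ _ The] ext conj_cong ball_cong imp_cong refl arg_cong2[of _ _ _ _ "(=)"]) (rule eq)
  then show ?thesis
    by (simp add: riemannian_volume_def)
qed

context almost_2_kaehler
begin

lemma riemannian_volume_deform:
  fixes N :: "('a, real^('n::finite + 'n)) atlas"
  assumes n: "n = CARD('n)" and t: "t > 0" and jk: "(j, k) \<in> {(1, 2), (2, 1)}"
    and N: "connected_integral_manifold M (kernel_sum 2 \<omega>) N"
  shows "riemannian_volume N (induced_metric M (deformed_metric n j k t \<omega> g) N) =
    riemannian_volume N (induced_metric M g N)"
proof (rule riemannian_volume_cong)
  have sm: "smooth_map N M id" and mN: "smooth_manifold N"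
    and range: "\<And>q. q \<in> points N \<Longrightarrow> range (tangent_map N M id q) = kernel_sum 2 \<omega> q"
    using N by (simp_all add: connected_integral_manifold_def immersed_submanifold_def)
  fix c x assume c: "c \<in> N" and x: "x \<in> chart_range c"
  define y where "y = chart_inv c x"
  have y: "y \<in> fst c" "y \<in> points N"
    unfolding y_def using chart_inv_mem(1)[OF x] points_of_chart[OF c chart_inv_mem(1)[OF x]] .
  have yM: "y \<in> points M"
    using sm y by (auto simp: smooth_map_def)
  define L where "L u = tangent_map N M id y (from_coords N c y u)" for u
  obtain v p q where "kaehler_space n (g y) (\<omega> j y) (\<omega> k y) v p q"
    using kaehler_space_at[OF yM jk] by blast
  then interpret kaehler_space n "g y" "\<omega> j y" "\<omega> k y" v p q .
  have orth: "g y (L u) (v i) = 0" if i: "i \<in> {1..n}" for u i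
  proof -
    have "L u \<in> kernel_sum 2 \<omega> y"
      using range[OF y(2)] unfolding L_def by blast
    then obtain a where a: "L u = (\<Sum>l=1..2. a l)" "\<forall>l\<in>{1..2}. a l \<in> form_kernel (\<omega> l y)"
      unfolding kernel_sum_def by blast
    have jk': "{1..2} = {j, k}" "j \<noteq> k"
      using jk by auto
    have "L u = a j + a k" "a j \<in> form_kernel (\<omega> j y)" "a k \<in> form_kernel (\<omega> k y)"
      using a jk'(2) unfolding jk'(1) by simp_all
    then show ?thesis
      using form_kernel_orthogonal[OF i] by (simp only: h_simps)
  qed
  have det: "det (\<chi> i l. deform_inner t (g y) (\<omega> j y) (L (axis i 1)) (L (axis l 1))) =
      det (\<chi> i l. g y (L (axis i 1)) (L (axis l 1)))"
    by (rule det_gram_deform[OF n t]) (rule orth)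
  have local: "local_form N c (induced_metric M m N) x = (\<lambda>u v. m y (L u) (L v))" for m
    by (simp add: local_form_eq induced_metric_def L_def y_def)
  show "volume_density N c (induced_metric M (deformed_metric n j k t \<omega> g) N) x =
      volume_density N c (induced_metric M g N) x"
    unfolding volume_density_def local deformed_metric_eq[OF yM jk t] det ..
qed

end

section \<open>The Levi-Civita connection and integrability\<close>

text \<open>Product rule for the evaluation of a field of linear maps, of which only the derivatives
  at fixed vectors are known. Finite dimension reduces it to a sum over the basis.\<close>

lemma has_derivative_apply:
  fixes a :: "'a::real_normed_vector \<Rightarrow> 'e::euclidean_space \<Rightarrow> 'b::real_normed_vector"
  assumes S: "open S" "x \<in> S" and lin: "\<And>y. y \<in> S \<Longrightarrow> linear (a y)"
    and a: "\<And>v. ((\<lambda>y. a y v) has_derivative (\<lambda>u. a' u v)) (at x)"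
    and w: "(w has_derivative w') (at x)"
  shows "((\<lambda>y. a y (w y)) has_derivative (\<lambda>u. a' u (w x) + a x (w' u))) (at x)"
proof -
  \<comment> \<open>Splitting off \<open>w x\<close> produces \<open>a' u (w x)\<close> as it
    stands; expanding \<open>w y\<close> itself would leave a sum of values of \<open>a' u\<close>
    on the basis to be recombined.\<close>
  have d: "((\<lambda>y. a y (w x) + (\<Sum>b\<in>Basis. ((w y - w x) \<bullet> b) *\<^sub>R a y b)) has_derivative
      (\<lambda>u. a' u (w x) + (\<Sum>b\<in>Basis. ((w x - w x) \<bullet> b) *\<^sub>R a' u b + ((w' u - 0) \<bullet> b) *\<^sub>R a x b))) (at x)"
    by (intro has_derivative_add a has_derivative_sum has_derivative_scaleR has_derivative_inner_left
        has_derivative_diff w has_derivative_const)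
  have e1: "a y (w x) + (\<Sum>b\<in>Basis. ((w y - w x) \<bullet> b) *\<^sub>R a y b) = a y (w y)" if "y \<in> S" for y
  proof -
    note l = lin[OF that]
    have "(\<Sum>b\<in>Basis. ((w y - w x) \<bullet> b) *\<^sub>R a y b) = a y (\<Sum>b\<in>Basis. ((w y - w x) \<bullet> b) *\<^sub>R b)"
      by (simp add: linear_sum[OF l] linear_scale[OF l])
    also have "\<dots> = a y (w y) - a y (w x)"
      by (simp only: euclidean_representation linear_diff[OF l])
    finally show ?thesis by simp
  qed
  have e2: "(\<Sum>b\<in>Basis. ((w x - w x) \<bullet> b) *\<^sub>R a' u b + ((w' u - 0) \<bullet> b) *\<^sub>R a x b) = a x (w' u)" for u
  proof -
    note l = lin[OF S(2)]
    have "a x (w' u) = a x (\<Sum>b\<in>Basis. (w' u \<bullet> b) *\<^sub>R b)"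
      by (simp only: euclidean_representation)
    then show ?thesis
      by (simp add: linear_sum[OF l] linear_scale[OF l])
  qed
  show ?thesis
    by (rule has_derivative_transform_within_open[OF d[unfolded e2] S e1])
qed

lemma linear_derivative_family:
  fixes a :: "'a::real_normed_vector \<Rightarrow> 'e::real_vector \<Rightarrow> 'b::real_normed_vector"
  assumes S: "open S" "x \<in> S" and lin: "\<And>y. y \<in> S \<Longrightarrow> linear (a y)"
    and a: "\<And>v. ((\<lambda>y. a y v) has_derivative (\<lambda>u. a' u v)) (at x)"
  shows "linear (a' u)"
proof (rule linearI)
  fix v w r
  have "((\<lambda>y. a y v + a y w) has_derivative (\<lambda>u. a' u (v + w))) (at x)"
    by (rule has_derivative_transform_within_open[OF a S]) (simp add: lin linear_add)
  from has_derivative_unique[OF this has_derivative_add[OF a a]]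
  show "a' u (v + w) = a' u v + a' u w" by metis
  have "((\<lambda>y. r *\<^sub>R a y v) has_derivative (\<lambda>u. a' u (r *\<^sub>R v))) (at x)"
    by (rule has_derivative_transform_within_open[OF a S]) (simp add: lin linear_scale)
  from has_derivative_unique[OF this has_derivative_scaleR_right[OF a]]
  show "a' u (r *\<^sub>R v) = r *\<^sub>R a' u v" by metis
qed

lemma partial_form_linear:
  assumes M: "smooth_manifold M" and \<tau>: "smooth_bifield M \<tau>" and c: "c \<in> M" "x \<in> chart_range c"
  shows "linear (\<lambda>u. partial_form M c \<tau> x u v w)" "linear (\<lambda>v. partial_form M c \<tau> x u v w)"
    "linear (\<lambda>w. partial_form M c \<tau> x u v w)"
proof -
  note d = partial_form_has_derivative[OF \<tau> c]
  show "linear (\<lambda>u. partial_form M c \<tau> x u v w)"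
    using has_derivative_linear[OF d] .
  have b: "linear (local_form M c \<tau> y v)" "linear (\<lambda>v. local_form M c \<tau> y v w)" if "y \<in> chart_range c" for y v w
    using bilinear_local_form[OF M \<tau> c(1) that] by (simp_all add: bilinear_def)
  show "linear (\<lambda>v. partial_form M c \<tau> x u v w)"
    by (rule linear_derivative_family[of "chart_range c" x "\<lambda>y v. local_form M c \<tau> y v w"
          "\<lambda>u v. partial_form M c \<tau> x u v w", OF smooth_manifoldD(3)[OF M c(1)] c(2) b(2) d])
  show "linear (\<lambda>w. partial_form M c \<tau> x u v w)"
    by (rule linear_derivative_family[of "chart_range c" x "\<lambda>y w. local_form M c \<tau> y v w"
          "\<lambda>u w. partial_form M c \<tau> x u v w", OF smooth_manifoldD(3)[OF M c(1)] c(2) b(1) d])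
qed

text \<open>Applied with \<open>r = 1\<close> to metrics and with \<open>r = - 1\<close> to
  2-forms.\<close>

lemma partial_form_commute:
  assumes M: "smooth_manifold M" and c: "c \<in> M" "x \<in> chart_range c"
    and eq: "\<And>y v w. y \<in> chart_range c \<Longrightarrow> local_form M c \<tau> y v w = r * local_form M c \<tau> y w v"
    and \<tau>: "smooth_bifield M \<tau>"
  shows "partial_form M c \<tau> x u v w = r * partial_form M c \<tau> x u w v"
proof -
  have "((\<lambda>y. r * local_form M c \<tau> y w v) has_derivative (\<lambda>u. r * partial_form M c \<tau> x u w v)) (at x)"
    by (intro has_derivative_mult_right partial_form_has_derivative[OF \<tau> c])
  then have "((\<lambda>y. local_form M c \<tau> y v w) has_derivative (\<lambda>u. r * partial_form M c \<tau> x u w v)) (at x)"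
    by (rule has_derivative_transform_within_open[OF _ smooth_manifoldD(3)[OF M c(1)] c(2)])
      (rule eq[symmetric])
  from has_derivative_unique[OF partial_form_has_derivative[OF \<tau> c] this] show ?thesis
    by metis
qed

section \<open>Existence and uniqueness of the Levi-Civita connection, and the effect of
  integrability\<close>

definition is_levi_civita ::
    "('a, 'e::euclidean_space) atlas \<Rightarrow> ('a, 'e) chart \<Rightarrow> ('a, 'e) bifield \<Rightarrow> 'e \<Rightarrow> ('e \<Rightarrow> 'e \<Rightarrow> 'e) \<Rightarrow> bool" where
  "is_levi_civita M c g x \<Gamma> \<longleftrightarrow>
     bilinear \<Gamma> \<and> (\<forall>u v. \<Gamma> u v = \<Gamma> v u) \<and> (\<forall>u v w. cov_deriv M c \<Gamma> g x u v w = 0)"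

text \<open>The difference of two solutions, with an index lowered, is symmetric in the first two
  arguments and skew in the last two, hence zero.\<close>

lemma levi_civita_unique:
  assumes h: "inner_form (local_form M c g x)"
    and "is_levi_civita M c g x \<Gamma>" "is_levi_civita M c g x \<Gamma>'"
  shows "\<Gamma> = \<Gamma>'"
proof (intro ext inner_form_eqI[OF h])
  fix u v w
  define D where "D u v w = local_form M c g x (\<Gamma> u v) w - local_form M c g x (\<Gamma>' u v) w" for u v w
  have sym: "D u v w = D v u w" for u v w
    using assms(2,3) unfolding D_def is_levi_civita_def by metis
  have skew: "D u v w = - D u w v" for u v w
  proof -
    have "cov_deriv M c \<Gamma> g x u v w = 0" "cov_deriv M c \<Gamma>' g x u v w = 0"
      using assms(2,3) by (simp_all add: is_levi_civita_def)
    then show ?thesis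
      unfolding D_def cov_deriv_def inner_formD(3)[OF h, of v] by simp
  qed
  have "D u v w = 0"
    using skew[of u v w] sym[of u w v] skew[of w u v] sym[of w v u] skew[of v w u] sym[of v u w]
    by linarith
  then show "local_form M c g x (\<Gamma> u v) w = local_form M c g x (\<Gamma>' u v) w"
    by (simp add: D_def)
qed

lemma levi_civita_eqI:
  assumes "inner_form (local_form M c g x)" "is_levi_civita M c g x \<Gamma>"
  shows "levi_civita M c g x = \<Gamma>"
  unfolding levi_civita_def is_levi_civita_def[symmetric]
  using assms(2) levi_civita_unique[OF assms(1)] by (intro the_equality)

text \<open>Justifies the definite description \<open>levi_civita\<close>. Coordinate fields
  commute, so the Koszul formula has no bracket terms; it is linear in its last argument, and the
  Riesz lemma turns it into a vector.\<close>

lemma is_levi_civita_levi_civita: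
  assumes M: "smooth_manifold M" and g: "smooth_bifield M g" and c: "c \<in> M" "x \<in> chart_range c"
    and h: "\<And>y. y \<in> chart_range c \<Longrightarrow> inner_form (local_form M c g y)"
  shows "is_levi_civita M c g x (levi_civita M c g x)"
proof -
  note hx = h[OF c(2)]
  define P where "P = partial_form M c g x"
  have P: "linear (\<lambda>u. P u v w)" "linear (\<lambda>v. P u v w)" "linear (\<lambda>w. P u v w)" for u v w
    unfolding P_def by (rule partial_form_linear[OF M g c])+
  have P_commute: "P u v w = P u w v" for u v w
    using partial_form_commute[OF M c _ g, of 1 u v w] inner_formD(3)[OF h] unfolding P_def by simp
  \<comment> \<open>the right-hand side of the Koszul formula\<close>
  define K where "K u v w = (P u v w + P v u w - P w u v) / 2" for u v w
  have K: "K (a + b) v w = K a v w + K b v w" "K u (a + b) w = K u a w + K u b w"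
    "K u v (a + b) = K u v a + K u v b" "K (r *\<^sub>R a) v w = r * K a v w" "K u (r *\<^sub>R a) w = r * K u a w"
    "K u v (r *\<^sub>R a) = r * K u v a" for u v w a b r
    unfolding K_def linear_add[OF P(1)] linear_add[OF P(2)] linear_add[OF P(3)]
      linear_scale[OF P(1)] linear_scale[OF P(2)] linear_scale[OF P(3)]
    by (simp_all add: algebra_simps add_divide_distrib diff_divide_distrib)
  define \<Gamma> where "\<Gamma> u v = (THE y. \<forall>w. local_form M c g x y w = K u v w)" for u v
  have \<Gamma>: "local_form M c g x (\<Gamma> u v) w = K u v w" for u v w
  proof -
    have "linear (K u v)"
      by (rule linearI) (simp_all add: K)
    from theI'[OF inner_form_riesz[OF hx this]] show ?thesis
      unfolding \<Gamma>_def by blast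
  qed
  have "is_levi_civita M c g x \<Gamma>"
    unfolding is_levi_civita_def
  proof (intro conjI allI)
    have "linear (\<Gamma> u)" "linear (\<lambda>u. \<Gamma> u v)" for u v
      by (rule linearI; rule inner_form_eqI[OF hx]; simp add: \<Gamma> K inner_formD(5,7)[OF hx])+
    then show "bilinear \<Gamma>"
      by (simp add: bilinear_def)
    show "\<Gamma> u v = \<Gamma> v u" for u v
      by (rule inner_form_eqI[OF hx]) (simp add: \<Gamma> K_def P_commute[of _ u v])
    show "cov_deriv M c \<Gamma> g x u v w = 0" for u v w
      unfolding cov_deriv_def inner_formD(3)[OF hx, of v] \<Gamma> K_def
      using P_commute[of u v w] P_commute[of v u w] P_commute[of w u v] by (simp add: P_def field_simps)
  qed
  then show ?thesis
    using levi_civita_eqI[OF hx] by metis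
qed

text \<open>Involutivity in dual form: \<open>K\<close> is a vector-valued 1-form vanishing on the
  distribution, and its exterior derivative vanishes there too. In the straightening chart, with
  transition map \<open>\<phi>\<close>, \<open>K\<close> kills the image under
  \<open>\<phi>'\<close> of each constant \<open>f\<close> in \<open>F\<close>. Differentiating this
  expresses \<open>K'\<close> by \<open>K\<close> applied to the second derivative of
  \<open>\<phi>\<close>, which is symmetric.\<close>

lemma integrable_distribution_symmetric:
  fixes M :: "('a, 'e::euclidean_space) atlas" and K :: "'e \<Rightarrow> 'e \<Rightarrow> 'b::real_normed_vector"
  assumes M: "smooth_manifold M" and D: "integrable_distribution M D" and c: "c \<in> M" "x \<in> chart_range c"
    and lin: "\<And>y. y \<in> chart_range c \<Longrightarrow> linear (K y)"
    and deriv: "\<And>v. ((\<lambda>y. K y v) has_derivative (\<lambda>u. K' u v)) (at x)"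
    and zero: "\<And>y u. y \<in> chart_range c \<Longrightarrow> from_coords M c (chart_inv c y) u \<in> D (chart_inv c y) \<Longrightarrow> K y u = 0"
    and u: "from_coords M c (chart_inv c x) u \<in> D (chart_inv c x)"
    and v: "from_coords M c (chart_inv c x) v \<in> D (chart_inv c x)"
  shows "K' u v = K' v u"
proof -
  define p where "p = chart_inv c x"
  have p: "p \<in> fst c" "snd c p = x"
    using chart_inv_mem[OF c(2)] by (simp_all add: p_def)
  have ch: "is_chart c"
    using smooth_manifoldD(1)[OF M c(1)] .
  have pM: "p \<in> points M"
    using points_of_chart[OF c(1) p(1)] .
  obtain d where D': "\<forall>p\<in>points M. \<exists>c F. is_chart c \<and> p \<in> fst c \<and> fst c \<subseteq> points M \<and>
      (\<forall>d\<in>M. compatible_charts c d) \<and> subspace F \<and> dim F = d \<and>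
      (\<forall>q\<in>fst c. D q = {u. to_coords M c q u \<in> F})"
    using D unfolding integrable_distribution_def by (elim exE) (rule that)
  obtain c' F where chart: "is_chart c' \<and> p \<in> fst c' \<and> fst c' \<subseteq> points M \<and>
      (\<forall>d\<in>M. compatible_charts c' d) \<and> subspace F \<and> dim F = d \<and>
      (\<forall>q\<in>fst c'. D q = {u. to_coords M c' q u \<in> F})"
    using bspec[OF D' pM] by (elim exE) (rule that)
  note c' = chart[THEN conjunct1] chart[THEN conjunct2, THEN conjunct1]
    chart[THEN conjunct2, THEN conjunct2, THEN conjunct1]
  have c'_compat: "compatible_charts c' d" if "d \<in> M" for d
    using chart that by simp
  have DF: "D q = {u. to_coords M c' q u \<in> F}" if "q \<in> fst c'" for q
    using chart that by simp
  define \<phi> where "\<phi> = snd c \<circ> chart_inv c'"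
  define S where "S = snd c' ` (fst c' \<inter> fst c)"
  have sm: "smooth_on S \<phi>"
    using c'_compat[OF c(1)] by (simp add: compatible_charts_def S_def \<phi>_def)
  note S = smooth_onD(1)[OF sm]
  define z0 where "z0 = snd c' p"
  have z0: "z0 \<in> S" "\<phi> z0 = x"
    using p c' by (auto simp: z0_def S_def \<phi>_def chart_inv_snd)
  define \<phi>' where "\<phi>' z = frechet_derivative \<phi> (at z)" for z
  have \<phi>'_eq: "\<phi>' (snd c' q) = transition_deriv c' c q" for q
    by (simp add: \<phi>'_def \<phi>_def transition_deriv_def)
  \<comment> \<open>The reference chart at \<open>q\<close> is an intermediate chart for both maps
    and drops out of the composition.\<close>
  have coords: "to_coords M c' q (from_coords M c q w) = transition_deriv c c' q w"
    if q: "q \<in> fst c" "q \<in> fst c'" for q w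
  proof -
    note c0 = chart_at[OF points_of_chart[OF c(1) q(1)]]
    show ?thesis
      unfolding to_coords_eq from_coords_eq
      by (rule transition_deriv_compose[OF ch smooth_manifoldD(1)[OF M c0(1)]
            smooth_manifoldD(2)[OF M c(1) c0(1)] iffD1[OF compatible_charts_commute c'_compat[OF c0(1)]]
            q(1) c0(2) q(2), symmetric])
  qed
  have vanish: "K (\<phi> z) (\<phi>' z f) = 0" if z: "z \<in> S" and f: "f \<in> F" for z f
  proof -
    obtain q where q: "q \<in> fst c'" "q \<in> fst c" "z = snd c' q"
      using z by (auto simp: S_def)
    have y: "\<phi> z = snd c q" "chart_inv c (snd c q) = q" "snd c q \<in> chart_range c"
      using q c' ch by (auto simp: \<phi>_def chart_inv_snd chart_range_def)
    have "to_coords M c' q (from_coords M c q (\<phi>' z f)) = f"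
      unfolding coords[OF q(2,1)] q(3) \<phi>'_eq
      by (rule transition_deriv_inverse[OF c'(1) ch c'_compat[OF c(1)] q(1,2)])
    then have "from_coords M c q (\<phi>' z f) \<in> D q"
      using DF[OF q(1)] f by simp
    then show ?thesis
      using zero[of "snd c q" "\<phi>' z f"] y by simp
  qed
  have range: "\<phi> z \<in> chart_range c" if z: "z \<in> S" for z
  proof -
    obtain q where "q \<in> fst c'" "q \<in> fst c" "z = snd c' q"
      using z by (auto simp: S_def)
    then show ?thesis
      using c'(1) by (simp add: \<phi>_def chart_inv_snd chart_range_def)
  qed
  have second: "((\<lambda>z. \<phi>' z f) has_derivative frechet_derivative (\<lambda>z. \<phi>' z f) (at z0)) (at z0)" for f
  proof -
    have "Ck_on (Suc (Suc 0)) S \<phi>"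
      by (rule smooth_onD(2)[OF sm])
    then have "Ck_on (Suc 0) S (\<lambda>z. \<phi>' z f)"
      unfolding \<phi>'_def by simp
    then show ?thesis
      using z0(1) by (rule Ck_on_Suc_has_derivative)
  qed
  have key: "K' (\<phi>' z0 d) (\<phi>' z0 f) = - K x (frechet_derivative (\<lambda>z. \<phi>' z f) (at z0) d)" if f: "f \<in> F" for d f
  proof -
    have "((\<lambda>z. K (\<phi> z) (\<phi>' z f)) has_derivative
        (\<lambda>d. K' (\<phi>' z0 d) (\<phi>' z0 f) + K (\<phi> z0) (frechet_derivative (\<lambda>z. \<phi>' z f) (at z0) d))) (at z0)"
    proof (rule has_derivative_apply[of S z0 "\<lambda>z. K (\<phi> z)" "\<lambda>d. K' (\<phi>' z0 d)", OF S z0(1) _ _ second])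
      show "linear (K (\<phi> z))" if "z \<in> S" for z
        by (rule lin[OF range[OF that]])
      fix v
      have "((\<lambda>y. K y v) has_derivative (\<lambda>u. K' u v)) (at (\<phi> z0))"
        using deriv z0(2) by simp
      with smooth_onD(4)[OF sm z0(1)] show "((\<lambda>z. K (\<phi> z) v) has_derivative (\<lambda>d. K' (\<phi>' z0 d) v)) (at z0)"
        unfolding \<phi>'_def by (rule has_derivative_compose)
    qed
    moreover have "((\<lambda>z. K (\<phi> z) (\<phi>' z f)) has_derivative (\<lambda>d. 0)) (at z0)"
      by (rule has_derivative_transform_within_open[OF has_derivative_const[of 0] S z0(1)])
        (simp add: vanish f)
    ultimately have "K' (\<phi>' z0 d) (\<phi>' z0 f) + K (\<phi> z0) (frechet_derivative (\<lambda>z. \<phi>' z f) (at z0) d) = 0"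
      by (rule has_derivative_unique[THEN fun_cong])
    then show ?thesis
      using z0(2) by (simp add: eq_neg_iff_add_eq_0)
  qed
  have straight: "\<exists>f\<in>F. w = \<phi>' z0 f" if "from_coords M c p w \<in> D p" for w
  proof
    show "transition_deriv c c' p w \<in> F"
      using that DF[OF c'(2)] coords[OF p(1) c'(2)] by simp
    show "w = \<phi>' z0 (transition_deriv c c' p w)"
      unfolding z0_def \<phi>'_eq
      by (rule transition_deriv_inverse[OF ch c'(1) iffD1[OF compatible_charts_commute c'_compat[OF c(1)]]
            p(1) c'(2), symmetric])
  qed
  obtain f f' where "f \<in> F" "u = \<phi>' z0 f" "f' \<in> F" "v = \<phi>' z0 f'"
    using straight[of u] straight[of v] u v unfolding p_def[symmetric] by blast
  moreover have "frechet_derivative (\<lambda>z. \<phi>' z f) (at z0) f' = frechet_derivative (\<lambda>z. \<phi>' z f') (at z0) f"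
    unfolding \<phi>'_def by (rule second_derivative_symmetric[OF smooth_onD(2)[OF sm, of "Suc (Suc 0)"] S z0(1)])
  ultimately show ?thesis
    using key by simp
qed

section \<open>Covariant derivatives in a chart\<close>

lemma differentiable_sharp:
  fixes G \<Omega> :: "'a::real_normed_vector \<Rightarrow> real^'m::finite \<Rightarrow> real^'m \<Rightarrow> real"
  assumes S: "open S" "x \<in> S"
    and G: "\<And>x. x \<in> S \<Longrightarrow> inner_form (G x)" "\<And>u v. Ck_on (Suc 0) S (\<lambda>x. G x u v)"
    and \<Omega>: "\<And>x u. x \<in> S \<Longrightarrow> linear (\<Omega> x u)" "\<And>u v. Ck_on (Suc 0) S (\<lambda>x. \<Omega> x u v)"
  shows "((\<lambda>y. sharp (G y) (\<Omega> y) v) has_derivative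
    frechet_derivative (\<lambda>y. sharp (G y) (\<Omega> y) v) (at x)) (at x)"
proof -
  have "Ck_on (Suc 0) S (\<lambda>y. sharp (G y) (\<Omega> y) v $ i)" for i
    by (intro Ck_on_sharp S(1) G \<Omega>)
  then have "(\<lambda>y. sharp (G y) (\<Omega> y) v $ i) differentiable at x" for i
    using S(2) by simp
  then have "(\<lambda>y. \<Sum>i\<in>UNIV. (sharp (G y) (\<Omega> y) v $ i) *\<^sub>R (axis i 1 :: real^'m)) differentiable at x"
    by (intro differentiable_sum differentiable_scaleR differentiable_const) auto
  moreover have "(\<lambda>y. \<Sum>i\<in>UNIV. (sharp (G y) (\<Omega> y) v $ i) *\<^sub>R (axis i 1 :: real^'m)) =
      (\<lambda>y. sharp (G y) (\<Omega> y) v)"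
    by (simp add: scalar_mult_eq_scaleR[symmetric] basis_expansion)
  ultimately show ?thesis
    by (simp add: has_derivative_frechet)
qed

context almost_2_kaehler
begin

lemma kernel_sum_local:
  assumes c: "c \<in> M" "x \<in> chart_range c" and jk: "(j, k) \<in> {(1, 2), (2, 1)}"
  shows "from_coords M c (chart_inv c x) u \<in> kernel_sum 2 \<omega> (chart_inv c x) \<longleftrightarrow>
    (\<exists>a b. u = a + b \<and> a \<in> form_kernel (local_form M c (\<omega> j) x) \<and> b \<in> form_kernel (local_form M c (\<omega> k) x))"
proof -
  let ?p = "chart_inv c x"
  let ?F = "from_coords M c ?p" and ?G = "to_coords M c ?p"
  note FG = from_coords[OF manifold c(1) chart_inv_mem(1)[OF c(2)]]
  have jk': "{1..2} = {j, k}" "j \<noteq> k"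
    using jk by auto
  have ker: "a \<in> form_kernel (local_form M c (\<omega> l) x) \<longleftrightarrow> ?F a \<in> form_kernel (\<omega> l ?p)" for l a
    unfolding form_kernel_def local_form_eq mem_Collect_eq using FG(3) by metis
  have sum: "w \<in> kernel_sum 2 \<omega> ?p \<longleftrightarrow> (\<exists>a b. w = a + b \<and> a \<in> form_kernel (\<omega> j ?p) \<and> b \<in> form_kernel (\<omega> k ?p))" for w
  proof
    assume "w \<in> kernel_sum 2 \<omega> ?p"
    then obtain y where "w = (\<Sum>l\<in>{1..2}. y l)" "\<forall>l\<in>{1..2}. y l \<in> form_kernel (\<omega> l ?p)"
      unfolding kernel_sum_def by blast
    then have "w = y j + y k" "y j \<in> form_kernel (\<omega> j ?p)" "y k \<in> form_kernel (\<omega> k ?p)"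
      unfolding jk'(1) using jk'(2) by simp_all
    then show "\<exists>a b. w = a + b \<and> a \<in> form_kernel (\<omega> j ?p) \<and> b \<in> form_kernel (\<omega> k ?p)"
      by blast
  next
    assume "\<exists>a b. w = a + b \<and> a \<in> form_kernel (\<omega> j ?p) \<and> b \<in> form_kernel (\<omega> k ?p)"
    then obtain a b where ab: "w = a + b" "a \<in> form_kernel (\<omega> j ?p)" "b \<in> form_kernel (\<omega> k ?p)"
      by blast
    have "w = (\<Sum>l\<in>{1..2}. if l = j then a else b) \<and>
        (\<forall>l\<in>{1..2}. (if l = j then a else b) \<in> form_kernel (\<omega> l ?p))"
      unfolding jk'(1) using jk'(2) ab by simp
    then show "w \<in> kernel_sum 2 \<omega> ?p"
      unfolding kernel_sum_def by blast
  qed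
  show ?thesis
  proof
    assume "?F u \<in> kernel_sum 2 \<omega> ?p"
    then obtain a b where ab: "?F u = a + b" "a \<in> form_kernel (\<omega> j ?p)" "b \<in> form_kernel (\<omega> k ?p)"
      using sum by blast
    have "u = ?G a + ?G b"
      using FG(4)[of u] ab(1) linear_add[OF FG(2)] by simp
    then show "\<exists>a b. u = a + b \<and> a \<in> form_kernel (local_form M c (\<omega> j) x) \<and>
        b \<in> form_kernel (local_form M c (\<omega> k) x)"
      using ab(2,3) FG(3) unfolding ker by metis
  next
    assume "\<exists>a b. u = a + b \<and> a \<in> form_kernel (local_form M c (\<omega> j) x) \<and>
        b \<in> form_kernel (local_form M c (\<omega> k) x)"
    then show "?F u \<in> kernel_sum 2 \<omega> ?p"
      unfolding sum ker using linear_add[OF FG(1)] by blast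
  qed
qed

end

text \<open>One chart and one point, with \<open>A\<close> representing the form of index
  \<open>j\<close>. A second interpretation with \<open>j\<close> and \<open>k\<close> exchanged
  supplies the endomorphism of the other form.\<close>

locale almost_2_kaehler_chart = almost_2_kaehler n M \<omega> g
  for n :: nat and M :: "('a, real^'m::finite) atlas"
    and \<omega> :: "nat \<Rightarrow> ('a, real^'m) bifield" and g :: "('a, real^'m) bifield" +
  fixes c :: "('a, real^'m) chart" and x :: "real^'m" and j k :: nat
  assumes c: "c \<in> M" and x: "x \<in> chart_range c" and jk: "(j, k) \<in> {(1, 2), (2, 1)}"
begin

abbreviation "S \<equiv> chart_range c"
abbreviation "G \<equiv> local_form M c g"
abbreviation "O1 \<equiv> local_form M c (\<omega> j)"
abbreviation "\<Gamma> \<equiv> levi_civita M c g x"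
abbreviation "A y \<equiv> sharp (G y) (O1 y)"

definition "A' u v = frechet_derivative (\<lambda>y. A y v) (at x) u"
text \<open>The covariant derivative of the endomorphism field \<open>A\<close> at \<open>x\<close>,
  by the Leibniz rule.\<close>

definition "N u v = A' u v + \<Gamma> u (A x v) - A x (\<Gamma> u v)"

lemma S: "open S"
  by (rule smooth_manifoldD(3)[OF manifold c])

lemma j: "j \<in> {1, 2}" "k \<in> {1, 2}"
  using jk by auto

lemma G_inner: "y \<in> S \<Longrightarrow> inner_form (G y)"
  by (rule inner_local[OF c])

lemma O1_linear: "y \<in> S \<Longrightarrow> linear (O1 y u)" "y \<in> S \<Longrightarrow> linear (\<lambda>u. O1 y u v)"
  using bilinear_local_form[OF manifold smooth_form[OF j(1)] c] by (simp_all add: bilinear_def)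

lemma A_linear: "y \<in> S \<Longrightarrow> linear (A y)"
  using kaehler_space_local[OF c _ jk] kaehler_space.linear_A by blast

lemma G_A: "y \<in> S \<Longrightarrow> G y (A y v) w = O1 y v w"
  using kaehler_space_local[OF c _ jk] kaehler_space.h_A by blast

lemma A_skew: "y \<in> S \<Longrightarrow> G y (A y v) w = - G y v (A y w)"
  using kaehler_space_local[OF c _ jk] kaehler_space.h_A_skew by blast

lemma A_derivative: "((\<lambda>y. A y v) has_derivative (\<lambda>u. A' u v)) (at x)"
  unfolding A'_def
  by (rule differentiable_sharp[OF S x G_inner _ O1_linear(1)])
    (use smooth_onD(2)[OF smooth_bifieldD(2)[OF smooth_metric c]]
      smooth_onD(2)[OF smooth_bifieldD(2)[OF smooth_form[OF j(1)] c]] in blast)+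

lemma A'_linear: "linear (A' u)" "linear (\<lambda>u. A' u v)"
proof -
  show "linear (A' u)"
    by (rule linear_derivative_family[of S x A A', OF S x A_linear A_derivative])
  show "linear (\<lambda>u. A' u v)"
    by (rule has_derivative_linear[OF A_derivative])
qed

lemma levi_civita: "is_levi_civita M c g x \<Gamma>"
  by (rule is_levi_civita_levi_civita[OF manifold smooth_metric c x G_inner])

lemma \<Gamma>_bilinear: "bilinear \<Gamma>" and \<Gamma>_commute: "\<Gamma> u v = \<Gamma> v u"
  and metric_parallel: "partial_form M c g x u v w = G x (\<Gamma> u v) w + G x v (\<Gamma> u w)"
proof -
  show "bilinear \<Gamma>" "\<Gamma> u v = \<Gamma> v u"
    using levi_civita unfolding is_levi_civita_def by blast+
  have "cov_deriv M c \<Gamma> g x u v w = 0"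
    using levi_civita unfolding is_levi_civita_def by blast
  then show "partial_form M c g x u v w = G x (\<Gamma> u v) w + G x v (\<Gamma> u w)"
    unfolding cov_deriv_def by linarith
qed

lemma N_linear: "linear (N u)" "linear (\<lambda>u. N u v)"
proof -
  have \<Gamma>l: "linear (\<Gamma> u)" "linear (\<lambda>u. \<Gamma> u v)" for u v
    using \<Gamma>_bilinear by (simp_all add: bilinear_def)
  show "linear (N u)"
    unfolding N_def
    by (rule linearI) (simp_all add: linear_add[OF A'_linear(1)] linear_add[OF A_linear[OF x]] linear_add[OF \<Gamma>l(1)]
        linear_scale[OF A'_linear(1)] linear_scale[OF A_linear[OF x]] linear_scale[OF \<Gamma>l(1)] algebra_simps)
  show "linear (\<lambda>u. N u v)"
    unfolding N_def
    by (rule linearI) (simp_all add: linear_add[OF A'_linear(2)] linear_add[OF A_linear[OF x]] linear_add[OF \<Gamma>l(2)]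
        linear_scale[OF A'_linear(2)] linear_scale[OF A_linear[OF x]] linear_scale[OF \<Gamma>l(2)] algebra_simps)
qed

lemma G_derivative:
  assumes "(a has_derivative a') (at x)" "(b has_derivative b') (at x)"
  shows "((\<lambda>y. G y (a y) (b y)) has_derivative
    (\<lambda>u. partial_form M c g x u (a x) (b x) + G x (a' u) (b x) + G x (a x) (b' u))) (at x)"
proof (rule has_derivative_apply[OF S x _ _ assms(2)])
  show "linear (G y (a y))" if "y \<in> S" for y
    by (rule inner_formD(1)[OF G_inner[OF that]])
  show "((\<lambda>y. G y (a y) v) has_derivative
      (\<lambda>u. partial_form M c g x u (a x) v + G x (a' u) v)) (at x)" for v
    by (rule has_derivative_apply[of S x "\<lambda>y a. G y a v" "\<lambda>u a. partial_form M c g x u a v", OF S x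
          inner_formD(2)[OF G_inner] partial_form_has_derivative[OF smooth_metric c x] assms(1)])
qed

lemma G_N: "G x (N u v) w = G x (A' u v) w + G x (\<Gamma> u (A x v)) w - G x (A x (\<Gamma> u v)) w"
  unfolding N_def by (simp only: inner_formD(5,6)[OF G_inner[OF x]])

text \<open>Since the metric is parallel, raising an index commutes with covariant
  differentiation.\<close>

lemma cov_deriv_form: "cov_deriv M c \<Gamma> (\<omega> j) x u v w = G x (N u v) w"
proof -
  have "((\<lambda>y. G y (A y v) w) has_derivative
      (\<lambda>u. partial_form M c g x u (A x v) w + G x (A' u v) w + G x (A x v) 0)) (at x)"
    by (rule G_derivative[OF A_derivative has_derivative_const])
  then have "((\<lambda>y. O1 y v w) has_derivative
      (\<lambda>u. partial_form M c g x u (A x v) w + G x (A' u v) w + G x (A x v) 0)) (at x)"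
    by (rule has_derivative_transform_within_open[OF _ S x]) (rule G_A)
  from has_derivative_unique[OF partial_form_has_derivative[OF smooth_form[OF j(1)] c x] this]
  have "partial_form M c (\<omega> j) x u v w = partial_form M c g x u (A x v) w + G x (A' u v) w + G x (A x v) 0"
    by (rule fun_cong)
  moreover have "G x (A x v) 0 = 0"
    by (rule inner_formD(15)[OF G_inner[OF x]])
  ultimately show ?thesis
    unfolding cov_deriv_def
    using G_N[of u v w] metric_parallel[of u "A x v" w] G_A[OF x, of "\<Gamma> u v" w] G_A[OF x, of v "\<Gamma> u w"]
    by linarith
qed

lemma local_deformed_metric:
  assumes "y \<in> S" "t > 0"
  shows "local_form M c (deformed_metric n j k t \<omega> g) y = deform_inner t (G y) (O1 y)"
proof -
  have "local_form M c (deformed_metric n j k t \<omega> g) y = local_form M c (\<lambda>p. deform_inner t (g p) (\<omega> j p)) y"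
    by (rule local_form_cong[OF c assms(1) deformed_metric_eq[OF _ jk assms(2)]])
  then show ?thesis
    using local_form_deform[OF c assms(1) j(1)] by simp
qed

text \<open>The multiple of \<open>g\<close> contributes nothing because \<open>g\<close> is
  parallel; the rest is the Leibniz rule for g(A., A.).\<close>

lemma cov_deriv_deform:
  assumes t: "t > 0"
  shows "cov_deriv M c \<Gamma> (deformed_metric n j k t \<omega> g) x u v w =
    (t - 1 / t) * (G x (N u v) (A x w) + G x (A x v) (N u w))"
proof -
  note loc = local_deformed_metric[OF _ t]
  have "((\<lambda>y. (1 / t) * G y v w + (t - 1 / t) * G y (A y v) (A y w)) has_derivative
      (\<lambda>u. (1 / t) * partial_form M c g x u v w + (t - 1 / t) * (partial_form M c g x u (A x v) (A x w) +
        G x (A' u v) (A x w) + G x (A x v) (A' u w)))) (at x)"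
    by (intro has_derivative_add has_derivative_mult_right G_derivative A_derivative
        partial_form_has_derivative smooth_metric c x)
  then have "((\<lambda>y. local_form M c (deformed_metric n j k t \<omega> g) y v w) has_derivative
      (\<lambda>u. (1 / t) * partial_form M c g x u v w + (t - 1 / t) * (partial_form M c g x u (A x v) (A x w) +
        G x (A' u v) (A x w) + G x (A x v) (A' u w)))) (at x)"
    by (rule has_derivative_transform_within_open[OF _ S x])
      (simp add: loc deform_inner_def sharp_form_def)
  then have pf: "partial_form M c (deformed_metric n j k t \<omega> g) x u v w =
      (1 / t) * partial_form M c g x u v w + (t - 1 / t) * (partial_form M c g x u (A x v) (A x w) +
        G x (A' u v) (A x w) + G x (A x v) (A' u w))"
    unfolding partial_form_def[of M c "deformed_metric n j k t \<omega> g"] by (simp add: frechet_derivative_eq)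
  have N': "G x (A x v) (N u w) = G x (A x v) (A' u w) + G x (A x v) (\<Gamma> u (A x w)) - G x (A x v) (A x (\<Gamma> u w))"
    unfolding N_def by (simp only: inner_formD(11,12)[OF G_inner[OF x]])
  define r where "r = 1 / t"
  show ?thesis
    unfolding cov_deriv_def pf loc[OF x] deform_inner_def sharp_form_def G_N N' metric_parallel r_def[symmetric]
    by (simp only: algebra_simps)
qed

lemma form_skew: "y \<in> S \<Longrightarrow> O1 y v w = - 1 * O1 y w v"
  using A_skew[of y v w] inner_formD(3)[OF G_inner, of y v "A y w"] by (simp add: G_A)

lemma partial_form_skew: "partial_form M c (\<omega> j) x u v w = - 1 * partial_form M c (\<omega> j) x u w v"
  by (rule partial_form_commute[OF manifold c x form_skew smooth_form[OF j(1)]])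

lemma N_skew: "G x (N u v) w = - G x (N u w) v"
  unfolding cov_deriv_form[symmetric] cov_deriv_def
  using form_skew[OF x, of "\<Gamma> u v" w] form_skew[OF x, of v "\<Gamma> u w"] partial_form_skew[of u v w]
  by linarith

text \<open>For a torsion-free connection the exterior derivative is the cyclic sum of the covariant
  derivative: the Christoffel terms cancel by symmetry of \<open>\<Gamma>\<close>.\<close>

lemma N_cyclic: "G x (N u v) w + G x (N v w) u + G x (N w u) v = 0"
proof -
  have "exterior_deriv M c (\<omega> j) x u v w = 0"
    using closed[OF j(1)] c x unfolding closed_two_form_def by blast
  then show ?thesis
    unfolding cov_deriv_form[symmetric] cov_deriv_def exterior_deriv_def
      \<Gamma>_commute[of v u] \<Gamma>_commute[of w u] \<Gamma>_commute[of w v]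
    using partial_form_skew[of v u w] form_skew[OF x, of w "\<Gamma> u v"] form_skew[OF x, of v "\<Gamma> u w"]
      form_skew[OF x, of u "\<Gamma> v w"] by linarith
qed

end

text \<open>On the image of \<open>B\<close> the form \<open>sharp_form h \<beta>\<close> agrees
  with \<open>h\<close> because \<open>B B B = - B\<close>, so the metric deformed along
  \<open>\<beta>\<close> is t times \<open>h\<close> there.\<close>

lemma (in kaehler_space) deform_inner_A:
  assumes "t > 0"
  shows "deform_inner t h \<beta> (B a) b = - t * h a (B b)"
proof -
  have "sharp_form h \<beta> (B a) b = h (B a) b"
    using h_B_skew[of "B (B a)" b] by (simp add: sharp_form_def AB_identities(4) h_simps)
  then have "deform_inner t h \<beta> (B a) b = t * h (B a) b"
    by (simp add: deform_inner_def algebra_simps)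
  then show ?thesis
    by (simp add: h_B_skew)
qed

section \<open>Parallel forms under the two deformations\<close>

context almost_2_kaehler_chart
begin

lemma other_chart: "almost_2_kaehler_chart n M \<omega> g c x k j"
  using c x jk by unfold_locales auto

text \<open>A vector field \<open>w\<close> with covariant derivatives \<open>W u\<close> at \<open>x\<close> has the ordinary derivative
  \<open>W u - \<Gamma> u (w x)\<close>; the next rules compute \<open>W\<close> for composite fields.\<close>

lemma has_cov_deriv_const: "((\<lambda>y. v) has_derivative (\<lambda>u. \<Gamma> u v - \<Gamma> u v)) (at x)"
  by simp

lemma has_cov_deriv_A:
  assumes "(w has_derivative (\<lambda>u. W u - \<Gamma> u (w x))) (at x)"
  shows "((\<lambda>y. A y (w y)) has_derivative (\<lambda>u. (N u (w x) + A x (W u)) - \<Gamma> u (A x (w x)))) (at x)"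
proof -
  have "((\<lambda>y. A y (w y)) has_derivative (\<lambda>u. A' u (w x) + A x (W u - \<Gamma> u (w x)))) (at x)"
    by (rule has_derivative_apply[OF S x A_linear A_derivative assms])
  moreover have "A' u (w x) + A x (W u - \<Gamma> u (w x)) = (N u (w x) + A x (W u)) - \<Gamma> u (A x (w x))" for u
    by (simp add: N_def linear_diff[OF A_linear[OF x]])
  ultimately show ?thesis
    by simp
qed

lemma has_cov_deriv_add:
  assumes "(w has_derivative (\<lambda>u. W u - \<Gamma> u (w x))) (at x)"
    and "(z has_derivative (\<lambda>u. Z u - \<Gamma> u (z x))) (at x)"
  shows "((\<lambda>y. w y + z y) has_derivative (\<lambda>u. (W u + Z u) - \<Gamma> u (w x + z x))) (at x)"
proof -
  have "\<Gamma> u (w x + z x) = \<Gamma> u (w x) + \<Gamma> u (z x)" for u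
    using \<Gamma>_bilinear by (simp add: bilinear_def linear_add)
  then show ?thesis
    using has_derivative_add[OF assms] by (simp add: algebra_simps)
qed

text \<open>Converts an identity between endomorphism fields, valid on the whole chart, into its
  covariant derivative at \<open>x\<close>.\<close>

lemma cov_deriv_zero_field:
  assumes "(w has_derivative (\<lambda>u. W u - \<Gamma> u (w x))) (at x)" and zero: "\<And>y. y \<in> S \<Longrightarrow> w y = 0"
  shows "W u = 0"
proof -
  have "(w has_derivative (\<lambda>u. 0)) (at x)"
    by (rule has_derivative_transform_within_open[OF has_derivative_const[of 0] S x]) (simp add: zero)
  from fun_cong[OF has_derivative_unique[OF assms(1) this], of u]
  have "W u - \<Gamma> u (w x) = 0" .
  moreover have "\<Gamma> u 0 = 0"
    using \<Gamma>_bilinear by (simp add: bilinear_def linear_0)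
  ultimately show ?thesis
    by (simp add: zero x)
qed

lemma parallel_imp_N_zero:
  assumes "\<And>u v w. cov_deriv M c \<Gamma> (\<omega> j) x u v w = 0"
  shows "N u v = 0"
proof (rule inner_form_eqI[OF G_inner[OF x]])
  show "G x (N u v) w = G x 0 w" for w
    using assms[of u v w] by (simp add: cov_deriv_form inner_formD(9)[OF G_inner[OF x]])
qed

lemma inner_deformed_metric:
  assumes t: "t > 0"
  shows "inner_form (local_form M c (deformed_metric n j k t \<omega> g) x)"
  unfolding local_deformed_metric[OF x t]
  using kaehler_space_local[OF c x jk] kaehler_space.inner_form_deform[OF _ t] by blast

lemma parallel_deform_own:
  assumes par: "\<And>u v w. cov_deriv M c \<Gamma> (\<omega> j) x u v w = 0" and t: "t > 0"
  shows "cov_deriv M c (levi_civita M c (deformed_metric n j k t \<omega> g) x) (\<omega> j) x u v w = 0"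
proof -
  have "is_levi_civita M c (deformed_metric n j k t \<omega> g) x \<Gamma>"
    unfolding is_levi_civita_def cov_deriv_deform[OF t] parallel_imp_N_zero[OF par]
    using \<Gamma>_bilinear \<Gamma>_commute by (simp add: inner_formD(9,15)[OF G_inner[OF x]])
  then have "levi_civita M c (deformed_metric n j k t \<omega> g) x = \<Gamma>"
    by (rule levi_civita_eqI[OF inner_deformed_metric[OF t]])
  then show ?thesis
    using par by simp
qed

text \<open>If \<open>\<omega> j\<close> is parallel for \<open>g\<close>, the Levi-Civita connection of the metric deformed along \<open>\<omega> k\<close>
  differs from that of \<open>g\<close> by a multiple of \<open>B \<circ> \<nabla>B\<close>, where \<open>B\<close> is the endomorphism
  representing \<open>\<omega> k\<close>. The two properties of \<open>B \<circ> \<nabla>B\<close> provided by \<open>parallel_transfer\<close> say that the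
  new connection is torsion-free and preserves \<open>\<omega> j\<close>.\<close>

lemma parallel_deform_other:
  assumes par: "\<And>u v w. cov_deriv M c \<Gamma> (\<omega> j) x u v w = 0" and t: "t > 0"
  shows "cov_deriv M c (levi_civita M c (deformed_metric n k j t \<omega> g) x) (\<omega> j) x u v w = 0"
proof -
  interpret b: almost_2_kaehler_chart n M \<omega> g c x k j
    by (rule other_chart)
  note N0 = parallel_imp_N_zero[OF par]
  obtain e p q where "kaehler_space n (G x) (O1 x) (b.O1 x) e p q"
    using kaehler_space_local[OF c x jk] by blast
  then interpret ks: kaehler_space n "G x" "O1 x" "b.O1 x" e p q .
  have A: "((\<lambda>y. A y (w y)) has_derivative (\<lambda>u. A x (W u) - \<Gamma> u (A x (w x)))) (at x)"
    if "(w has_derivative (\<lambda>u. W u - \<Gamma> u (w x))) (at x)" for w W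
    using has_cov_deriv_A[OF that] by (simp add: N0)
  have at_y: "A y (A y (b.A y a)) + b.A y (A y (A y a)) = - b.A y a" "b.A y (A y (b.A y a)) = 0"
    "b.A y (b.A y (b.A y a)) = - b.A y a" if y: "y \<in> S" for y a
  proof -
    obtain v' p' q' where k: "kaehler_space n (G y) (O1 y) (b.O1 y) v' p' q'"
      using kaehler_space_local[OF c y jk] by blast
    show "A y (A y (b.A y a)) + b.A y (A y (A y a)) = - b.A y a" "b.A y (A y (b.A y a)) = 0"
      "b.A y (b.A y (b.A y a)) = - b.A y a"
      by (rule kaehler_space.AB_identities(1)[OF k] kaehler_space.AB_identities(3)[OF k]
          kaehler_space.AB_identities(4)[OF k])+
  qed
  have AAB: "b.N u (A x (A x a)) + A x (A x (b.N u a)) = - b.N u a" for u a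
  proof -
    \<comment> \<open>The constant field \<open>a\<close> has covariant derivative
      \<open>\<Gamma> u a\<close>. The terms containing it add up to the undifferentiated identity
      at \<open>\<Gamma> u a\<close> and cancel; the same happens for \<open>BAB\<close> and
      \<open>BBB\<close>.\<close>
    have "A x (A x (b.N u a + b.A x (\<Gamma> u a))) + (b.N u (A x (A x a)) + b.A x (A x (A x (\<Gamma> u a)))) +
        (b.N u a + b.A x (\<Gamma> u a)) = 0"
      by (rule cov_deriv_zero_field[OF has_cov_deriv_add[OF has_cov_deriv_add[OF
              A[OF A[OF b.has_cov_deriv_A[OF has_cov_deriv_const]]]
              b.has_cov_deriv_A[OF A[OF A[OF has_cov_deriv_const]]]]
              b.has_cov_deriv_A[OF has_cov_deriv_const]]])
        (simp add: at_y)
    then show ?thesis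
      using at_y(1)[OF x, of "\<Gamma> u a"]
      by (simp add: ks.frame_simps(7) add_eq_0_iff algebra_simps)
  qed
  have BAB: "b.N u (A x (b.A x a)) + b.A x (A x (b.N u a)) = 0" for u a
  proof -
    have "b.N u (A x (b.A x a)) + b.A x (A x (b.N u a + b.A x (\<Gamma> u a))) = 0"
      by (rule cov_deriv_zero_field[OF b.has_cov_deriv_A[OF A[OF b.has_cov_deriv_A[OF has_cov_deriv_const]]]])
        (simp add: at_y)
    then show ?thesis
      using at_y(2)[OF x, of "\<Gamma> u a"] by (simp add: ks.linear_A_simps ks.linear_B_simps)
  qed
  have BBB: "b.N u (b.A x (b.A x a)) + b.A x (b.N u (b.A x a)) + b.A x (b.A x (b.N u a)) = - b.N u a" for u a
  proof -
    have "b.N u (b.A x (b.A x a)) + b.A x (b.N u (b.A x a) + b.A x (b.N u a + b.A x (\<Gamma> u a))) +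
        (b.N u a + b.A x (\<Gamma> u a)) = 0"
      by (rule cov_deriv_zero_field[OF has_cov_deriv_add[OF
              b.has_cov_deriv_A[OF b.has_cov_deriv_A[OF b.has_cov_deriv_A[OF has_cov_deriv_const]]]
              b.has_cov_deriv_A[OF has_cov_deriv_const]]])
        (simp add: at_y)
    then show ?thesis
      using at_y(3)[OF x, of "\<Gamma> u a"] by (simp add: ks.linear_B_simps algebra_simps add_eq_0_iff)
  qed
  have involutive: "b.N (q i) (p l) = 0" if i: "i \<in> {1..n}" and l: "l \<in> {1..n}" for i l
  proof -
    \<comment> \<open>B A A vanishes on the kernel of \<open>A\<close> trivially, and on the kernel
      of \<open>B\<close> by the first identity of \<open>AB_identities\<close>. It is thus a field
      of linear maps killing the integrable distribution.\<close>
    define K where "K y a = b.A y (A y (A y a))" for y a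
    define K' where "K' u a = b.N u (A x (A x a)) + K x (\<Gamma> u a) - \<Gamma> u (K x a)" for u a
    have deriv: "((\<lambda>y. K y a) has_derivative (\<lambda>u. K' u a)) (at x)" for a
      unfolding K_def K'_def by (rule b.has_cov_deriv_A[OF A[OF A[OF has_cov_deriv_const]]])
    have "K' (q i) (p l) = K' (p l) (q i)"
    proof (rule integrable_distribution_symmetric[OF manifold integrable c x _ deriv])
      show "linear (K y)" if "y \<in> S" for y
        unfolding K_def using linear_compose[OF linear_compose[OF A_linear[OF that] A_linear[OF that]] b.A_linear[OF that]]
        by (simp add: o_def)
      show "K y a = 0" if y: "y \<in> S" and a: "from_coords M c (chart_inv c y) a \<in> kernel_sum 2 \<omega> (chart_inv c y)" for y a
      proof -
        obtain v' p' q' where "kaehler_space n (G y) (O1 y) (b.O1 y) v' p' q'"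
          using kaehler_space_local[OF c y jk] by blast
        then interpret y: kaehler_space n "G y" "O1 y" "b.O1 y" v' p' q' .
        obtain a1 a2 where a: "a = a1 + a2" "a1 \<in> form_kernel (O1 y)" "a2 \<in> form_kernel (b.O1 y)"
          using a unfolding kernel_sum_local[OF c y jk] by blast
        have "A y a1 = 0" "b.A y a2 = 0"
          using a(2,3) inner_formD(9)[OF G_inner[OF y]]
          by (auto intro!: inner_form_eqI[OF G_inner[OF y]] simp: form_kernel_def G_A[OF y] b.G_A[OF y])
        then show ?thesis
          using at_y(1)[OF y, of a2] unfolding K_def a(1) by (simp add: y.linear_A_simps y.linear_B_simps)
      qed
      have ker: "q i \<in> form_kernel (O1 x)" "p l \<in> form_kernel (b.O1 x)"
        using i l by (simp_all add: form_kernel_def G_A[OF x, symmetric] b.G_A[OF x, symmetric] ks.frame_simps ks.h_simps)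
      have zero: "0 \<in> form_kernel (O1 x)" "0 \<in> form_kernel (b.O1 x)"
        by (simp_all add: form_kernel_def G_A[OF x, symmetric] b.G_A[OF x, symmetric] ks.frame_simps ks.h_simps)
      show "from_coords M c (chart_inv c x) (q i) \<in> kernel_sum 2 \<omega> (chart_inv c x)"
        unfolding kernel_sum_local[OF c x jk] using ker(1) zero(2) by (intro exI[of _ "q i"] exI[of _ 0]) simp
      show "from_coords M c (chart_inv c x) (p l) \<in> kernel_sum 2 \<omega> (chart_inv c x)"
        unfolding kernel_sum_local[OF c x jk] using ker(2) zero(1) by (intro exI[of _ 0] exI[of _ "p l"]) simp
    qed
    moreover have "K x (q i) = 0" "K x (p l) = 0"
      using i l by (simp_all add: K_def ks.frame_simps)
    moreover have "\<Gamma> u 0 = 0" "b.N u 0 = 0" "b.N u (- a) = - b.N u a" for u a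
      using \<Gamma>_bilinear linear_neg[OF b.N_linear(1)] linear_0[OF b.N_linear(1)] by (simp_all add: bilinear_def linear_0)
    \<comment> \<open>\<open>A A\<close> is -1 on \<open>p l\<close> and 0 on \<open>q i\<close>. Up
      to the Christoffel terms, which agree by symmetry of \<open>\<Gamma>\<close>, the two sides
      are \<open>- b.N (q i) (p l)\<close> and 0.\<close>
    ultimately show ?thesis
      using i l \<Gamma>_commute[of "q i" "p l"] by (simp add: K'_def ks.frame_simps)
  qed
  note transfer = ks.parallel_transfer[of b.N, OF b.N_linear AAB BAB BBB b.N_skew b.N_cyclic involutive]
  \<comment> \<open>Solves (t - 1/t) + r t = 0: the first term is the factor in
    \<open>cov_deriv_deform\<close>, and t is the factor by which the deformed metric acts on the
    image of \<open>B\<close>.\<close>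
  define r where "r = - (t - 1 / t) / t"
  define \<Gamma>' where "\<Gamma>' u v = \<Gamma> u v + r *\<^sub>R b.A x (b.N u v)" for u v
  let ?h = "deformed_metric n k j t \<omega> g"
  have inner: "inner_form (local_form M c ?h x)"
    by (rule b.inner_deformed_metric[OF t])
  have "is_levi_civita M c ?h x \<Gamma>'"
    unfolding is_levi_civita_def
  proof (intro conjI allI)
    have lin: "linear (\<Gamma> u)" "linear (\<lambda>u. \<Gamma> u v)" for u v
      using \<Gamma>_bilinear by (simp_all add: bilinear_def)
    show "bilinear \<Gamma>'"
      unfolding bilinear_def \<Gamma>'_def
      by (intro conjI allI linear_compose_add linear_compose_scale_right lin ks.linear_compose_AB b.N_linear)
    show "\<Gamma>' u v = \<Gamma>' v u" for u v
      unfolding \<Gamma>'_def using \<Gamma>_commute[of u v] transfer(1)[of u v] by simp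
    show "cov_deriv M c \<Gamma>' ?h x u v w = 0" for u v w
    proof -
      have h: "local_form M c ?h x (b.A x (b.N u v)) w = - t * G x (b.N u v) (b.A x w)" for u v w
        unfolding b.local_deformed_metric[OF x t] by (rule ks.deform_inner_A[OF t])
      have "cov_deriv M c \<Gamma>' ?h x u v w = cov_deriv M c \<Gamma> ?h x u v w
          - r * local_form M c ?h x (b.A x (b.N u v)) w - r * local_form M c ?h x v (b.A x (b.N u w))"
        unfolding cov_deriv_def \<Gamma>'_def
        by (simp only: inner_formD(5,7,11,13)[OF inner])
      also have "local_form M c ?h x v (b.A x (b.N u w)) = local_form M c ?h x (b.A x (b.N u w)) v"
        by (rule inner_formD(3)[OF inner])
      finally show ?thesis
        unfolding h b.cov_deriv_deform[OF t] r_def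
        using t ks.h_commute[of "b.A x v" "b.N u w"] by (simp add: field_simps)
    qed
  qed
  then have LC: "levi_civita M c ?h x = \<Gamma>'"
    by (rule levi_civita_eqI[OF inner])
  have "cov_deriv M c \<Gamma>' (\<omega> j) x u v w = cov_deriv M c \<Gamma> (\<omega> j) x u v w
      - r * (G x (A x (b.A x (b.N u v))) w - G x (A x (b.A x (b.N u w))) v)"
  proof -
    have "O1 x (a + r *\<^sub>R a') b = O1 x a b + r * O1 x a' b" "O1 x b (a + r *\<^sub>R a') = O1 x b a + r * O1 x b a'" for a a' b
      using linear_add[OF O1_linear(1)[OF x]] linear_scale[OF O1_linear(1)[OF x]]
        linear_add[OF O1_linear(2)[OF x]] linear_scale[OF O1_linear(2)[OF x]] by simp_all
    then show ?thesis
      unfolding cov_deriv_def \<Gamma>'_def G_A[OF x]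
      using form_skew[OF x, of v "b.A x (b.N u w)"] by (simp add: algebra_simps)
  qed
  then show ?thesis
    unfolding LC par using transfer(2)[of u v w] by simp
qed

end

section \<open>From pointwise statements to the manifold\<close>

lemma (in almost_2_kaehler) covariantly_constant_deform:
  assumes jk: "(j, k) \<in> {(1, 2), (2, 1)}" and t: "t > 0" and i: "i \<in> {1, 2}"
    and par: "covariantly_constant M g (\<omega> i)"
  shows "covariantly_constant M (deformed_metric n j k t \<omega> g) (\<omega> i)"
  unfolding covariantly_constant_def
proof (intro ballI allI)
  fix c x u v w assume c: "c \<in> M" and x: "x \<in> chart_range c"
  have par': "cov_deriv M c (levi_civita M c g x) (\<omega> i) x u v w = 0" for u v w
    using par c x by (simp add: covariantly_constant_def)
  have kj: "(k, j) \<in> {(1, 2), (2, 1)}"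
    using jk by auto
  interpret own: almost_2_kaehler_chart n M \<omega> g c x j k
    by unfold_locales (rule c x jk)+
  interpret other: almost_2_kaehler_chart n M \<omega> g c x k j
    by unfold_locales (rule c x kj)+
  have "i = j \<or> i = k"
    using i jk by auto
  then show "cov_deriv M c (levi_civita M c (deformed_metric n j k t \<omega> g) x) (\<omega> i) x u v w = 0"
    using own.parallel_deform_own[OF _ t] other.parallel_deform_other[OF _ t] par' by metis
qed

text \<open>Rescaling a form does not change its kernel, so the deformed structure has the same
  leaves, and only their volumes have to be compared.\<close>

lemma self_dual_deform:
  fixes M :: "('a, real^('n::finite + 'n + 'n)) atlas"
  assumes "almost_2_kaehler CARD('n) M \<omega> g" and t: "t > 0" and sd: "self_dual (M, \<omega>, g)"
  shows "self_dual (alpha_deform CARD('n) t (M, \<omega>, g))" "self_dual (beta_deform CARD('n) t (M, \<omega>, g))"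
proof -
  interpret almost_2_kaehler "CARD('n)" M \<omega> g
    by (rule assms(1))
  have weak: "weakly_self_dual CARD('n) (M, \<omega>, g)"
    using sd by (simp add: self_dual_def)
  have vol: "riemannian_volume N (induced_metric M (deformed_metric CARD('n) j k t \<omega> g) N) = 1"
    if "leaf M (kernel_sum 2 \<omega>) N" "(j, k) \<in> {(1, 2), (2, 1)}" for N :: "('a, real^('n + 'n)) atlas" and j k
  proof -
    have "connected_integral_manifold M (kernel_sum 2 \<omega>) N"
      using that(1) by (simp add: leaf_def)
    from riemannian_volume_deform[OF refl t that(2) this] show ?thesis
      using sd that(1) by (simp add: self_dual_def)
  qed
  have t0: "t \<noteq> 0"
    using t by simp
  show "self_dual (alpha_deform CARD('n) t (M, \<omega>, g))"
    unfolding self_dual_def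
    using weakly_self_dual_deform(1)[OF t weak] vol[of _ 1 2]
    by (simp add: alpha_deform_def kernel_sum_scale_one[OF t0])
  show "self_dual (beta_deform CARD('n) t (M, \<omega>, g))"
    unfolding self_dual_def
    using weakly_self_dual_deform(2)[OF t weak] vol[of _ 2 1]
    by (simp add: beta_deform_def kernel_sum_scale_one[OF t0])
qed

theorem proposition2p11:
  fixes M :: "('a, real^('n::finite + 'n + 'n)) atlas"
    and \<omega> :: "nat \<Rightarrow> ('a, real^('n + 'n + 'n)) bifield"
    and g :: "('a, real^('n + 'n + 'n)) bifield"
    and X :: "('a, real^('n + 'n + 'n)) kaehler_data"
    and n :: nat and t :: real
  assumes "n = CARD('n)"
    and "X = (M, \<omega>, g)"
    and "almost_kaehler n 2 X"
    and "t > 0"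
  shows "(almost_kaehler n 2 (alpha_deform n t X) \<and>
          almost_kaehler n 2 (beta_deform n t X) \<and>
          almost_kaehler n 2 (lambda_deform t X)) \<and>
         ((\<forall>p\<in>points M. dualizing_form n (alpha_deform n t X) p = dualizing_form n X p) \<and>
          (\<forall>p\<in>points M. dualizing_form n (beta_deform n t X) p = dualizing_form n X p) \<and>
          (weakly_self_dual n X \<longrightarrow>
             weakly_self_dual n (alpha_deform n t X) \<and> weakly_self_dual n (beta_deform n t X)) \<and>
          (self_dual X \<longrightarrow>
             self_dual (alpha_deform n t X) \<and> self_dual (beta_deform n t X))) \<and>
         (\<forall>i\<in>{1, 2}. covariantly_constant M g (\<omega> i) \<longrightarrow>
            covariantly_constant M (deformed_metric n 1 2 t \<omega> g) (\<omega> i) \<and>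
            covariantly_constant M (deformed_metric n 2 1 t \<omega> g) (\<omega> i))"
proof -
  note t = \<open>t > 0\<close>
  have loc: "almost_2_kaehler n M \<omega> g"
    using assms(2,3) by (simp add: almost_2_kaehler_def)
  interpret almost_2_kaehler n M \<omega> g
    by (rule loc)
  have "self_dual X \<Longrightarrow> self_dual (alpha_deform n t X)" "self_dual X \<Longrightarrow> self_dual (beta_deform n t X)"
    using self_dual_deform[of M \<omega> g t] loc t unfolding assms(1,2) by blast+
  then show ?thesis
    using almost_kaehler_alpha[OF t] almost_kaehler_beta[OF t] almost_kaehler_lambda[OF t]
      dualizing_form_alpha[OF _ t] dualizing_form_beta[OF _ t] weakly_self_dual_deform[OF t]
      covariantly_constant_deform[OF _ t, of 1 2] covariantly_constant_deform[OF _ t, of 2 1]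
    unfolding assms(2) by (intro conjI ballI impI) simp_all
qed

end
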